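(* Let $C_*=2/(1-\log 2)$ and suppose $p=p(n)$ satisfies $C_*\log n/n\le p$ and $p=o(n^{-1/2})$. Let $G\sim G(n,p)$. Then for every fixed $\varepsilon$ with $0<\varepsilon<1/2$ and all integers $d=d(n)$, as $n\to\infty$, \[ \mathbb P(G\text{ is }d\text{-rigid})\to\begin{cases}1 & \text{if } d<(1/2-\varepsilon)np,\\ 0 & \text{if } d>(1/2+\varepsilon)np.\end{cases} \]
   Context: $G(n,p)$ is the Erdős–Rényi random graph on vertex set $[n]$ with each edge present independently with probability $p$; $\log$ is the natural logarithm. For a graph $G=(V,E)$ and integer $d\ge1$, an embedding $\mathbf p:V\to\mathbb R^d$ is generic if its $d|V|$ coordinates are algebraically independent over $\mathbb Q$. The rigidity matrix $R(G,\mathbf p)$ is the $|E|\times d|V|$ matrix whose row indexed by $xy\in E$ contains $(\mathbf p(x)-\mathbf p(y))^T$ in the coordinates of $x$, $(\mathbf p(y)-\mathbf p(x))^T$ in the coordinates of $y$, and $0$ elsewhere. A graph with $|V|>d$ is $d$-rigid if for a generic $\mathbf p$, $\operatorname{rank}R(G,\mathbf p)=d|V|-\binom{d+1}{2}$ (independent of the choice of generic $\mathbf p$). *)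

theory Defs
  imports Complex_Main "HOL-Library.Landau_Symbols"
begin

definition all_edges :: "nat \<Rightarrow> (nat \<times> nat) set" where
  "all_edges n = {(x, y). x < y \<and> y < n}"

definition prob_Gnp :: "nat \<Rightarrow> real \<Rightarrow> ((nat \<times> nat) set \<Rightarrow> bool) \<Rightarrow> real" where
  "prob_Gnp n p P =
     (\<Sum>E\<in>{E. E \<subseteq> all_edges n \<and> P E}.
        p ^ card E * (1 - p) ^ (card (all_edges n) - card E))"

text \<open>Algebraic independence over Q of the family (x j) indexed by the finite set I:
  no nontrivial rational polynomial relation in the variables x j, j in I.
  A polynomial is a finite set M of monomials (exponent vectors supported on I)
  with rational coefficients c.\<close>
definition alg_indep_Q :: "'i set \<Rightarrow> ('i \<Rightarrow> real) \<Rightarrow> bool" where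
  "alg_indep_Q I x \<longleftrightarrow>
     (\<forall>(M :: ('i \<Rightarrow> nat) set) (c :: ('i \<Rightarrow> nat) \<Rightarrow> rat).
        finite M \<longrightarrow> (\<forall>m\<in>M. \<forall>j. j \<notin> I \<longrightarrow> m j = 0) \<longrightarrow>
        (\<Sum>m\<in>M. of_rat (c m) * (\<Prod>j\<in>I. x j ^ m j)) = 0 \<longrightarrow>
        (\<forall>m\<in>M. c m = 0))"

text \<open>An embedding q : [n] \<rightarrow> R^d is given by q v i (vertex v < n, coordinate i < d).\<close>
definition generic :: "nat \<Rightarrow> nat \<Rightarrow> (nat \<Rightarrow> nat \<Rightarrow> real) \<Rightarrow> bool" where
  "generic n d q \<longleftrightarrow> alg_indep_Q ({0..<n} \<times> {0..<d}) (\<lambda>(v, i). q v i)"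

text \<open>Row of the rigidity matrix R(G,q) indexed by the edge (x,y); its columns are
  indexed by (v,i) with v < n, i < d.\<close>
definition rig_row :: "(nat \<Rightarrow> nat \<Rightarrow> real) \<Rightarrow> nat \<times> nat \<Rightarrow> nat \<times> nat \<Rightarrow> real" where
  "rig_row q e = (\<lambda>(v, i). if v = fst e then q (fst e) i - q (snd e) i
                          else if v = snd e then q (snd e) i - q (fst e) i else 0)"

definition rows_indep :: "nat \<Rightarrow> nat \<Rightarrow> (nat \<Rightarrow> nat \<Rightarrow> real) \<Rightarrow> (nat \<times> nat) set \<Rightarrow> bool" where
  "rows_indep n d q F \<longleftrightarrow>
     (\<forall>c :: nat \<times> nat \<Rightarrow> real.
        (\<forall>v<n. \<forall>i<d. (\<Sum>e\<in>F. c e * rig_row q e (v, i)) = 0) \<longrightarrow> (\<forall>e\<in>F. c e = 0))"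

definition rig_rank :: "nat \<Rightarrow> nat \<Rightarrow> (nat \<times> nat) set \<Rightarrow> (nat \<Rightarrow> nat \<Rightarrow> real) \<Rightarrow> nat" where
  "rig_rank n d E q = Max {card F | F. F \<subseteq> E \<and> rows_indep n d q F}"

text \<open>d-rigidity of the graph ([n], E). For n > d as in the paper; for n \<le> d we use the
  standard convention that only the complete graph is d-rigid.\<close>
definition d_rigid :: "nat \<Rightarrow> nat \<Rightarrow> (nat \<times> nat) set \<Rightarrow> bool" where
  "d_rigid n d E \<longleftrightarrow>
     (if d < n then (\<forall>q. generic n d q \<longrightarrow> rig_rank n d E q = d * n - (d + 1 choose 2))
      else E = all_edges n)"

definition C_star :: real where
  "C_star = 2 / (1 - ln 2)"

end

theory Submission
  imports Defs "HOL-Library.Function_Algebras" "HOL-Analysis.Analysis" "HOL-Real_Asymp.Real_Asymp"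
begin

text \<open>Let \<open>C\<close> be the closure of \<open>G\<close> in the generic \<open>d\<close>-dimensional rigidity matroid. A vertex whose
  \<open>C\<close>-neighbourhood is not a clique can be added by a 1-extension, which raises the rank by
  \<open>d + 1\<close> instead of \<open>d\<close>. Since the rank is at most \<open>d n\<close> and \<open>d\<^sup>2 = o(n)\<close>, almost all vertices of
  linear degree in \<open>C\<close> are simplicial, so \<open>C\<close> is, up to \<open>o(n\<^sup>2)\<close> edges, a disjoint union of boundedly
  many cliques. For each of the exponentially many candidates \<open>M\<close> for this union, exposing the edges
  one at a time gives, up to an error exponentially small in \<open>n\<^sup>2 p\<close>,
  \<open>rk C \<ge> rk M + (expected number of edges of G outside C)\<close>.
  If the cliques occupy the proportions \<open>a\<^sub>i\<close> of the vertices and \<open>d n = (1 - 2 \<epsilon>) n\<^sup>2 p / 2\<close>, this reads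
  \<open>(1 - 2 \<epsilon>) (1 - \<Sum>a\<^sub>i) \<ge> 1 - \<Sum>a\<^sub>i\<^sup>2\<close> up to \<open>o(1)\<close>, which forces one clique to contain almost all
  vertices. Finally, for \<open>p \<ge> C_star ln n / n\<close> every small nonempty vertex set sends more than \<open>d\<close>
  edges per vertex to its complement, so the clique absorbs the remaining vertices. Above the
  threshold there are too few edges to reach full rank.\<close>

subsection \<open>Polynomial functions and generic points\<close>

text \<open>The closure \<open>C\<close> depends on the random graph, so the edges outside it cannot
  be counted as if \<open>C\<close> were fixed. The remedy is to put the deterministic set
  \<open>M\<close> in first: if \<open>M \<subseteq> C\<close>, adding \<open>M\<close> does not
  change the span of \<open>G\<close>, and relative to a fixed \<open>M\<close> each exposed pair
  outside the current span raises the rank with probability p. The price is a union bound over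
  (K+1)^n colourings. It is affordable because K is a constant while the error exponent is of order
  n^2 p, hence at least of order n ln n.

  The value of \<open>C_star\<close> comes from single vertices: d is just below n p / 2, and a
  binomial variable of mean n p falls to half its mean with probability about exp (-(1 - ln 2) n p /
  2). This drops to 1/n when n p = \<open>C_star\<close> ln n.

  The bound p = o(n^(-1/2)) enters because the set \<open>U0\<close> has order d + ln n vertices,
  and its size times d bounds the number of nonsimplicial vertices; this product has to be a small
  fraction of n.\<close>

definition monom_val :: "'i set \<Rightarrow> ('i \<Rightarrow> nat) \<Rightarrow> ('i \<Rightarrow> real) \<Rightarrow> real" where
  "monom_val I m x = (\<Prod>j\<in>I. x j ^ m j)"

definition supported :: "'i set \<Rightarrow> ('i \<Rightarrow> nat) set" where
  "supported I = {m. \<forall>j. j \<notin> I \<longrightarrow> m j = 0}"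

text \<open>A property of the function rather than a polynomial type: \<open>M\<close> and
  \<open>c\<close> are exactly the data over which \<open>alg_indep_Q\<close> quantifies.\<close>

definition poly_rep :: "'i set \<Rightarrow> (('i \<Rightarrow> real) \<Rightarrow> real) \<Rightarrow> bool" where
  "poly_rep I f \<longleftrightarrow> (\<exists>M c. finite M \<and> M \<subseteq> supported I \<and>
     f = (\<lambda>x. \<Sum>m\<in>M. of_rat (c m) * monom_val I m x))"

lemma poly_rep_const: "poly_rep I (\<lambda>x. of_rat r)"
  unfolding poly_rep_def
  by (rule exI[of _ "{\<lambda>_. 0}"], rule exI[of _ "\<lambda>_. r"]) (simp add: supported_def monom_val_def)

lemma poly_rep_monom: "m \<in> supported I \<Longrightarrow> poly_rep I (\<lambda>x. of_rat r * monom_val I m x)"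
  unfolding poly_rep_def by (rule exI[of _ "{m}"], rule exI[of _ "\<lambda>_. r"]) simp

lemma poly_rep_add:
  assumes "poly_rep I f" "poly_rep I g"
  shows "poly_rep I (\<lambda>x. f x + g x)"
proof -
  obtain M c where M: "finite M" "M \<subseteq> supported I"
      "f = (\<lambda>x. \<Sum>m\<in>M. of_rat (c m) * monom_val I m x)"
    using assms(1) unfolding poly_rep_def by blast
  obtain M' c' where M': "finite M'" "M' \<subseteq> supported I"
      "g = (\<lambda>x. \<Sum>m\<in>M'. of_rat (c' m) * monom_val I m x)"
    using assms(2) unfolding poly_rep_def by blast
  let ?c = "\<lambda>m. (if m \<in> M then c m else 0) + (if m \<in> M' then c' m else 0)"
  have "f x + g x = (\<Sum>m\<in>M \<union> M'. of_rat (?c m) * monom_val I m x)" for x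
  proof -
    have "f x = (\<Sum>m\<in>M \<union> M'. of_rat (if m \<in> M then c m else 0) * monom_val I m x)"
      unfolding M(3) using M(1) M'(1) by (intro sum.mono_neutral_cong_left) auto
    moreover have "g x = (\<Sum>m\<in>M \<union> M'. of_rat (if m \<in> M' then c' m else 0) * monom_val I m x)"
      unfolding M'(3) using M(1) M'(1) by (intro sum.mono_neutral_cong_left) auto
    ultimately show ?thesis
      by (simp add: sum.distrib[symmetric] of_rat_add distrib_right del: sum.distrib)
  qed
  then show ?thesis
    unfolding poly_rep_def using M M' by (intro exI[of _ "M \<union> M'"] exI[of _ ?c]) auto
qed

lemma poly_rep_sum:
  "finite A \<Longrightarrow> (\<And>a. a \<in> A \<Longrightarrow> poly_rep I (f a)) \<Longrightarrow> poly_rep I (\<lambda>x. \<Sum>a\<in>A. f a x)"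
proof (induction A rule: finite_induct)
  case empty
  then show ?case using poly_rep_const[of I 0] by simp
next
  case (insert a A)
  then show ?case by (simp add: poly_rep_add)
qed

lemma poly_rep_mult:
  assumes "poly_rep I f" "poly_rep I g"
  shows "poly_rep I (\<lambda>x. f x * g x)"
proof -
  obtain M c where M: "finite M" "M \<subseteq> supported I"
      "f = (\<lambda>x. \<Sum>m\<in>M. of_rat (c m) * monom_val I m x)"
    using assms(1) unfolding poly_rep_def by blast
  obtain M' c' where M': "finite M'" "M' \<subseteq> supported I"
      "g = (\<lambda>x. \<Sum>m\<in>M'. of_rat (c' m) * monom_val I m x)"
    using assms(2) unfolding poly_rep_def by blast
  \<comment> \<open>Different pairs may yield the same exponent vector, so this is only a sum of
    monomial functions; \<open>poly_rep_sum\<close> merges the repetitions.\<close>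
  have "(\<lambda>x. f x * g x) =
      (\<lambda>x. \<Sum>a\<in>M \<times> M'. of_rat (c (fst a) * c' (snd a)) *
        monom_val I (\<lambda>j. fst a j + snd a j) x)"
    unfolding M(3) M'(3) sum_product sum.cartesian_product
    by (intro ext sum.cong) (auto simp: monom_val_def power_add prod.distrib of_rat_mult)
  moreover have "poly_rep I \<dots>"
    using M M' by (intro poly_rep_sum poly_rep_monom) (auto simp: supported_def)
  ultimately show ?thesis by simp
qed

lemma poly_rep_var:
  assumes "finite I" "j \<in> I"
  shows "poly_rep I (\<lambda>x. x j)"
proof -
  have "monom_val I (\<lambda>k. if k = j then 1 else 0) x = x j" for x
  proof -
    have "monom_val I (\<lambda>k. if k = j then 1 else 0) x = (\<Prod>k\<in>I. if k = j then x k else 1)"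
      unfolding monom_val_def by (intro prod.cong) auto
    then show ?thesis using assms by (simp add: prod.delta)
  qed
  moreover have "poly_rep I (\<lambda>x. of_rat 1 * monom_val I (\<lambda>k. if k = j then 1 else 0) x)"
    by (rule poly_rep_monom) (use assms in \<open>auto simp: supported_def\<close>)
  ultimately show ?thesis by simp
qed

lemma poly_rep_diff:
  assumes "poly_rep I f" "poly_rep I g"
  shows "poly_rep I (\<lambda>x. f x - g x)"
  using poly_rep_add[OF assms(1) poly_rep_mult[OF poly_rep_const[of I "-1"] assms(2)]]
  by (simp add: of_rat_minus)

text \<open>The gateway through which genericity is used, always in contrapositive form: a rational
  polynomial that is nonzero somewhere is nonzero at the generic point.\<close>

lemma alg_indep_Q_poly_zero:
  assumes "alg_indep_Q I x" "poly_rep I f" "f x = 0"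
  shows "f y = 0"
proof -
  obtain M c where M: "finite M" "M \<subseteq> supported I"
      "f = (\<lambda>x. \<Sum>m\<in>M. of_rat (c m) * monom_val I m x)"
    using assms(2) unfolding poly_rep_def by blast
  have "\<forall>m\<in>M. c m = 0"
    using assms(1)[unfolded alg_indep_Q_def, rule_format, of M c] assms(3) M
    by (auto simp: supported_def monom_val_def)
  then show ?thesis unfolding M(3) by simp
qed



text \<open>There are only countably many rational polynomials. With \<open>x\<close> substituted,
  each nonzero one becomes a nonzero polynomial in the new coordinate, because some coefficient
  would otherwise be an algebraic relation of \<open>x\<close>. So the values to avoid form a
  countable union of finite sets.\<close>

lemma alg_indep_Q_extend:
  fixes x :: "'i \<Rightarrow> real"
  assumes "finite I" "j \<notin> I" "alg_indep_Q I x"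
  shows "\<exists>y. alg_indep_Q (insert j I) (x(j := y))"
proof -
  define J where "J = insert j I"
  have finJ: "finite J" using assms by (simp add: J_def)
  define S where "S = supported J"
  have cS: "countable S"
  proof -
    have "S \<subseteq> (\<lambda>g. \<lambda>i. if i \<in> J then g i else 0) ` (PiE J (\<lambda>_. UNIV :: nat set))"
    proof
      fix m assume "m \<in> S"
      then have "m = (\<lambda>i. if i \<in> J then (restrict m J) i else 0)"
        by (auto simp: S_def supported_def)
      then show "m \<in> (\<lambda>g. \<lambda>i. if i \<in> J then g i else 0) ` (PiE J (\<lambda>_. UNIV :: nat set))"
        by (rule image_eqI[where x = "restrict m J"]) auto
    qed
    moreover have "countable (PiE J (\<lambda>_. UNIV :: nat set))"
      using finJ by (intro countable_PiE) auto
    ultimately show ?thesis by (meson countable_image countable_subset)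
  qed
  \<comment> \<open>\<open>PiE\<close> forgets the coefficients outside \<open>M\<close>; without
    this the coefficient functions would be uncountably many.\<close>
  define Q where "Q = (SIGMA M : {M. M \<subseteq> S \<and> finite M}. PiE M (\<lambda>_. UNIV :: rat set))"
  have cQ: "countable Q"
  proof -
    have "countable {M. M \<subseteq> S \<and> finite M}"
      using countable_Collect_finite_subset[OF cS] by (simp add: conj_commute)
    then show ?thesis
      unfolding Q_def by (intro countable_SIGMA countable_PiE) auto
  qed
  define val where "val = (\<lambda>(M, c) y. \<Sum>m\<in>M. real_of_rat (c m) * monom_val J m (x(j := y)))"
  define bad where "bad = (\<Union>(M, c) \<in> {Mc \<in> Q. \<exists>m\<in>fst Mc. snd Mc m \<noteq> 0}. {y. val (M, c) y = 0})"
  have fin: "finite {y. val (M, c) y = 0}" if MQ: "(M, c) \<in> Q" and nz: "\<exists>m\<in>M. c m \<noteq> 0" for M c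
  proof -
    have M: "finite M" "M \<subseteq> supported J" using MQ by (auto simp: Q_def S_def)
    define P where "P = (\<Sum>m\<in>M. monom (real_of_rat (c m) * monom_val I m x) (m j))"
    have *: "monom_val J m (x(j := y)) = y ^ m j * monom_val I m x" for m y
    proof -
      have "monom_val I m (x(j := y)) = monom_val I m x"
        using assms(2) unfolding monom_val_def by (intro prod.cong) auto
      then show ?thesis using assms(1,2) by (simp add: monom_val_def J_def)
    qed
    have P: "poly P y = val (M, c) y" for y
      unfolding P_def val_def by (simp add: poly_sum poly_monom * algebra_simps)
    obtain m0 where m0: "m0 \<in> M" "c m0 \<noteq> 0" using nz by blast
    \<comment> \<open>All monomials with the same power of the new variable as \<open>m0\<close>.
      Deleting that variable (\<open>rd\<close>) is injective on them, so they contribute distinct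
      monomials of \<open>x\<close> to one coefficient of \<open>P\<close>, and \<open>m0\<close>
      has a nonzero factor there.\<close>
    define M1 where "M1 = {m \<in> M. m j = m0 j}"
    define rd where "rd = (\<lambda>m::'i\<Rightarrow>nat. m(j := 0))"
    have inj: "inj_on rd M1"
    proof (rule inj_onI)
      fix m m' assume a: "m \<in> M1" "m' \<in> M1" "rd m = rd m'"
      show "m = m'"
      proof
        fix i show "m i = m' i"
          using a(1,2) fun_cong[OF a(3)[unfolded rd_def], of i]
          by (cases "i = j") (simp_all add: M1_def)
      qed
    qed
    have "coeff P (m0 j) \<noteq> 0"
    proof
      assume z: "coeff P (m0 j) = 0"
      have "coeff P (m0 j) = (\<Sum>m\<in>M. if m j = m0 j then real_of_rat (c m) * monom_val I m x else 0)"
        unfolding P_def by (simp add: coeff_sum)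
      also have "\<dots> = (\<Sum>m\<in>M1. real_of_rat (c m) * monom_val I m x)"
        unfolding M1_def using M(1) by (simp add: sum.inter_filter)
      also have "\<dots> = (\<Sum>m\<in>rd ` M1. real_of_rat (c (inv_into M1 rd m)) * monom_val I m x)"
      proof (subst sum.reindex[OF inj], intro sum.cong refl)
        fix m assume m: "m \<in> M1"
        have "monom_val I (rd m) x = monom_val I m x"
          using assms(2) unfolding monom_val_def rd_def by (intro prod.cong) auto
        then show "real_of_rat (c m) * monom_val I m x =
          ((\<lambda>m. real_of_rat (c (inv_into M1 rd m)) * monom_val I m x) \<circ> rd) m"
          using m inj by simp
      qed
      finally have z': "(\<Sum>m\<in>rd ` M1. real_of_rat (c (inv_into M1 rd m)) * (\<Prod>i\<in>I. x i ^ m i)) = 0"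
        using z by (simp add: monom_val_def)
      have "\<forall>m\<in>rd ` M1. c (inv_into M1 rd m) = 0"
      proof (rule assms(3)[unfolded alg_indep_Q_def, THEN spec, THEN spec, THEN mp, THEN mp, THEN mp])
        show "finite (rd ` M1)" using M(1) by (simp add: M1_def)
        show "\<forall>m\<in>rd ` M1. \<forall>i. i \<notin> I \<longrightarrow> m i = 0"
          using M(2) by (auto simp: rd_def M1_def supported_def J_def)
      qed (use z' in auto)
      then show False using m0 inj by (auto simp: M1_def)
    qed
    then have "P \<noteq> 0" by auto
    then show ?thesis using poly_roots_finite[of P] by (simp add: P)
  qed
  have "countable bad"
    unfolding bad_def
    by (intro countable_UN countable_subset[OF _ cQ]) (auto intro!: countable_finite fin)
  then obtain y where y: "y \<notin> bad"
    using uncountable_UNIV_real by (metis UNIV_eq_I)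
  have "alg_indep_Q J (x(j := y))"
    unfolding alg_indep_Q_def
  proof (intro allI impI)
    fix M :: "('i \<Rightarrow> nat) set" and c :: "('i \<Rightarrow> nat) \<Rightarrow> rat"
    assume a: "finite M" "\<forall>m\<in>M. \<forall>i. i \<notin> J \<longrightarrow> m i = 0"
      "(\<Sum>m\<in>M. of_rat (c m) * (\<Prod>i\<in>J. (x(j := y)) i ^ m i)) = 0"
    have inQ: "(M, restrict c M) \<in> Q"
      using a by (auto simp: Q_def S_def supported_def)
    have "val (M, restrict c M) y = 0"
      using a(3) by (simp add: val_def monom_val_def)
    then show "\<forall>m\<in>M. c m = 0"
      using y inQ unfolding bad_def by fastforce
  qed
  then show ?thesis by (auto simp: J_def)
qed

lemma alg_indep_Q_exists:
  assumes "finite I"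
  shows "\<exists>x :: 'i \<Rightarrow> real. alg_indep_Q I x"
  using assms
proof (induction I rule: finite_induct)
  case empty
  have "alg_indep_Q {} (\<lambda>_::'i. 0 :: real)"
    unfolding alg_indep_Q_def
  proof (intro allI impI)
    fix M :: "('i \<Rightarrow> nat) set" and c :: "('i \<Rightarrow> nat) \<Rightarrow> rat"
    assume a: "finite M" "\<forall>m\<in>M. \<forall>j. j \<notin> {} \<longrightarrow> m j = 0"
      and s: "(\<Sum>m\<in>M. of_rat (c m) * (\<Prod>j\<in>{}. (0::real) ^ m j)) = 0"
    have "M \<subseteq> {\<lambda>_. 0}" using a(2) by auto
    then consider "M = {}" | "M = {\<lambda>_. 0}" by blast
    then show "\<forall>m\<in>M. c m = 0" using s by cases auto
  qed
  then show ?case by blast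
next
  case (insert j I)
  from insert.IH obtain x :: "'i \<Rightarrow> real" where "alg_indep_Q I x" ..
  from alg_indep_Q_extend[OF insert.hyps(1,2) this] show ?case by (elim exE) (rule exI)
qed

text \<open>Excludes that \<open>d_rigid\<close> holds vacuously, and supplies the one framework in
  which all ranks are computed.\<close>

lemma generic_exists: "\<exists>q. generic n d q"
proof -
  obtain x :: "nat \<times> nat \<Rightarrow> real" where "alg_indep_Q ({0..<n} \<times> {0..<d}) x"
    using alg_indep_Q_exists[of "{0..<n} \<times> {0..<d}"] by auto
  then show ?thesis
    unfolding generic_def by (intro exI[of _ "\<lambda>v i. x (v, i)"]) simp
qed

subsection \<open>Independence of the rows of a matrix\<close>

definition mat_rows_indep :: "('e \<Rightarrow> 'c \<Rightarrow> real) \<Rightarrow> 'e set \<Rightarrow> 'c set \<Rightarrow> bool" where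
  "mat_rows_indep N F J \<longleftrightarrow>
     (\<forall>w. (\<forall>c\<in>J. (\<Sum>e\<in>F. w e * N e c) = 0) \<longrightarrow> (\<forall>e\<in>F. w e = 0))"

text \<open>One elimination step with pivot \<open>N e0 c0\<close>. Cross-multiplying instead of
  dividing keeps the entries polynomial. A relation \<open>w\<close> among the reduced rows lifts to
  the original rows, the weight of \<open>e0\<close> being forced by column
  \<open>c0\<close>.\<close>

lemma mat_rows_indep_insert:
  assumes F: "finite F" "e0 \<notin> F"
  shows "mat_rows_indep N (insert e0 F) J \<longleftrightarrow>
    (\<exists>c0\<in>J. N e0 c0 \<noteq> 0 \<and>
       mat_rows_indep (\<lambda>e c. N e0 c0 * N e c - N e c0 * N e0 c) F J)"
proof
  assume ind: "mat_rows_indep N (insert e0 F) J"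
  have "\<exists>c0\<in>J. N e0 c0 \<noteq> 0"
  proof (rule ccontr)
    assume "\<not> (\<exists>c0\<in>J. N e0 c0 \<noteq> 0)"
    then have "\<forall>c\<in>J. (\<Sum>e\<in>insert e0 F. (if e = e0 then 1 else 0) * N e c) = 0"
      using F by (auto intro!: sum.neutral)
    from ind[unfolded mat_rows_indep_def, rule_format, OF this[rule_format], of e0]
    show False by simp
  qed
  then obtain c0 where c0: "c0 \<in> J" "N e0 c0 \<noteq> 0" by blast
  have "mat_rows_indep (\<lambda>e c. N e0 c0 * N e c - N e c0 * N e0 c) F J"
    unfolding mat_rows_indep_def
  proof (intro allI impI ballI)
    fix w e
    assume w: "\<forall>c\<in>J. (\<Sum>e\<in>F. w e * (N e0 c0 * N e c - N e c0 * N e0 c)) = 0" and e: "e \<in> F"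
    let ?w = "\<lambda>e. if e = e0 then - (\<Sum>e\<in>F. w e * N e c0) else w e * N e0 c0"
    have "(\<Sum>e\<in>insert e0 F. ?w e * N e c) = 0" if "c \<in> J" for c
    proof -
      have "(\<Sum>e\<in>insert e0 F. ?w e * N e c) =
          - (\<Sum>e\<in>F. w e * N e c0) * N e0 c + (\<Sum>e\<in>F. w e * N e0 c0 * N e c)"
        using F by (auto intro!: sum.cong)
      also have "\<dots> = (\<Sum>e\<in>F. w e * (N e0 c0 * N e c - N e c0 * N e0 c))"
        by (simp add: sum_distrib_right sum_distrib_left sum_subtractf[symmetric] algebra_simps
            del: sum_subtractf)
      finally show ?thesis using w that by simp
    qed
    from ind[unfolded mat_rows_indep_def, rule_format, OF this, of e]
    show "w e = 0" using e F c0 by (auto split: if_splits)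
  qed
  then show "\<exists>c0\<in>J. N e0 c0 \<noteq> 0 \<and> mat_rows_indep (\<lambda>e c. N e0 c0 * N e c - N e c0 * N e0 c) F J"
    using c0 by blast
next
  assume "\<exists>c0\<in>J. N e0 c0 \<noteq> 0 \<and> mat_rows_indep (\<lambda>e c. N e0 c0 * N e c - N e c0 * N e0 c) F J"
  then obtain c0 where c0: "c0 \<in> J" "N e0 c0 \<noteq> 0"
    and ind: "mat_rows_indep (\<lambda>e c. N e0 c0 * N e c - N e c0 * N e0 c) F J" by blast
  show "mat_rows_indep N (insert e0 F) J"
    unfolding mat_rows_indep_def
  proof (intro allI impI)
    fix w assume w: "\<forall>c\<in>J. (\<Sum>e\<in>insert e0 F. w e * N e c) = 0"
    then have w': "(\<Sum>e\<in>F. w e * N e c) = - w e0 * N e0 c" if "c \<in> J" for c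
      using F that by (simp add: eq_neg_iff_add_eq_0 add.commute)
    have "(\<Sum>e\<in>F. w e * (N e0 c0 * N e c - N e c0 * N e0 c)) = 0" if "c \<in> J" for c
    proof -
      have "(\<Sum>e\<in>F. w e * (N e0 c0 * N e c - N e c0 * N e0 c)) =
          N e0 c0 * (\<Sum>e\<in>F. w e * N e c) - N e0 c * (\<Sum>e\<in>F. w e * N e c0)"
        by (simp add: sum_distrib_left sum_subtractf[symmetric] algebra_simps del: sum_subtractf)
      then show ?thesis using w'[OF that] w'[OF c0(1)] by simp
    qed
    then have wF: "\<forall>e\<in>F. w e = 0" using ind unfolding mat_rows_indep_def by blast
    then have "w e0 * N e0 c0 = 0" using w'[OF c0(1)] by simp
    then show "\<forall>e\<in>insert e0 F. w e = 0" using wF c0 by simp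
  qed
qed

text \<open>Division-free Gaussian elimination: the pivots, multiplied together along an elimination
  path, play the role of the minors.\<close>

lemma mat_rows_indep_poly:
  assumes "finite F"
    and "\<And>e c. e \<in> F \<Longrightarrow> c \<in> J \<Longrightarrow> poly_rep I (\<lambda>x. N x e c)"
  shows "\<exists>D. (\<forall>f\<in>D. poly_rep I f) \<and> (\<forall>x. mat_rows_indep (N x) F J \<longleftrightarrow> (\<exists>f\<in>D. f x \<noteq> 0))"
  using assms
proof (induction F arbitrary: N rule: finite_induct)
  case empty
  then show ?case
    using poly_rep_const[of I 1]
    by (intro exI[of _ "{\<lambda>_. 1}"]) (auto simp: mat_rows_indep_def)
next
  case (insert e0 F)
  let ?N = "\<lambda>c0 x e c. N x e0 c0 * N x e c - N x e c0 * N x e0 c"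
  have "\<forall>c0\<in>J. \<exists>D. (\<forall>f\<in>D. poly_rep I f) \<and>
      (\<forall>x. mat_rows_indep (?N c0 x) F J \<longleftrightarrow> (\<exists>f\<in>D. f x \<noteq> 0))"
    using insert.prems by (intro ballI insert.IH poly_rep_diff poly_rep_mult) auto
  from bchoice[OF this] obtain D where D: "\<forall>c0\<in>J. (\<forall>f\<in>D c0. poly_rep I f) \<and>
      (\<forall>x. mat_rows_indep (?N c0 x) F J \<longleftrightarrow> (\<exists>f\<in>D c0. f x \<noteq> 0))" ..
  let ?D = "\<Union>c0\<in>J. (\<lambda>f x. N x e0 c0 * f x) ` D c0"
  have "\<forall>f\<in>?D. poly_rep I f"
    using D insert.prems by (auto intro!: poly_rep_mult)
  moreover have "mat_rows_indep (N x) (insert e0 F) J \<longleftrightarrow> (\<exists>f\<in>?D. f x \<noteq> 0)" for x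
    unfolding mat_rows_indep_insert[OF insert.hyps] using D by auto
  ultimately show ?case by blast
qed

text \<open>Specialisation principle: to prove independence at a generic point it is enough to see
  it at one convenient point \<open>y\<close>, however degenerate.\<close>

lemma mat_rows_indep_generic:
  assumes "finite F" "\<And>e c. e \<in> F \<Longrightarrow> c \<in> J \<Longrightarrow> poly_rep I (\<lambda>x. N x e c)"
    and "alg_indep_Q I x" "mat_rows_indep (N y) F J"
  shows "mat_rows_indep (N x) F J"
proof -
  obtain D where D: "\<forall>f\<in>D. poly_rep I f" "\<forall>x. mat_rows_indep (N x) F J \<longleftrightarrow> (\<exists>f\<in>D. f x \<noteq> 0)"
    using mat_rows_indep_poly[OF assms(1), of J I N] assms(2) by blast
  then obtain f where "f \<in> D" "f y \<noteq> 0" using assms(4) by blast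
  then show ?thesis using D alg_indep_Q_poly_zero[OF assms(3)] by blast
qed

subsection \<open>The vector space of real functions\<close>

text \<open>Matrix rows are functions on the column indices with pointwise addition. A named scaling
  gives the \<open>vector_space\<close> locale, whose span and dimension express the
  matroid.\<close>

definition fscale :: "real \<Rightarrow> ('a \<Rightarrow> real) \<Rightarrow> 'a \<Rightarrow> real" where
  "fscale c f = (\<lambda>x. c * f x)"

lemma fscale_apply [simp]: "fscale c f x = c * f x"
  by (simp add: fscale_def)

interpretation FV: vector_space "fscale :: real \<Rightarrow> ('a \<Rightarrow> real) \<Rightarrow> 'a \<Rightarrow> real"
  by unfold_locales (auto simp: fscale_def fun_eq_iff algebra_simps)

lemma fsum_apply: "(\<Sum>a\<in>A. f a) x = (\<Sum>a\<in>A. f a x)" for f :: "'b \<Rightarrow> 'a \<Rightarrow> real"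
  by (induction A rule: infinite_finite_induct) auto

text \<open>\<open>FV.dim\<close> is the \<open>card\<close> of a basis, hence 0 when the span is
  infinite-dimensional; a finite \<open>T\<close> rules this out.\<close>

lemma FV_dim_mono:
  fixes S T :: "('a \<Rightarrow> real) set"
  assumes "finite T" "S \<subseteq> FV.span T"
  shows "FV.dim S \<le> FV.dim T"
proof -
  obtain B where B: "B \<subseteq> T" "FV.independent B" "T \<subseteq> FV.span B" "card B = FV.dim T"
    using FV.basis_exists by blast
  have "S \<subseteq> FV.span B"
    using assms(2) FV.span_minimal[OF B(3) FV.subspace_span] by blast
  moreover have "finite B" using B(1) assms(1) finite_subset by blast
  ultimately show ?thesis using FV.dim_le_card B(4) by metis
qed

lemma FV_dim_insert:
  fixes S :: "('a \<Rightarrow> real) set"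
  assumes "finite S"
  shows "FV.dim (insert a S) = FV.dim S + (if a \<in> FV.span S then 0 else 1)"
proof (cases "a \<in> FV.span S")
  case True
  have "FV.span (insert a S) = FV.span S" using FV.span_redundant[OF True] .
  then show ?thesis using True FV.dim_span by (metis add.right_neutral)
next
  case False
  obtain B where B: "B \<subseteq> S" "FV.independent B" "S \<subseteq> FV.span B" "card B = FV.dim S"
    using FV.basis_exists by blast
  have sp: "FV.span B = FV.span S"
    using B by (intro FV.span_eq[THEN iffD2] conjI) (auto intro: FV.span_base)
  have fB: "finite B" using B(1) assms finite_subset by blast
  have "FV.independent (insert a B)" using B(2) False sp by (intro FV.independent_insertI) auto
  moreover have "insert a S \<subseteq> FV.span (insert a B)"
    using B(3) FV.span_mono[of B "insert a B"] by (auto intro: FV.span_base)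
  ultimately have "card (insert a B) = FV.dim (insert a S)"
    using B(1) by (intro FV.basis_card_eq_dim) auto
  moreover have "a \<notin> B" using False B(1) FV.span_base by blast
  ultimately show ?thesis using False B(4) fB by simp
qed

text \<open>Zero outside \<open>J\<close>, so that equality and dependence of these functions see
  only the columns in \<open>J\<close>.\<close>

definition matrix_row :: "('e \<Rightarrow> 'c \<Rightarrow> real) \<Rightarrow> 'c set \<Rightarrow> 'e \<Rightarrow> 'c \<Rightarrow> real" where
  "matrix_row N J e = (\<lambda>c. if c \<in> J then N e c else 0)"

text \<open>Passage from an indexed family to a set of vectors. A set cannot record a repeated row,
  which is why injectivity appears.\<close>

lemma mat_rows_indep_iff:
  assumes "finite F"
  shows "mat_rows_indep N F J \<longleftrightarrow>
    inj_on (matrix_row N J) F \<and> FV.independent (matrix_row N J ` F)" (is "_ \<longleftrightarrow> inj_on ?r F \<and> _")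
proof
  assume ind: "mat_rows_indep N F J"
  have inj: "inj_on ?r F"
  proof (rule inj_onI, rule ccontr)
    fix e e' assume e: "e \<in> F" "e' \<in> F" "?r e = ?r e'" "e \<noteq> e'"
    let ?w = "\<lambda>f. if f = e then 1 else if f = e' then -1 else (0::real)"
    have "(\<Sum>f\<in>F. ?w f * N f c) = 0" if "c \<in> J" for c
    proof -
      have "(\<Sum>f\<in>F. ?w f * N f c) = (\<Sum>f\<in>{e, e'}. ?w f * N f c)"
        using e assms by (intro sum.mono_neutral_right) auto
      also have "\<dots> = N e c - N e' c" using e by simp
      finally show ?thesis using fun_cong[OF e(3), of c] that by (simp add: matrix_row_def)
    qed
    then have "?w e = 0"
      using ind[unfolded mat_rows_indep_def, THEN spec, of ?w] e(1) by blast
    then show False by simp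
  qed
  have "\<not> FV.dependent (?r ` F)"
  proof
    assume "FV.dependent (?r ` F)"
    then obtain u where u: "\<exists>v\<in>?r ` F. u v \<noteq> 0" "(\<Sum>v\<in>?r ` F. fscale (u v) v) = 0"
      using FV.dependent_finite[of "?r ` F"] assms by auto
    have "(\<Sum>e\<in>F. u (?r e) * N e c) = 0" if "c \<in> J" for c
    proof -
      have "0 = (\<Sum>v\<in>?r ` F. fscale (u v) v) c" using u(2) by simp
      also have "\<dots> = (\<Sum>e\<in>F. u (?r e) * ?r e c)"
        using inj by (simp add: fsum_apply sum.reindex)
      also have "\<dots> = (\<Sum>e\<in>F. u (?r e) * N e c)"
        using that by (simp add: matrix_row_def)
      finally show ?thesis by simp
    qed
    then have "\<forall>e\<in>F. u (?r e) = 0" using ind[unfolded mat_rows_indep_def, THEN spec, of "\<lambda>e. u (?r e)"] by blast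
    then show False using u(1) by blast
  qed
  then show "inj_on ?r F \<and> FV.independent (?r ` F)" using inj by blast
next
  assume r: "inj_on ?r F \<and> FV.independent (?r ` F)"
  show "mat_rows_indep N F J"
    unfolding mat_rows_indep_def
  proof (intro allI impI)
    fix w assume w: "\<forall>c\<in>J. (\<Sum>e\<in>F. w e * N e c) = 0"
    let ?u = "\<lambda>v. w (inv_into F ?r v)"
    have "(\<Sum>v\<in>?r ` F. fscale (?u v) v) = 0"
    proof
      fix c
      have "(\<Sum>v\<in>?r ` F. fscale (?u v) v) c = (\<Sum>e\<in>F. w e * ?r e c)"
        using r by (simp add: fsum_apply sum.reindex)
      also have "\<dots> = 0" using w by (cases "c \<in> J") (auto simp: matrix_row_def)
      finally show "(\<Sum>v\<in>?r ` F. fscale (?u v) v) c = 0 c" by simp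
    qed
    moreover have "finite (?r ` F)" using assms by simp
    ultimately have "\<forall>v\<in>?r ` F. ?u v = 0"
      using r FV.dependent_finite[of "?r ` F", THEN iffD2, OF _ exI[of _ ?u]] by blast
    then show "\<forall>e\<in>F. w e = 0" using r by auto
  qed
qed

lemma mat_rows_indep_card_le:
  fixes N :: "'e \<Rightarrow> 'c \<Rightarrow> real"
  assumes "finite F" "finite J" "mat_rows_indep N F J"
  shows "card F \<le> card J"
proof -
  have inj: "inj_on (matrix_row N J) F" and ind: "FV.independent (matrix_row N J ` F)"
    using assms mat_rows_indep_iff by blast+
  let ?\<delta> = "\<lambda>c::'c. \<lambda>x. if x = c then 1 else (0::real)"
  have "matrix_row N J ` F \<subseteq> FV.span (?\<delta> ` J)"
  proof
    fix v assume "v \<in> matrix_row N J ` F"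
    then obtain e where e: "v = matrix_row N J e" by blast
    have "v = (\<Sum>c\<in>J. fscale (N e c) (?\<delta> c))"
      using assms(2) by (auto simp: e matrix_row_def fun_eq_iff fsum_apply if_distrib cong: if_cong)
    also have "\<dots> \<in> FV.span (?\<delta> ` J)"
      by (intro FV.span_sum FV.span_scale FV.span_base) auto
    finally show "v \<in> FV.span (?\<delta> ` J)" .
  qed
  then have "card (matrix_row N J ` F) \<le> card (?\<delta> ` J)"
    using FV.independent_span_bound[OF _ ind] assms(2) by blast
  also have "\<dots> \<le> card J" using assms(2) card_image_le by blast
  finally show ?thesis using inj by (simp add: card_image)
qed

subsection \<open>The rigidity matroid at a generic point\<close>

definition rig_vec :: "nat \<Rightarrow> nat \<Rightarrow> (nat \<Rightarrow> nat \<Rightarrow> real) \<Rightarrow> nat \<times> nat \<Rightarrow> nat \<times> nat \<Rightarrow> real" where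
  "rig_vec n d q = matrix_row (rig_row q) ({..<n} \<times> {..<d})"

lemma rows_indep_mat: "rows_indep n d q F \<longleftrightarrow> mat_rows_indep (rig_row q) F ({..<n} \<times> {..<d})"
  unfolding rows_indep_def mat_rows_indep_def by auto

lemma rows_indep_iff:
  "finite F \<Longrightarrow> rows_indep n d q F \<longleftrightarrow> inj_on (rig_vec n d q) F \<and> FV.independent (rig_vec n d q ` F)"
  unfolding rows_indep_mat rig_vec_def by (rule mat_rows_indep_iff)

lemma rig_vec_sym: "rig_vec n d q (x, y) = rig_vec n d q (y, x)"
  by (auto simp: rig_vec_def matrix_row_def rig_row_def fun_eq_iff)

text \<open>With \<open>rig_vec_sym\<close> this lets \<open>U \<times> U\<close> stand for the
  complete graph on \<open>U\<close>: diagonal pairs and double orientations do not affect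
  spans.\<close>

lemma rig_vec_self [simp]: "rig_vec n d q (x, x) = 0"
  by (auto simp: rig_vec_def matrix_row_def rig_row_def fun_eq_iff)

lemma rig_vec_apply:
  "rig_vec n d q (a, b) (w, i) = (if w < n \<and> i < d then
     (if w = a then q a i - q b i else 0) + (if w = b then q b i - q a i else 0) else 0)"
  by (auto simp: rig_vec_def matrix_row_def rig_row_def)

lemma rows_indep_generic:
  assumes "generic n d q" "finite F" "F \<subseteq> {..<n} \<times> {..<n}" "rows_indep n d q' F"
  shows "rows_indep n d q F"
proof -
  let ?I = "{0..<n} \<times> {0..<d}"
  let ?N = "\<lambda>x. rig_row (\<lambda>v i. x (v, i))"
  have "mat_rows_indep (?N (\<lambda>(v, i). q v i)) F ({..<n} \<times> {..<d})"
  proof (rule mat_rows_indep_generic[where I = ?I and N = ?N and y = "\<lambda>(v, i). q' v i"])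
    show "poly_rep ?I (\<lambda>x. ?N x e c)" if "e \<in> F" "c \<in> {..<n} \<times> {..<d}" for e c
    proof -
      obtain v i where c: "c = (v, i)" by (cases c)
      obtain a b where e: "e = (a, b)" by (cases e)
      have "a < n" "b < n" "i < d" using that assms(3) c e by auto
      then have "poly_rep ?I (\<lambda>x. x (a, i) - x (b, i))" "poly_rep ?I (\<lambda>x. x (b, i) - x (a, i))"
        by (intro poly_rep_diff poly_rep_var; simp)+
      then show ?thesis
        using poly_rep_const[of ?I 0] unfolding rig_row_def c e
        by (cases "v = a"; cases "v = b") auto
    qed
    show "alg_indep_Q ?I (\<lambda>(v, i). q v i)" using assms(1) unfolding generic_def .
  qed (use assms in \<open>auto simp: rows_indep_mat\<close>)
  then show ?thesis by (simp add: rows_indep_mat)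
qed

lemma finite_choice_subset:
  assumes "finite (N :: nat set)" "k \<le> card N"
  shows "\<exists>A\<subseteq>N. card A = k"
  using assms obtain_subset_with_card_n by metis

locale generic_framework =
  fixes n d :: nat and q :: "nat \<Rightarrow> nat \<Rightarrow> real"
  assumes gen: "generic n d q"
begin

abbreviation "R \<equiv> rig_vec n d q"

definition rk :: "(nat \<times> nat) set \<Rightarrow> nat" where
  "rk X = FV.dim (R ` X)"

text \<open>Affine dependence is linear dependence after appending a coordinate 1, here column
  \<open>d\<close>. The test configuration places the vertices at distinct unit vectors, except that
  a vertex with \<open>h a = d\<close> goes to the origin.\<close>

lemma affine_indep:
  assumes A: "A \<subseteq> {..<n}" "card A \<le> d + 1"
    and c: "(\<Sum>a\<in>A. c a) = 0" "\<And>i. i < d \<Longrightarrow> (\<Sum>a\<in>A. c a * q a i) = 0"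
    and a: "a \<in> A"
  shows "c a = 0"
proof -
  have finA: "finite A" using A(1) finite_subset by blast
  let ?I = "{0..<n} \<times> {0..<d}"
  let ?N = "\<lambda>x a i. if i < d then x (a, i) else (1::real)"
  obtain h where h: "bij_betw h A {0..<card A}"
    using ex_bij_betw_finite_nat[OF finA] by blast
  have hd: "h a \<le> d" if "a \<in> A" for a
    using h A(2) that bij_betwE by fastforce
  have "mat_rows_indep (?N (\<lambda>(v, i). q v i)) A {..d}"
  proof (rule mat_rows_indep_generic[where I = ?I and N = ?N and
        y = "\<lambda>(v, i). if h v = i then 1 else 0"])
    show "poly_rep ?I (\<lambda>x. ?N x e c)" if "e \<in> A" "c \<in> {..d}" for e c
      using that A(1) poly_rep_const[of ?I 1] poly_rep_var[of ?I "(e, c)"]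
      by (cases "c < d") auto
    show "alg_indep_Q ?I (\<lambda>(v, i). q v i)" using gen unfolding generic_def .
    show "mat_rows_indep (?N (\<lambda>(v, i). if h v = i then 1 else 0)) A {..d}"
      unfolding mat_rows_indep_def
    proof (intro allI impI)
      fix w assume w: "\<forall>c\<in>{..d}. (\<Sum>e\<in>A. w e * ?N (\<lambda>(v, i). if h v = i then 1 else 0) e c) = 0"
      have *: "w a = 0" if "a \<in> A" "h a < d" for a
      proof -
        have "(\<Sum>e\<in>A. w e * (if h e = h a then 1 else 0)) = 0"
          using w[rule_format, of "h a"] that by simp
        also have "(\<Sum>e\<in>A. w e * (if h e = h a then 1 else 0)) = (\<Sum>e\<in>A. if e = a then w e else 0)"
          using h that by (intro sum.cong) (auto simp: bij_betw_def inj_on_def)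
        finally show ?thesis using finA that by simp
      qed
      show "\<forall>a\<in>A. w a = 0"
      proof
        fix a assume a: "a \<in> A"
        show "w a = 0"
        proof (cases "h a < d")
          case False
          then have "h a = d" using hd[OF a] by simp
          then have "h b < d" if "b \<in> A - {a}" for b
            using hd[of b] that h a by (metis DiffD1 DiffD2 bij_betw_def inj_on_def insertI1 le_neq_implies_less)
          then have "(\<Sum>b\<in>A. w b) = w a"
            using * finA a by (subst sum.remove[of A a]) auto
          then show ?thesis using w[rule_format, of d] by simp
        qed (use * a in blast)
      qed
    qed
  qed (fact finA)
  moreover have "\<forall>i\<in>{..d}. (\<Sum>a\<in>A. c a * ?N (\<lambda>(v, i). q v i) a i) = 0"
  proof
    fix i assume "i \<in> {..d}"
    then show "(\<Sum>a\<in>A. c a * ?N (\<lambda>(v, i). q v i) a i) = 0" using c by (cases "i < d") auto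
  qed
  ultimately show ?thesis using a unfolding mat_rows_indep_def by blast
qed

lemma rk_mono: "finite Y \<Longrightarrow> R ` X \<subseteq> FV.span (R ` Y) \<Longrightarrow> rk X \<le> rk Y"
  unfolding rk_def by (rule FV_dim_mono) auto

lemma rk_subset: "finite Y \<Longrightarrow> X \<subseteq> Y \<Longrightarrow> rk X \<le> rk Y"
  by (rule rk_mono) (auto intro: FV.span_base)

lemma rk_insert:
  "finite X \<Longrightarrow> rk (insert e X) = rk X + (if R e \<in> FV.span (R ` X) then 0 else 1)"
  unfolding rk_def by (simp add: FV_dim_insert)

text \<open>The rows in \<open>X\<close> vanish in the columns of \<open>v\<close>, so in these
  columns the span sees only the star.\<close>

lemma span_star_at:
  assumes X: "\<forall>(a, b)\<in>X. a \<noteq> v \<and> b \<noteq> v" and A: "finite A" "v \<notin> A" "v < n"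
    and z: "z \<in> FV.span (R ` (X \<union> Pair v ` A))"
  shows "\<exists>c. \<forall>i<d. z (v, i) = (\<Sum>a\<in>A. c a * (q v i - q a i))"
  using z
proof (induction rule: FV.span_induct_alt)
  case base
  show ?case by (rule exI[of _ "\<lambda>_. 0"]) simp
next
  case (step k x y)
  obtain c where c: "\<forall>i<d. y (v, i) = (\<Sum>a\<in>A. c a * (q v i - q a i))" using step by blast
  consider e where "e \<in> X" "x = R e" | a where "a \<in> A" "x = R (v, a)" using step(1) by blast
  then show ?case
  proof cases
    case 1
    then have "x (v, i) = 0" for i using X by (cases e) (auto simp: rig_vec_apply)
    then show ?thesis using c by (intro exI[of _ c]) simp
  next
    case 2
    have "(fscale k x + y) (v, i) = (\<Sum>b\<in>A. (c b + (if b = a then k else 0)) * (q v i - q b i))"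
      if "i < d" for i
    proof -
      have "(\<Sum>b\<in>A. (c b + (if b = a then k else 0)) * (q v i - q b i)) =
          (\<Sum>b\<in>A. c b * (q v i - q b i)) + (\<Sum>b\<in>A. if b = a then k * (q v i - q b i) else 0)"
        by (subst sum.distrib[symmetric]) (auto intro!: sum.cong simp: algebra_simps)
      then show ?thesis using 2 A that c by (auto simp: rig_vec_apply)
    qed
    then show ?thesis by (intro exI[of _ "\<lambda>b. c b + (if b = a then k else 0)"]) simp
  qed
qed

text \<open>If the row of \<open>(v, a)\<close> were already spanned, its entries at
  \<open>v\<close> would give an affine dependency among \<open>v\<close>, \<open>a\<close> and the
  earlier neighbours. These are at most \<open>d + 1\<close> points and \<open>a\<close> has weight
  -1, against \<open>affine_indep\<close>; the weight of \<open>v\<close> is chosen to make the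
  total 0.\<close>

lemma rk_star:
  assumes "finite X" and X: "\<forall>(a, b)\<in>X. a \<noteq> v \<and> b \<noteq> v"
    and v: "v < n" and A: "finite A" "A \<subseteq> {..<n} - {v}" "card A \<le> d"
  shows "rk (X \<union> Pair v ` A) = rk X + card A"
  using A
proof (induction A rule: finite_induct)
  case empty
  then show ?case by simp
next
  case (insert a A)
  have "R (v, a) \<notin> FV.span (R ` (X \<union> Pair v ` A))"
  proof
    assume "R (v, a) \<in> FV.span (R ` (X \<union> Pair v ` A))"
    then obtain c where c: "\<forall>i<d. R (v, a) (v, i) = (\<Sum>b\<in>A. c b * (q v i - q b i))"
      using span_star_at[OF X insert.hyps(1) _ v] insert.prems by blast
    let ?c = "\<lambda>b. if b = v then 1 - (\<Sum>b\<in>A. c b) else if b = a then -1 else c b"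
    have vA: "v \<notin> A" "a \<noteq> v" using insert by auto
    have S: "(\<Sum>b\<in>insert v (insert a A). ?c b * f b) =
        (1 - (\<Sum>b\<in>A. c b)) * f v - f a + (\<Sum>b\<in>A. c b * f b)" for f :: "nat \<Rightarrow> real"
    proof -
      have "(\<Sum>b\<in>A. ?c b * f b) = (\<Sum>b\<in>A. c b * f b)"
        using vA insert.hyps by (intro sum.cong) auto
      then show ?thesis using vA insert.hyps by simp
    qed
    have ca: "?c a = 0"
    proof (rule affine_indep[where c = ?c])
      show "insert v (insert a A) \<subseteq> {..<n}" using insert.prems v by auto
      show "card (insert v (insert a A)) \<le> d + 1"
        using insert.prems insert.hyps vA by simp
      show "(\<Sum>b\<in>insert v (insert a A). ?c b) = 0" using S[of "\<lambda>_. 1"] by simp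
      show "(\<Sum>b\<in>insert v (insert a A). ?c b * q b i) = 0" if "i < d" for i
      proof -
        have "q v i - q a i = (\<Sum>b\<in>A. c b * (q v i - q b i))"
          using c that v vA by (auto simp: rig_vec_apply)
        then show ?thesis
          using S[of "\<lambda>b. q b i"]
          by (simp add: sum_subtractf sum_distrib_right algebra_simps)
      qed
    qed simp
    then show False using vA by simp
  qed
  moreover have "rk (X \<union> Pair v ` A) = rk X + card A" using insert by simp
  ultimately show ?case using insert.hyps assms(1) rk_insert[of "X \<union> Pair v ` A" "(v, a)"] by simp
qed

lemma rk_basis:
  assumes "finite X"
  obtains F where "F \<subseteq> X" "rows_indep n d q F" "card F = rk X" "FV.span (R ` F) = FV.span (R ` X)"
proof -
  obtain B where B: "B \<subseteq> R ` X" "FV.independent B" "R ` X \<subseteq> FV.span B" "card B = FV.dim (R ` X)"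
    using FV.basis_exists by blast
  obtain F where F: "F \<subseteq> X" "inj_on R F" "B = R ` F"
    using B(1) subset_image_inj by metis
  have fin: "finite F" using F(1) assms finite_subset by blast
  show thesis
  proof
    show "rows_indep n d q F" using F B(2) fin by (simp add: rows_indep_iff)
    show "card F = rk X" using F B(4) by (simp add: card_image rk_def)
    have "R ` F \<subseteq> FV.span (R ` X)" using B(1) F(3) FV.span_superset by blast
    then show "FV.span (R ` F) = FV.span (R ` X)" using B(3) F(3) by (simp add: FV.span_eq)
  qed (fact F)
qed

lemma rows_indep_rk: "finite F \<Longrightarrow> rows_indep n d q F \<Longrightarrow> rk F = card F"
  by (simp add: rows_indep_iff rk_def FV.dim_eq_card_independent card_image)

text \<open>The classical 1-extension argument: put \<open>v\<close> at the midpoint of \<open>x\<close> and \<open>y\<close>; a stress on the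
  star of \<open>v\<close> then acts on the other vertices as a multiple of the row of \<open>xy\<close>.\<close>

lemma rk_one_extension:
  assumes "finite X" and X: "\<forall>(a, b)\<in>X. a \<noteq> v \<and> b \<noteq> v" "X \<subseteq> {..<n} \<times> {..<n}"
    and v: "v < n" and A: "A \<subseteq> {..<n} - {v}" "card A \<le> d + 1"
    and xy: "x \<in> A" "y \<in> A" "R (x, y) \<notin> FV.span (R ` X)"
  shows "rk X + card A \<le> rk (X \<union> Pair v ` A)"
proof -
  have xny: "x \<noteq> y" using xy(3) FV.span_zero[of "R ` X"] by auto
  have finA: "finite A" using A(1) finite_subset by blast
  obtain F where F: "F \<subseteq> X" "rows_indep n d q F" "card F = rk X" "FV.span (R ` F) = FV.span (R ` X)"
    using rk_basis[OF assms(1)] .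
  have finF: "finite F" using F(1) assms(1) finite_subset by blast
  have xyF: "(x, y) \<notin> F" "R (x, y) \<notin> R ` F" using xy(3) F(4) FV.span_base by (metis image_eqI)+
  have ind: "rows_indep n d q (insert (x, y) F)"
    using F(2) finF xy(3) F(4) xyF by (auto simp: rows_indep_iff FV.independent_insertI)
  define q' where "q' = (\<lambda>w i. if w = v then (q x i + q y i) / 2 else q w i)"
  have disj: "F \<inter> Pair v ` A = {}" using F(1) X(1) by fastforce
  have rowF: "rig_row q' e (w, i) = rig_row q e (w, i)" "rig_row q' e (v, i) = 0"
    if "e \<in> F" for e w i
  proof -
    obtain a b where e: "e = (a, b)" by (cases e)
    have "a \<noteq> v" "b \<noteq> v" using that F(1) X(1) e by auto
    then show "rig_row q' e (w, i) = rig_row q e (w, i)" "rig_row q' e (v, i) = 0"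
      by (auto simp: e rig_row_def q'_def)
  qed
  have "rows_indep n d q' (F \<union> Pair v ` A)"
    unfolding rows_indep_def
  proof (intro allI impI)
    fix c :: "nat \<times> nat \<Rightarrow> real"
    assume c: "\<forall>w<n. \<forall>i<d. (\<Sum>e\<in>F \<union> Pair v ` A. c e * rig_row q' e (w, i)) = 0"
    have c': "(\<Sum>e\<in>F. c e * rig_row q' e (w, i)) +
        (\<Sum>a\<in>A. c (v, a) * rig_row q' (v, a) (w, i)) = 0" if "w < n" "i < d" for w i
    proof -
      have "(\<Sum>e\<in>Pair v ` A. c e * rig_row q' e (w, i)) =
          (\<Sum>a\<in>A. c (v, a) * rig_row q' (v, a) (w, i))"
        by (simp add: sum.reindex inj_on_def)
      moreover have "(\<Sum>e\<in>F \<union> Pair v ` A. c e * rig_row q' e (w, i)) =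
          (\<Sum>e\<in>F. c e * rig_row q' e (w, i)) + (\<Sum>e\<in>Pair v ` A. c e * rig_row q' e (w, i))"
        using finF finA disj by (intro sum.union_disjoint) auto
      ultimately show ?thesis using c that by simp
    qed
    define s where "s = (\<Sum>a\<in>A. c (v, a))"
    \<comment> \<open>The columns of \<open>v\<close> say that \<open>s\<close> times the midpoint
      of \<open>x\<close> and \<open>y\<close> equals the sum of \<open>c (v, a) * q a\<close>.
      Writing the midpoint as half of \<open>x\<close> plus half of \<open>y\<close> makes
      \<open>b\<close> an affine dependency of at most \<open>d + 1\<close> points. Hence
      \<open>c (v, a)\<close> is \<open>s / 2\<close> at \<open>x\<close> and \<open>y\<close> and 0
      elsewhere.\<close>
    define b where "b = (\<lambda>a. (if a = x \<or> a = y then s / 2 else 0) - c (v, a))"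
    have sxy: "(\<Sum>a\<in>A. (if a = x \<or> a = y then s / 2 else 0) * f a) = s / 2 * (f x + f y)" for f
    proof -
      have "(\<Sum>a\<in>A. (if a = x \<or> a = y then s / 2 else 0) * f a) =
          (\<Sum>a\<in>{x, y}. (if a = x \<or> a = y then s / 2 else 0) * f a)"
        using xy finA by (intro sum.mono_neutral_right) auto
      then show ?thesis using xny by (simp add: algebra_simps)
    qed
    have b0: "b a = 0" if "a \<in> A" for a
    proof (rule affine_indep[OF _ A(2) _ _ that])
      show "A \<subseteq> {..<n}" using A by auto
      show "(\<Sum>a\<in>A. b a) = 0"
        using sxy[of "\<lambda>_. 1"] by (simp add: b_def sum_subtractf s_def)
      show "(\<Sum>a\<in>A. b a * q a i) = 0" if i: "i < d" for i
      proof -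
        have "(\<Sum>a\<in>A. c (v, a) * rig_row q' (v, a) (v, i)) = 0"
          using c'[OF v i] rowF(2) by simp
        moreover have "rig_row q' (v, a) (v, i) = (q x i + q y i) / 2 - q a i" if "a \<in> A" for a
          using that A by (auto simp: rig_row_def q'_def)
        ultimately have "(\<Sum>a\<in>A. c (v, a) * ((q x i + q y i) / 2 - q a i)) = 0" by simp
        moreover have "(\<Sum>a\<in>A. c (v, a) * (m - q a i)) = s * m - (\<Sum>a\<in>A. c (v, a) * q a i)" for m
          by (simp add: right_diff_distrib sum_subtractf s_def sum_distrib_right)
        ultimately have "s * ((q x i + q y i) / 2) = (\<Sum>a\<in>A. c (v, a) * q a i)" by simp
        then show ?thesis
          using sxy[of "\<lambda>a. q a i"] by (simp add: b_def left_diff_distrib sum_subtractf)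
      qed
    qed
    \<comment> \<open>At \<open>x\<close> the row of \<open>(v, x)\<close> is \<open>q x\<close>
      minus the midpoint, that is, half of \<open>q x - q y\<close>; the weight \<open>s / 2\<close>
      turns it into \<open>s / 4\<close> times the row of \<open>(x, y)\<close>.\<close>
    let ?c = "\<lambda>e. if e = (x, y) then s / 4 else c e"
    have "(\<Sum>e\<in>insert (x, y) F. ?c e * rig_row q e (w, i)) = 0" if "w < n" "i < d" for w i
    proof -
      have "(\<Sum>a\<in>A. c (v, a) * rig_row q' (v, a) (w, i)) = s / 4 * rig_row q (x, y) (w, i)"
      proof (cases "w = v")
        case True
        have "(\<Sum>e\<in>F. c e * rig_row q' e (v, i)) = 0" using rowF(2) by simp
        then show ?thesis using c'[OF that] True xy A by (auto simp: rig_row_def)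
      next
        case False
        have "(\<Sum>a\<in>A. c (v, a) * rig_row q' (v, a) (w, i)) =
            (\<Sum>a\<in>A. if a = w then c (v, a) * (q w i - (q x i + q y i) / 2) else 0)"
          using False A by (intro sum.cong) (auto simp: rig_row_def q'_def)
        also have "\<dots> = (if w \<in> A then c (v, w) * (q w i - (q x i + q y i) / 2) else 0)"
          using finA by simp
        also have "\<dots> = s / 4 * rig_row q (x, y) (w, i)"
          using b0[of w] xy xny by (auto simp: b_def rig_row_def field_simps split: if_splits)
        finally show ?thesis .
      qed
      moreover have "(\<Sum>e\<in>F. ?c e * rig_row q e (w, i)) = (\<Sum>e\<in>F. c e * rig_row q' e (w, i))"
        using rowF(1) xyF by (intro sum.cong) auto
      ultimately show ?thesis using c'[OF that] finF xyF by simp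
    qed
    then have "\<forall>w<n. \<forall>i<d. (\<Sum>e\<in>insert (x, y) F. ?c e * rig_row q e (w, i)) = 0" by simp
    from ind[unfolded rows_indep_def, THEN spec, THEN mp, OF this]
    have z: "\<forall>e\<in>insert (x, y) F. ?c e = 0" .
    then have "s = 0" by auto
    then have "c (v, a) = 0" if "a \<in> A" for a using b0[OF that] by (auto simp: b_def split: if_splits)
    moreover have "c e = 0" if "e \<in> F" for e using z that xyF by (metis insertI2)
    ultimately show "\<forall>e\<in>F \<union> Pair v ` A. c e = 0" by auto
  qed
  moreover have "F \<union> Pair v ` A \<subseteq> {..<n} \<times> {..<n}" using F(1) X(2) A v by auto
  ultimately have "rows_indep n d q (F \<union> Pair v ` A)"
    using finF finA by (intro rows_indep_generic[OF gen _ _ \<open>rows_indep n d q' _\<close>]) auto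
  then have "rk (F \<union> Pair v ` A) = card F + card A"
    using finF finA disj by (simp add: rows_indep_rk card_Un_disjoint card_image inj_on_def)
  moreover have "rk (F \<union> Pair v ` A) \<le> rk (X \<union> Pair v ` A)"
    using F(1) assms(1) finA by (intro rk_subset) auto
  ultimately show ?thesis using F(3) by simp
qed

text \<open>\<open>K\<^sub>d\<^sub>+\<^sub>2\<close> is a circuit: an affine dependency \<open>l\<close> of its vertices gives the stress
  \<open>l a * l b\<close>, which has no zero entry.\<close>

lemma complete_graph_circuit:
  assumes W: "FV.subspace W" and A: "A \<subseteq> {..<n} - {x, y}" "card A = d"
    and xy: "x < n" "y < n" "x \<noteq> y"
    and rows: "\<And>a. a \<in> A \<Longrightarrow> R (x, a) \<in> W" "\<And>a. a \<in> A \<Longrightarrow> R (y, a) \<in> W"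
      "\<And>a b. a \<in> A \<Longrightarrow> b \<in> A \<Longrightarrow> R (a, b) \<in> W"
  shows "R (x, y) \<in> W"
proof -
  define B where "B = insert x (insert y A)"
  have finA: "finite A" using A(1) finite_subset by blast
  have finB: "finite B" using finA by (simp add: B_def)
  have xyA: "x \<notin> A" "y \<notin> A" using A by auto
  have cardB: "card B = d + 2" using xyA xy finA A(2) by (simp add: B_def)
  \<comment> \<open>\<open>d + 2\<close> points have only \<open>d + 1\<close> homogeneous
    coordinates.\<close>
  have "\<not> mat_rows_indep (\<lambda>a i. if i < d then q a i else 1) B {..d}"
    using mat_rows_indep_card_le[OF finB, of "{..d}"] cardB by auto
  then obtain l a0 where l: "\<forall>i\<in>{..d}. (\<Sum>a\<in>B. l a * (if i < d then q a i else 1)) = 0"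
      and a0: "a0 \<in> B" "l a0 \<noteq> 0"
    unfolding mat_rows_indep_def by blast
  have l1: "(\<Sum>a\<in>B. l a) = 0" using l[rule_format, of d] by simp
  have lq: "(\<Sum>a\<in>B. l a * q a i) = 0" if "i < d" for i using l[rule_format, of i] that by simp
  \<comment> \<open>A zero weight would leave an affine dependency among the remaining
    \<open>d + 1\<close> points.\<close>
  have nz: "l b \<noteq> 0" if b: "b \<in> B" for b
  proof
    assume z: "l b = 0"
    have "l a0 = 0"
    proof (rule affine_indep[of "B - {b}"])
      show "B - {b} \<subseteq> {..<n}" using A xy by (auto simp: B_def)
      show "card (B - {b}) \<le> d + 1" using cardB b finB by simp
      show "(\<Sum>a\<in>B - {b}. l a) = 0" using l1 z b finB by (simp add: sum_diff1)
      show "(\<Sum>a\<in>B - {b}. l a * q a i) = 0" if "i < d" for i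
        using lq[OF that] z b finB by (simp add: sum_diff1)
      show "a0 \<in> B - {b}" using a0 z by auto
    qed
    then show False using a0 by simp
  qed
  \<comment> \<open>The sum runs over ordered pairs, so the edge \<open>xy\<close> carries the
    weight \<open>2 * l x * l y\<close>. At a vertex \<open>w\<close> the stress cancels because it
    is \<open>l w\<close> times \<open>q w * sum l - sum (l * q)\<close>, and both sums
    vanish.\<close>
  let ?f = "\<lambda>(a, b). fscale (l a * l b) (R (a, b))"
  have zero: "(\<Sum>e\<in>B \<times> B. ?f e) = 0"
  proof
    fix wi :: "nat \<times> nat"
    obtain w i where wi: "wi = (w, i)" by (cases wi)
    show "(\<Sum>e\<in>B \<times> B. ?f e) wi = 0 wi"
    proof (cases "w < n \<and> i < d")
      case True
      have "(\<Sum>e\<in>B \<times> B. ?f e) wi = (\<Sum>a\<in>B. \<Sum>b\<in>B. l a * l b * R (a, b) (w, i))"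
        by (simp add: fsum_apply sum.cartesian_product wi case_prod_beta)
      also have "\<dots> = (\<Sum>a\<in>B. \<Sum>b\<in>B. (if a = w then l a * l b * (q a i - q b i) else 0) +
          (if b = w then l a * l b * (q b i - q a i) else 0))"
        using True by (intro sum.cong refl) (auto simp: rig_vec_apply)
      also have "\<dots> = (\<Sum>a\<in>B. \<Sum>b\<in>B. if a = w then l a * l b * (q a i - q b i) else 0) +
          (\<Sum>b\<in>B. \<Sum>a\<in>B. if b = w then l a * l b * (q b i - q a i) else 0)"
        by (subst (3) sum.swap) (simp add: sum.distrib)
      also have "\<dots> = 0"
      proof -
        have in0: "(\<Sum>b\<in>B. if a = w then l a * l b * (q a i - q b i) else 0) = 0" for a
        proof -
          have "(\<Sum>b\<in>B. l a * l b * (q a i - q b i)) =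
              (\<Sum>b\<in>B. l a * q a i * l b - l a * (l b * q b i))"
            by (intro sum.cong) (simp_all add: algebra_simps)
          also have "\<dots> = l a * q a i * (\<Sum>b\<in>B. l b) - l a * (\<Sum>b\<in>B. l b * q b i)"
            by (simp add: sum_subtractf sum_distrib_left)
          finally have "(\<Sum>b\<in>B. l a * l b * (q a i - q b i)) = 0" using l1 lq True by simp
          then show ?thesis by (cases "a = w") auto
        qed
        have in1: "(\<Sum>a\<in>B. if b = w then l a * l b * (q b i - q a i) else 0) = 0" for b
        proof -
          have "(if b = w then l a * l b * (q b i - q a i) else 0) =
              (if b = w then l b * l a * (q b i - q a i) else 0)" for a by simp
          then show ?thesis using in0[of b] by simp
        qed
        show ?thesis by (simp only: in0 in1) simp
      qed
      finally show ?thesis by simp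
    next
      case False
      then show ?thesis
        by (auto simp: fsum_apply wi rig_vec_apply case_prod_beta intro!: sum.neutral)
    qed
  qed
  have rest: "(\<Sum>e\<in>B \<times> B - {(x, y), (y, x)}. ?f e) \<in> W"
  proof (rule FV.subspace_sum[OF W])
    fix e assume e: "e \<in> B \<times> B - {(x, y), (y, x)}"
    obtain a b where ab: "e = (a, b)" by (cases e)
    have "R (a, b) \<in> W"
    proof (cases "a = b")
      case True
      then show ?thesis using FV.subspace_0[OF W] by simp
    next
      case False
      then have "a \<in> A \<and> b \<in> A \<or> a \<in> {x, y} \<and> b \<in> A \<or> a \<in> A \<and> b \<in> {x, y}"
        using e ab by (auto simp: B_def)
      then show ?thesis using rows rig_vec_sym by (metis insertE singletonD)
    qed
    then show "?f e \<in> W" using ab FV.subspace_scale[OF W] by simp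
  qed
  have sub: "{(x, y), (y, x)} \<subseteq> B \<times> B" by (auto simp: B_def)
  have "(\<Sum>e\<in>B \<times> B. ?f e) =
      (\<Sum>e\<in>B \<times> B - {(x, y), (y, x)}. ?f e) + (\<Sum>e\<in>{(x, y), (y, x)}. ?f e)"
    using sum.subset_diff[OF sub, of ?f] finB by simp
  also have "(\<Sum>e\<in>{(x, y), (y, x)}. ?f e) = fscale (2 * l x * l y) (R (x, y))"
    using xy rig_vec_sym[of n d q y x] by (auto simp: fun_eq_iff algebra_simps)
  finally have "(\<Sum>e\<in>B \<times> B - {(x, y), (y, x)}. ?f e) + fscale (2 * l x * l y) (R (x, y)) = 0"
    using zero by (rule trans[OF sym])
  then have "fscale (2 * l x * l y) (R (x, y)) = - (\<Sum>e\<in>B \<times> B - {(x, y), (y, x)}. ?f e)"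
    by (rule minus_unique[symmetric])
  then have "fscale (2 * l x * l y) (R (x, y)) \<in> W"
    using FV.subspace_neg[OF W rest] by simp
  then have "fscale (1 / (2 * l x * l y)) (fscale (2 * l x * l y) (R (x, y))) \<in> W"
    by (rule FV.subspace_scale[OF W])
  moreover have "l x \<noteq> 0" "l y \<noteq> 0" using nz by (auto simp: B_def)
  ultimately show ?thesis by simp
qed

text \<open>A star of \<open>min d (card U)\<close> edges at \<open>v\<close> is free of relations,
  and each further edge from \<open>v\<close> closes a complete graph on \<open>d + 2\<close>
  vertices. If \<open>card U < d\<close>, the star already reaches all of \<open>U\<close>.\<close>

lemma rk_complete_insert:
  assumes U: "U \<subseteq> {..<n}" and v: "v < n" "v \<notin> U"
  shows "rk (insert v U \<times> insert v U) = rk (U \<times> U) + min d (card U)"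
proof -
  have finU: "finite U" using U finite_subset by blast
  obtain A where A: "A \<subseteq> U" "card A = min d (card U)"
    using finite_choice_subset[OF finU, of "min d (card U)"] by auto
  have finA: "finite A" using A finU finite_subset by blast
  let ?S = "U \<times> U \<union> Pair v ` A"
  have fin: "finite ?S" "finite (insert v U \<times> insert v U)" using finU finA by auto
  have star: "rk ?S = rk (U \<times> U) + card A"
    using U v A finU finA by (intro rk_star) auto
  have inS: "R (v, u) \<in> FV.span (R ` ?S)" if u: "u \<in> U" for u
  proof (cases "u \<in> A")
    case True
    then show ?thesis by (auto intro: FV.span_base)
  next
    case False
    have "card A = d"
    proof (rule ccontr)
      assume "card A \<noteq> d"
      then have "card A = card U" using A by simp
      then show False using A finU u False card_subset_eq by blast
    qed
    show ?thesis
    proof (rule complete_graph_circuit[OF FV.subspace_span _ \<open>card A = d\<close> v(1)])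
      show "A \<subseteq> {..<n} - {v, u}" "u < n" "v \<noteq> u" using A U v False u by auto
      show "R (v, a) \<in> FV.span (R ` ?S)" if "a \<in> A" for a
        using that by (intro FV.span_base) auto
      show "R (u, a) \<in> FV.span (R ` ?S)" if "a \<in> A" for a
        using that u A by (intro FV.span_base) auto
      show "R (b, a) \<in> FV.span (R ` ?S)" if "b \<in> A" "a \<in> A" for a b
        using that A by (intro FV.span_base) auto
    qed
  qed
  have "R ` (insert v U \<times> insert v U) \<subseteq> FV.span (R ` ?S)"
  proof
    fix z assume "z \<in> R ` (insert v U \<times> insert v U)"
    then obtain a b where ab: "a \<in> insert v U" "b \<in> insert v U" "z = R (a, b)" by blast
    then consider "a = b" | "a \<in> U" "b \<in> U" | "a = v" "b \<in> U" | "b = v" "a \<in> U" by blast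
    then show "z \<in> FV.span (R ` ?S)"
    proof cases
      case 1 then show ?thesis using ab FV.span_zero by simp
    next
      case 2 then show ?thesis using ab by (auto intro: FV.span_base)
    next
      case 3 then show ?thesis using ab inS by simp
    next
      case 4 then show ?thesis using ab inS rig_vec_sym by metis
    qed
  qed
  then have "rk (insert v U \<times> insert v U) \<le> rk ?S" using fin by (intro rk_mono)
  moreover have "rk ?S \<le> rk (insert v U \<times> insert v U)"
    using A fin by (intro rk_subset) auto
  ultimately show ?thesis using star A by simp
qed

lemma rk_complete_sum:
  assumes "finite U" "U \<subseteq> {..<n}"
  shows "rk (U \<times> U) = (\<Sum>i<card U. min d i)"
  using assms
proof (induction U rule: finite_induct)
  case empty
  then show ?case using FV.dim_le_card[of "{}" "{}"] by (simp add: rk_def)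
next
  case (insert v U)
  then show ?case using rk_complete_insert[of U v] by simp
qed

lemma sum_min_closed: "d \<le> m \<Longrightarrow> (\<Sum>i<m. min d i) + (d + 1 choose 2) = d * m"
proof (induction m rule: dec_induct)
  case base
  have "(\<Sum>i<d. min d i) = (\<Sum>i<d. i)" by (intro sum.cong) auto
  moreover have "(\<Sum>i<k. i) + (Suc k choose 2) = k * k" for k :: nat
    by (induction k) (simp_all add: numeral_2_eq_2)
  ultimately show ?case by simp
next
  case (step m)
  then show ?case by simp
qed

lemma rk_complete:
  assumes "U \<subseteq> {..<n}" "d \<le> card U"
  shows "rk (U \<times> U) + (d + 1 choose 2) = d * card U"
  using rk_complete_sum[of U] sum_min_closed[OF assms(2)] assms(1) finite_subset by fastforce

text \<open>The binomial correction is dropped, so that the bound covers \<open>card U < d\<close>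
  as well.\<close>

lemma rk_le: 
  assumes "U \<subseteq> {..<n}" "X \<subseteq> U \<times> U"
  shows "rk X \<le> d * card U"
proof -
  have fin: "finite U" using assms finite_subset by blast
  have "rk X \<le> rk (U \<times> U)" using assms fin by (intro rk_subset) auto
  also have "\<dots> = (\<Sum>i<card U. min d i)" using rk_complete_sum fin assms by blast
  also have "\<dots> \<le> (\<Sum>i<card U. d)" by (intro sum_mono) simp
  finally show ?thesis by (simp add: mult.commute)
qed

text \<open>Every \<open>A\<close> lies in \<open>U\<close>, so the vertices of \<open>Y\<close> can
  be added one at a time in any order. A row outside the span of all of \<open>C\<close> is also
  outside the span of the part built so far, as \<open>rk_one_extension\<close> requires.\<close>

lemma rk_grow:
  assumes finY: "finite Y" and U: "U \<union> Y \<subseteq> {..<n}" "U \<inter> Y = {}" and C: "C \<subseteq> {..<n} \<times> {..<n}"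
    and Y: "\<And>v. v \<in> Y \<Longrightarrow> \<exists>A. A \<subseteq> U \<and> Pair v ` A \<subseteq> C \<and> card A = g v \<and>
      (g v \<le> d \<or> g v \<le> d + 1 \<and> (\<exists>x\<in>A. \<exists>y\<in>A. R (x, y) \<notin> FV.span (R ` C)))"
  shows "rk (C \<inter> U \<times> U) + sum g Y \<le> rk (C \<inter> (U \<union> Y) \<times> (U \<union> Y))"
  using finY U Y
proof (induction Y rule: finite_induct)
  case empty
  then show ?case by simp
next
  case (insert v Y)
  let ?X = "C \<inter> (U \<union> Y) \<times> (U \<union> Y)"
  have IH: "rk (C \<inter> U \<times> U) + sum g Y \<le> rk ?X"
    using insert by (intro insert.IH) auto
  obtain A where A: "A \<subseteq> U" "Pair v ` A \<subseteq> C" "card A = g v"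
      "g v \<le> d \<or> g v \<le> d + 1 \<and> (\<exists>x\<in>A. \<exists>y\<in>A. R (x, y) \<notin> FV.span (R ` C))"
    using insert.prems(3)[of v] by blast
  have fin: "finite C" using C finite_subset by blast
  then have finX: "finite ?X" by simp
  have vX: "\<forall>(a, b)\<in>?X. a \<noteq> v \<and> b \<noteq> v" using insert by auto
  have vn: "v < n" "A \<subseteq> {..<n} - {v}" "v \<notin> A" using insert.prems A by auto
  have finA: "finite A" using vn(2) finite_subset by blast
  have "rk ?X + card A \<le> rk (?X \<union> Pair v ` A)"
  proof (cases "g v \<le> d")
    case True
    then show ?thesis using rk_star[OF finX vX vn(1) finA vn(2)] A(3) by simp
  next
    case False
    then obtain x y where xy: "x \<in> A" "y \<in> A" "R (x, y) \<notin> FV.span (R ` C)" "g v \<le> d + 1"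
      using A(4) by blast
    have "R (x, y) \<notin> FV.span (R ` ?X)" using xy(3) FV.span_mono[of "R ` ?X" "R ` C"] by auto
    then show ?thesis
      using finX vX C vn A(3) xy by (intro rk_one_extension) auto
  qed
  also have "\<dots> \<le> rk (C \<inter> (U \<union> insert v Y) \<times> (U \<union> insert v Y))"
    using fin A by (intro rk_subset) auto
  finally show ?case using IH insert.hyps A(3) by simp
qed

lemma rig_rank_eq:
  assumes "finite E"
  shows "rig_rank n d E q = rk E"
proof -
  have fin: "finite {card F | F. F \<subseteq> E \<and> rows_indep n d q F}"
    using finite_image_set[of "\<lambda>F. F \<subseteq> E \<and> rows_indep n d q F" card] assms by simp
  obtain F where F: "F \<subseteq> E" "rows_indep n d q F" "card F = rk E" using rk_basis[OF assms] by metis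
  show ?thesis
    unfolding rig_rank_def
  proof (rule Max_eqI[OF fin])
    show "rk E \<in> {card F | F. F \<subseteq> E \<and> rows_indep n d q F}"
      using F(1,2) F(3)[symmetric] by blast
    fix k assume "k \<in> {card F | F. F \<subseteq> E \<and> rows_indep n d q F}"
    then obtain F' where "k = card F'" "F' \<subseteq> E" "rows_indep n d q F'" by blast
    moreover from this have "finite F'" using assms finite_subset by blast
    ultimately show "k \<le> rk E" using rows_indep_rk[of F'] rk_subset[OF assms, of F'] by simp
  qed
qed

end

text \<open>Specialisation in both directions: any two generic points have the same independent edge
  sets.\<close>

lemma rig_rank_generic_unique:
  assumes "generic n d q" "generic n d q'" "E \<subseteq> {..<n} \<times> {..<n}"
  shows "rig_rank n d E q = rig_rank n d E q'"
proof -
  have "F \<subseteq> E \<and> rows_indep n d q F \<longleftrightarrow> F \<subseteq> E \<and> rows_indep n d q' F" for F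
  proof (cases "F \<subseteq> E")
    case True
    then have "F \<subseteq> {..<n} \<times> {..<n}" using assms(3) by blast
    moreover from this have "finite F" by (rule finite_subset) simp
    ultimately show ?thesis
      using rows_indep_generic[OF assms(1), of F q'] rows_indep_generic[OF assms(2), of F q] by blast
  qed simp
  then show ?thesis unfolding rig_rank_def by simp
qed

subsection \<open>Combinatorial selection lemmas\<close>

lemma exists_le_average:
  fixes f :: "'a \<Rightarrow> real" and b :: real
  assumes "finite A" "A \<noteq> {}" "(\<Sum>a\<in>A. f a) \<le> real (card A) * b"
  shows "\<exists>a\<in>A. f a \<le> b"
proof (rule ccontr)
  assume "\<not> (\<exists>a\<in>A. f a \<le> b)"
  then have "(\<Sum>a\<in>A. b) < (\<Sum>a\<in>A. f a)"
    using assms by (intro sum_strict_mono) auto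
  then show False using assms(3) by simp
qed

text \<open>The sum of \<open>(1 / 2) ^ card (N v \<inter> U)\<close> is a potential. While
  \<open>card U\<close> is below \<open>D / 2\<close>, a uniformly chosen new vertex of
  \<open>H\<close> hits \<open>N v\<close> with probability at least \<open>D / (2 * card H)\<close>
  and then halves its term, so some choice multiplies the potential by at most
  \<open>1 - D / (4 * card H)\<close>.\<close>

lemma greedy_cover:
  fixes N :: "'a \<Rightarrow> 'b set"
  assumes H: "finite H" and V: "finite V"
    and N: "\<And>v. v \<in> V \<Longrightarrow> N v \<subseteq> H \<and> D \<le> card (N v)"
    and D: "0 < D" "D \<le> card H" and s: "2 * s \<le> D"
  shows "\<exists>U\<subseteq>H. card U = s \<and>
    (\<Sum>v\<in>V. (1 / 2 :: real) ^ card (N v \<inter> U)) \<le> real (card V) * (1 - real D / (4 * real (card H))) ^ s"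
  using s
proof (induction s)
  case 0
  then show ?case by (intro exI[of _ "{}"]) simp
next
  case (Suc s)
  then obtain U where U: "U \<subseteq> H" "card U = s"
    and pot: "(\<Sum>v\<in>V. (1 / 2 :: real) ^ card (N v \<inter> U)) \<le> real (card V) * (1 - real D / (4 * real (card H))) ^ s"
    by auto
  define \<beta> where "\<beta> = (1 - real D / (4 * real (card H)))"
  have h: "0 < card H" using D by simp
  have \<beta>: "0 \<le> \<beta>" using D h by (simp add: \<beta>_def field_simps)
  have finU: "finite U" using U H finite_subset by blast
  let ?w = "\<lambda>v U. (1 / 2 :: real) ^ card (N v \<inter> U)"
  have cHU: "card (H - U) = card H - s" using U finU by (simp add: card_Diff_subset)
  have ne: "H - U \<noteq> {}"
  proof
    assume "H - U = {}"
    then have "card H \<le> s" using cHU by (metis card.empty diff_is_0_eq)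
    then show False using Suc.prems D by simp
  qed
  have step: "(\<Sum>u\<in>H - U. ?w v (insert u U)) \<le> card (H - U) * (\<beta> * ?w v U)" if v: "v \<in> V" for v
  proof -
    have finN: "finite (N v)" using N[OF v] H finite_subset by blast
    have "?w v (insert u U) = ?w v U - (if u \<in> N v then ?w v U / 2 else 0)" if "u \<in> H - U" for u
    proof (cases "u \<in> N v")
      case True
      then have "N v \<inter> insert u U = insert u (N v \<inter> U)" by auto
      then have "card (N v \<inter> insert u U) = Suc (card (N v \<inter> U))" using that finN by simp
      then show ?thesis using True by simp
    next
      case False
      then have "N v \<inter> insert u U = N v \<inter> U" by auto
      then show ?thesis using False by simp
    qed
    then have "(\<Sum>u\<in>H - U. ?w v (insert u U)) =
        (\<Sum>u\<in>H - U. ?w v U - (if u \<in> N v then ?w v U / 2 else 0))" by simp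
    also have "\<dots> = card (H - U) * ?w v U - (\<Sum>u\<in>(H - U) \<inter> N v. ?w v U / 2)"
      using H by (simp add: sum_subtractf sum.inter_restrict[symmetric] del: sum_constant)
        (simp add: mult.commute)
    also have "\<dots> = card (H - U) * ?w v U - card ((H - U) \<inter> N v) * (?w v U / 2)" by simp
    also have "\<dots> \<le> card (H - U) * (\<beta> * ?w v U)"
    proof -
      have "(H - U) \<inter> N v = N v - U" using N[OF v] by blast
      moreover have "card (N v) \<le> card (N v - U) + card U"
        using finN finU by (metis card_Un_le card_mono Un_Diff_cancel2 Un_upper1 finite_Un order_trans finite_Diff)
      ultimately have "D \<le> 2 * card ((H - U) \<inter> N v)" using N[OF v] U(2) Suc.prems by simp
      then have "real D / 2 \<le> card ((H - U) \<inter> N v)" by simp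
      moreover have "card (H - U) * (real D / (2 * real (card H))) \<le> real D / 2"
      proof -
        have "real (card (H - U)) \<le> card H" using H by (simp add: card_mono)
        then have "card (H - U) * (real D / (2 * real (card H))) \<le> card H * (real D / (2 * real (card H)))"
          by (intro mult_right_mono) auto
        then show ?thesis using h by simp
      qed
      ultimately have "card (H - U) * (real D / (2 * real (card H))) \<le> card ((H - U) \<inter> N v)" by linarith
      then have "card (H - U) * (real D / (2 * real (card H))) * (?w v U / 2) \<le>
          card ((H - U) \<inter> N v) * (?w v U / 2)" by (intro mult_right_mono) auto
      moreover have "card (H - U) * (\<beta> * ?w v U) =
          card (H - U) * ?w v U - card (H - U) * (real D / (2 * real (card H))) * (?w v U / 2)"
      proof -
        have "real D / (4 * real (card H)) = real D / (2 * real (card H)) / 2" by simp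
        then show ?thesis unfolding \<beta>_def by (simp only: algebra_simps) simp
      qed
      ultimately show ?thesis by linarith
    qed
    finally show ?thesis .
  qed
  have "(\<Sum>u\<in>H - U. \<Sum>v\<in>V. ?w v (insert u U)) = (\<Sum>v\<in>V. \<Sum>u\<in>H - U. ?w v (insert u U))"
    by (rule sum.swap)
  also have "\<dots> \<le> (\<Sum>v\<in>V. card (H - U) * (\<beta> * ?w v U))" by (intro sum_mono step)
  also have "\<dots> = card (H - U) * (\<beta> * (\<Sum>v\<in>V. ?w v U))" by (simp add: sum_distrib_left)
  finally have "\<exists>u\<in>H - U. (\<Sum>v\<in>V. ?w v (insert u U)) \<le> \<beta> * (\<Sum>v\<in>V. ?w v U)"
    using H ne by (intro exists_le_average) auto
  then obtain u where u: "u \<in> H - U" "(\<Sum>v\<in>V. ?w v (insert u U)) \<le> \<beta> * (\<Sum>v\<in>V. ?w v U)" ..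
  have "\<beta> * (\<Sum>v\<in>V. ?w v U) \<le> \<beta> * (card V * \<beta> ^ s)"
    using pot \<beta> by (intro mult_left_mono) (auto simp: \<beta>_def)
  then have "(\<Sum>v\<in>V. ?w v (insert u U)) \<le> card V * \<beta> ^ Suc s" using u(2) by (simp add: mult_ac)
  moreover have "card (insert u U) = Suc s" using u U finU by simp
  ultimately show ?case using u U unfolding \<beta>_def by (intro exI[of _ "insert u U"]) auto
qed

text \<open>Average over all subsets of \<open>H\<close>: since \<open>v\<close>, \<open>x v\<close>
  and \<open>y v\<close> are three distinct points, at least one eighth of the subsets contain the
  last two and avoid the first.\<close>

lemma half_subset:
  fixes x y :: "'a \<Rightarrow> 'a"
  assumes H: "finite H" and T: "T \<subseteq> H"
    and xy: "\<And>v. v \<in> T \<Longrightarrow> x v \<in> H - {v} \<and> y v \<in> H - {v} \<and> x v \<noteq> y v"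
  shows "\<exists>U\<subseteq>H. card T \<le> 8 * card {v \<in> T. v \<notin> U \<and> x v \<in> U \<and> y v \<in> U}"
proof (rule ccontr)
  let ?g = "\<lambda>U. {v \<in> T. v \<notin> U \<and> x v \<in> U \<and> y v \<in> U}"
  assume "\<not> ?thesis"
  then have less: "8 * card (?g U) < card T" if "U \<in> Pow H" for U
    using that by (auto simp: not_le)
  have finT: "finite T" using T H finite_subset by blast
  have fin: "finite (Pow H)" using H by simp
  have "8 * (\<Sum>U\<in>Pow H. card (?g U)) < (\<Sum>U\<in>Pow H. card T)"
    unfolding sum_distrib_left using less fin by (intro sum_strict_mono) auto
  then have up: "8 * (\<Sum>U\<in>Pow H. card (?g U)) < 2 ^ card H * card T"
    using H by (simp add: card_Pow)
  have "(\<Sum>U\<in>Pow H. card (?g U)) = (\<Sum>U\<in>Pow H. \<Sum>v\<in>T. if v \<notin> U \<and> x v \<in> U \<and> y v \<in> U then 1 else 0)"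
    using finT by (simp add: sum.If_cases Int_def)
  also have "\<dots> = (\<Sum>v\<in>T. \<Sum>U\<in>Pow H. if v \<notin> U \<and> x v \<in> U \<and> y v \<in> U then 1 else 0)"
    by (rule sum.swap)
  also have "\<dots> = (\<Sum>v\<in>T. card {U \<in> Pow H. v \<notin> U \<and> x v \<in> U \<and> y v \<in> U})"
    using fin by (simp add: sum.If_cases Int_def)
  finally have eq: "(\<Sum>U\<in>Pow H. card (?g U)) = (\<Sum>v\<in>T. card {U \<in> Pow H. v \<notin> U \<and> x v \<in> U \<and> y v \<in> U})" .
  have "2 ^ card H \<le> 8 * card {U \<in> Pow H. v \<notin> U \<and> x v \<in> U \<and> y v \<in> U}" if v: "v \<in> T" for v
  proof -
    let ?H = "H - {v, x v, y v}"
    have inj: "inj_on (\<lambda>Z. insert (x v) (insert (y v) Z)) (Pow ?H)"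
      by (rule inj_onI) (auto simp: set_eq_iff)
    have c3: "card {v, x v, y v} = 3" using xy[OF v] by auto
    have sub: "{v, x v, y v} \<subseteq> H" using xy[OF v] v T by auto
    have cH: "card H = card ?H + 3" using c3 sub H by (metis card_Diff_subset card_mono finite_subset le_add_diff_inverse2)
    have "2 ^ card ?H = card ((\<lambda>Z. insert (x v) (insert (y v) Z)) ` Pow ?H)"
      using H inj by (simp add: card_image card_Pow)
    also have "\<dots> \<le> card {U \<in> Pow H. v \<notin> U \<and> x v \<in> U \<and> y v \<in> U}"
      using xy[OF v] H by (intro card_mono) auto
    finally show ?thesis unfolding cH by (simp add: power_add)
  qed
  then have "(\<Sum>v\<in>T. 2 ^ card H) \<le> (\<Sum>v\<in>T. 8 * card {U \<in> Pow H. v \<notin> U \<and> x v \<in> U \<and> y v \<in> U})"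
    by (intro sum_mono)
  then have "2 ^ card H * card T \<le> 8 * (\<Sum>U\<in>Pow H. card (?g U))"
    unfolding eq sum_distrib_left by (simp add: mult.commute)
  then show False using up by simp
qed

text \<open>Peel off vertices of degree below \<open>D\<close>. Each one takes fewer than
  \<open>D\<close> neighbours with it, and every such edge is two ordered pairs.\<close>

lemma min_degree_subgraph:
  fixes C :: "('a \<times> 'a) set"
  assumes "finite V" and sym: "\<And>x y. (x, y) \<in> C \<Longrightarrow> (y, x) \<in> C"
  shows "\<exists>H\<subseteq>V. (\<forall>v\<in>H. D \<le> card {u \<in> H. (v, u) \<in> C}) \<and>
    card (C \<inter> V \<times> V - H \<times> H) \<le> 2 * D * card V"
  using assms(1)
proof (induction "card V" arbitrary: V rule: less_induct)
  case less
  show ?case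
  proof (cases "\<forall>v\<in>V. D \<le> card {u \<in> V. (v, u) \<in> C}")
    case True
    have e: "C \<inter> V \<times> V - V \<times> V = {}" by blast
    have "card (C \<inter> V \<times> V - V \<times> V) \<le> 2 * D * card V" unfolding e by simp
    then show ?thesis using True by blast
  next
    case False
    then obtain v where v: "v \<in> V" "card {u \<in> V. (v, u) \<in> C} < D" by (auto simp: not_le)
    let ?V = "V - {v}"
    let ?N = "{u \<in> V. (v, u) \<in> C}"
    have card: "card V = Suc (card ?V)" using v less.prems by (metis card.remove)
    obtain H where H: "H \<subseteq> ?V" "\<forall>v\<in>H. D \<le> card {u \<in> H. (v, u) \<in> C}"
        "card (C \<inter> ?V \<times> ?V - H \<times> H) \<le> 2 * D * card ?V"
      using less.hyps[of ?V] card less.prems by auto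
    have "C \<inter> V \<times> V - H \<times> H \<subseteq> (C \<inter> ?V \<times> ?V - H \<times> H) \<union> (Pair v ` ?N \<union> (\<lambda>u. (u, v)) ` ?N)"
      using sym by auto
    then have "card (C \<inter> V \<times> V - H \<times> H) \<le>
        card ((C \<inter> ?V \<times> ?V - H \<times> H) \<union> (Pair v ` ?N \<union> (\<lambda>u. (u, v)) ` ?N))"
      using less.prems by (intro card_mono) auto
    also have "\<dots> \<le> card (C \<inter> ?V \<times> ?V - H \<times> H) + (card (Pair v ` ?N) + card ((\<lambda>u. (u, v)) ` ?N))"
      by (meson card_Un_le le_trans nat_add_left_cancel_le)
    also have "\<dots> \<le> 2 * D * card ?V + (D + D)"
      using H(3) v(2) less.prems card_image_le[of ?N "Pair v"] card_image_le[of ?N "\<lambda>u. (u, v)"]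
      by (intro add_mono) auto
    also have "\<dots> = 2 * D * card V" unfolding card by simp
    finally show ?thesis using H by (intro exI[of _ H]) auto
  qed
qed

subsection \<open>Closed graphs are almost disjoint unions of cliques\<close>

context generic_framework
begin

text \<open>Edges are unordered in \<^const>\<open>all_edges\<close>, but closed graphs are symmetric relations, in which
  every edge is counted twice.\<close>

definition cl :: "(nat \<times> nat) set \<Rightarrow> (nat \<times> nat) set" where
  "cl E = {(x, y). x < n \<and> y < n \<and> x \<noteq> y \<and> R (x, y) \<in> FV.span (R ` E)}"

lemma cl_subset: "cl E \<subseteq> {..<n} \<times> {..<n}"
  by (auto simp: cl_def)

lemma finite_cl: "finite (cl E)"
  using cl_subset finite_subset by blast

lemma cl_sym: "(x, y) \<in> cl E \<Longrightarrow> (y, x) \<in> cl E"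
  using rig_vec_sym[of n d q x y] by (auto simp: cl_def)

lemma span_cl: "FV.span (R ` cl E) \<subseteq> FV.span (R ` E)"
  by (intro FV.span_minimal FV.subspace_span) (auto simp: cl_def)

text \<open>Add the vertices of \<open>H\<close> in this order: a small set \<open>U0\<close> meeting every neighbourhood in more
  than \<open>d\<close> vertices, a random half of the rest, and finally the others. A nonsimplicial vertex comes
  after two of its nonadjacent neighbours with probability about \<open>1 / 8\<close>, and then gains \<open>d + 1\<close>.\<close>

lemma nonsimplicial_few:
  fixes E defines "C \<equiv> cl E"
  assumes d: "1 \<le> d" and H: "H \<subseteq> {..<n}"
    and deg: "\<And>v. v \<in> H \<Longrightarrow> D \<le> card {u \<in> H. (v, u) \<in> C}"
    and D: "0 < D" and s: "2 * s \<le> D" and small: "real n * (1 - real D / (4 * real n)) ^ s < (1 / 2 :: real) ^ d"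
  shows "card {v \<in> H. \<exists>x\<in>H. \<exists>y\<in>H. (v, x) \<in> C \<and> (v, y) \<in> C \<and> x \<noteq> y \<and> (x, y) \<notin> C}
    \<le> (8 * d + 1) * s" (is "card ?NS \<le> _")
proof (cases "H = {}")
  case True
  then show ?thesis by simp
next
  case False
  have finH: "finite H" using H finite_subset by blast
  define N where "N = (\<lambda>v. {u \<in> H. (v, u) \<in> C})"
  obtain v0 where v0: "v0 \<in> H" using False by blast
  have DH: "D \<le> card H"
    using deg[OF v0] finH card_mono[of H "{u \<in> H. (v0, u) \<in> C}"] by force
  have h: "0 < card H" "card H \<le> n"
    using DH D H card_mono[of "{..<n}" H] by auto
  obtain U0 where U0: "U0 \<subseteq> H" "card U0 = s"
    and pot: "(\<Sum>v\<in>H. (1 / 2 :: real) ^ card (N v \<inter> U0)) \<le> real (card H) * (1 - real D / (4 * real (card H))) ^ s"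
    using greedy_cover[OF finH finH _ D DH s, of N] deg unfolding N_def by blast
  have finU0: "finite U0" using U0 finH finite_subset by blast
  \<comment> \<open>One term of the potential is at most the whole sum, which is below
    \<open>(1 / 2) ^ d\<close>, so its exponent exceeds \<open>d\<close>. The extra neighbour leaves
    room for a one-extension.\<close>
  have hits: "d + 1 \<le> card (N v \<inter> U0)" if v: "v \<in> H" for v
  proof -
    have "(1 / 2 :: real) ^ card (N v \<inter> U0) \<le> (\<Sum>v\<in>H. (1 / 2 :: real) ^ card (N v \<inter> U0))"
      using v finH by (intro member_le_sum) auto
    also have "\<dots> \<le> real (card H) * (1 - real D / (4 * real (card H))) ^ s" by (rule pot)
    also have "\<dots> \<le> real n * (1 - real D / (4 * real n)) ^ s"
    proof (intro mult_mono power_mono)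
      show "1 - real D / (4 * real (card H)) \<le> 1 - D / (4 * real n)"
        using h by (simp add: frac_le)
      show "0 \<le> 1 - real D / (4 * real (card H))" using h DH by (simp add: field_simps)
    qed (use h DH in \<open>auto simp: field_simps\<close>)
    also have "\<dots> < (1 / 2) ^ d" by (rule small)
    finally have "d < card (N v \<inter> U0)"
      by (subst (asm) power_strict_decreasing_iff) auto
    then show ?thesis by simp
  qed
  define T where "T = ?NS - U0"
  have "\<forall>v\<in>T. \<exists>xy. fst xy \<in> H \<and> snd xy \<in> H \<and> (v, fst xy) \<in> C \<and> (v, snd xy) \<in> C \<and>
      fst xy \<noteq> snd xy \<and> xy \<notin> C"
    by (auto simp: T_def) 
  from bchoice[OF this] obtain xy where xy: "\<And>v. v \<in> T \<Longrightarrow> fst (xy v) \<in> H \<and> snd (xy v) \<in> H \<and>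
      (v, fst (xy v)) \<in> C \<and> (v, snd (xy v)) \<in> C \<and> fst (xy v) \<noteq> snd (xy v) \<and> xy v \<notin> C"
    by blast
  have irr: "(v, v) \<notin> C" for v by (auto simp: C_def cl_def)
  obtain U where U: "U \<subseteq> H"
      "card T \<le> 8 * card {v \<in> T. v \<notin> U \<and> fst (xy v) \<in> U \<and> snd (xy v) \<in> U}" (is "_ \<le> 8 * card ?G")
  proof -
    have "T \<subseteq> H" by (auto simp: T_def)
    moreover have "fst (xy v) \<in> H - {v} \<and> snd (xy v) \<in> H - {v} \<and> fst (xy v) \<noteq> snd (xy v)"
      if "v \<in> T" for v
      using xy[OF that] irr[of v] by (metis Diff_iff singletonD)
    ultimately show ?thesis
      using half_subset[OF finH, of T "\<lambda>v. fst (xy v)" "\<lambda>v. snd (xy v)"] that by blast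
  qed
  define U1 where "U1 = U0 \<union> U"
  have CN: "C \<subseteq> {..<n} \<times> {..<n}" unfolding C_def by (rule cl_subset)
  have finC: "finite C" unfolding C_def by (rule finite_cl)
  have stage1: "rk (C \<inter> U0 \<times> U0) + (\<Sum>v\<in>U - U0. d) \<le> rk (C \<inter> (U0 \<union> (U - U0)) \<times> (U0 \<union> (U - U0)))"
  proof (rule rk_grow)
    fix v assume v: "v \<in> U - U0"
    then have "d \<le> card (N v \<inter> U0)" using hits[of v] U by auto
    then obtain A where A: "A \<subseteq> N v \<inter> U0" "card A = d"
      using finite_choice_subset[of "N v \<inter> U0" d] finU0 by auto
    then show "\<exists>A\<subseteq>U0. Pair v ` A \<subseteq> C \<and> card A = d \<and>
        (d \<le> d \<or> d \<le> d + 1 \<and> (\<exists>x\<in>A. \<exists>y\<in>A. R (x, y) \<notin> FV.span (R ` C)))"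
      by (intro exI[of _ A]) (auto simp: N_def)
  qed (use U U0 H CN finH finite_subset in \<open>auto simp: finite_subset\<close>)
  define g where "g = (\<lambda>v. if v \<in> ?G then d + 1 else d)"
  have finG: "finite (H - U1)" using finH by simp
  have GY: "?G \<subseteq> H - U1" by (auto simp: T_def U1_def)
  have stage2: "rk (C \<inter> U1 \<times> U1) + (\<Sum>v\<in>H - U1. g v) \<le> rk (C \<inter> (U1 \<union> (H - U1)) \<times> (U1 \<union> (H - U1)))"
  proof (rule rk_grow[OF finG])
    fix v assume v: "v \<in> H - U1"
    have finN: "finite (N v \<inter> U1)" using finH by (simp add: N_def)
    have "card (N v \<inter> U0) \<le> card (N v \<inter> U1)"
      using finN by (intro card_mono) (auto simp: U1_def)
    then have big: "d + 1 \<le> card (N v \<inter> U1)" using hits[of v] v by auto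
    show "\<exists>A\<subseteq>U1. Pair v ` A \<subseteq> C \<and> card A = g v \<and>
        (g v \<le> d \<or> g v \<le> d + 1 \<and> (\<exists>x\<in>A. \<exists>y\<in>A. R (x, y) \<notin> FV.span (R ` C)))"
    proof (cases "v \<in> ?G")
      case False
      obtain A where A: "A \<subseteq> N v \<inter> U1" "card A = d"
        using finite_choice_subset[OF finN, of d] big by auto
      then show ?thesis using False by (intro exI[of _ A]) (auto simp: N_def g_def)
    next
      case True
      define x where "x = fst (xy v)"
      define y where "y = snd (xy v)"
      have xy': "x \<in> N v \<inter> U1" "y \<in> N v \<inter> U1" "x \<noteq> y" "(x, y) \<notin> C" "x < n" "y < n"
        using True xy[of v] H by (auto simp: x_def y_def N_def U1_def)
      have "card (N v \<inter> U1 - {x, y}) = card (N v \<inter> U1) - 2"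
        using xy' finN by (subst card_Diff_subset) auto
      then have "d - 1 \<le> card (N v \<inter> U1 - {x, y})" using big by simp
      then obtain B where B: "B \<subseteq> N v \<inter> U1 - {x, y}" "card B = d - 1"
        using finite_choice_subset[of "N v \<inter> U1 - {x, y}" "d - 1"] finN by auto
      have finB: "finite B" using B(1) finN finite_subset by blast
      have "card (insert x (insert y B)) = d + 1"
        using B xy' finB d by (subst card_insert_disjoint card_insert_disjoint; auto)+
      moreover have "R (x, y) \<notin> FV.span (R ` C)"
        using xy' span_cl[of E] by (auto simp: C_def cl_def)
      moreover have "insert x (insert y B) \<subseteq> N v \<inter> U1" using B xy' by auto
      ultimately show ?thesis
        using True by (intro exI[of _ "insert x (insert y B)"]) (auto simp: N_def g_def)
    qed
  qed (use U U0 H CN in \<open>auto simp: U1_def\<close>)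
  have "(\<Sum>v\<in>H - U1. g v) = (\<Sum>v\<in>H - U1. d + (if v \<in> ?G then 1 else 0))"
    by (intro sum.cong) (auto simp: g_def)
  also have "\<dots> = d * card (H - U1) + card ((H - U1) \<inter> ?G)"
    unfolding sum.distrib using finG by (simp add: sum.If_cases mult.commute Int_def)
  also have "(H - U1) \<inter> ?G = ?G" using GY by blast
  finally have sg: "(\<Sum>v\<in>H - U1. g v) = d * card (H - U1) + card ?G" .
  have U1H: "U1 \<subseteq> H" "U0 \<union> (U - U0) = U1" "U1 \<union> (H - U1) = H" using U U0 by (auto simp: U1_def)
  have finU1: "finite U1" using U1H finH finite_subset by blast
  have "card U1 = s + card (U - U0)"
    using U1H(2) U0 finU0 finU1 by (metis Diff_disjoint card_Un_disjoint finite_Un)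
  moreover have "card H = card U1 + card (H - U1)"
    using U1H(3) finU1 finG by (metis Diff_disjoint card_Un_disjoint)
  ultimately have cH: "d * card H = d * s + d * card (U - U0) + d * card (H - U1)"
    by (simp add: add_mult_distrib2)
  \<comment> \<open>Nothing is claimed about the rank inside \<open>U0\<close>. Without
    \<open>card ?G\<close> the lower bound is thus short of the ceiling \<open>d * card H\<close> by
    exactly \<open>d * s\<close>, and the extra gains must fit into this gap.\<close>
  have "d * card (U - U0) + (d * card (H - U1) + card ?G) \<le> rk (C \<inter> H \<times> H)"
    using stage1 stage2 sg U1H by (simp add: mult.commute)
  also have "\<dots> \<le> d * card H" using H by (intro rk_le) auto
  finally have "card ?G \<le> d * s" using cH by simp
  then have "card T \<le> 8 * d * s" using U(2) by simp
  moreover have "card ?NS \<le> card T + card U0"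
  proof -
    have "card ?NS \<le> card (T \<union> U0)" using finH finU0 by (intro card_mono) (auto simp: T_def)
    then show ?thesis using card_Un_le[of T U0] by simp
  qed
  ultimately show ?thesis using U0(2) by simp
qed

text \<open>Colour 0 marks vertices in no clique, every other colour is one clique. Pairs are
  ordered, to be comparable with \<open>cl\<close>.\<close>

definition mono_pairs :: "(nat \<Rightarrow> nat) \<Rightarrow> (nat \<times> nat) set" where
  "mono_pairs f = {(x, y). x < n \<and> y < n \<and> x \<noteq> y \<and> f x = f y \<and> f x \<noteq> 0}"

text \<open>A simplicial vertex lies in only one maximal clique, so adjacency is an equivalence relation
  on the simplicial vertices; \<open>f\<close> numbers its classes.\<close>

lemma closed_structure:
  fixes E defines "C \<equiv> cl E"
  assumes d: "1 \<le> d" and s: "2 * s \<le> D" and small: "real n * (1 - real D / (4 * real n)) ^ s < (1 / 2 :: real) ^ d"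
    and NB: "(8 * d + 1) * s < D" and K: "n \<le> K * (D - (8 * d + 1) * s)"
  shows "\<exists>f. (\<forall>v. f v \<le> K) \<and> mono_pairs f \<subseteq> C \<and>
    card (C - mono_pairs f) \<le> 2 * D * n + 2 * n * ((8 * d + 1) * s)"
proof -
  define b where "b = (8 * d + 1) * s"
  have sym: "\<And>x y. (x, y) \<in> C \<Longrightarrow> (y, x) \<in> C" unfolding C_def by (rule cl_sym)
  have irr: "(x, x) \<notin> C" for x by (auto simp: C_def cl_def)
  have CN: "C \<subseteq> {..<n} \<times> {..<n}" unfolding C_def by (rule cl_subset)
  obtain H where H: "H \<subseteq> {..<n}" "\<forall>v\<in>H. D \<le> card {u \<in> H. (v, u) \<in> C}"
      "card (C \<inter> {..<n} \<times> {..<n} - H \<times> H) \<le> 2 * D * card {..<n}"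
    using min_degree_subgraph[of "{..<n}" C D] sym by auto
  have finH: "finite H" using H finite_subset by blast
  define NS where "NS = {v \<in> H. \<exists>x\<in>H. \<exists>y\<in>H. (v, x) \<in> C \<and> (v, y) \<in> C \<and> x \<noteq> y \<and> (x, y) \<notin> C}"
  have cNS: "card NS \<le> b"
    unfolding NS_def b_def C_def using H NB
    by (intro nonsimplicial_few[OF d _ _ _ s small]) (auto simp: C_def)
  have finNS: "finite NS" using finH by (simp add: NS_def)
  define S where "S = H - NS"
  have finS: "finite S" using finH by (simp add: S_def)
  have simp: "(x, y) \<in> C" if "v \<in> S" "x \<in> H" "y \<in> H" "(v, x) \<in> C" "(v, y) \<in> C" "x \<noteq> y" for v x y
    using that unfolding S_def NS_def by blast
  define cls where "cls = (\<lambda>u. {w \<in> S. w = u \<or> (u, w) \<in> C})"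
  define P where "P = cls ` S"
  have SH: "S \<subseteq> H" by (auto simp: S_def)
  have eqv: "cls u = cls v" if u: "u \<in> S" and v: "v \<in> S" and adj: "u = v \<or> (u, v) \<in> C" for u v
  proof -
    have "w \<in> cls v" if "w \<in> cls u" "u \<in> S" "v \<in> S" "(u, v) \<in> C" for u v w
      using that simp[of u v w] SH sym unfolding cls_def by blast
    then show ?thesis using u v adj sym by blast
  qed
  have in_cls: "u \<in> cls u" if "u \<in> S" for u using that by (simp add: cls_def)
  have disj: "p = p'" if pP: "p \<in> P" "p' \<in> P" and ne: "p \<inter> p' \<noteq> {}" for p p'
  proof -
    obtain w where w: "w \<in> p" "w \<in> p'" using ne by blast
    obtain u where u: "u \<in> S" "p = cls u" using pP(1) unfolding P_def by blast
    obtain u' where u': "u' \<in> S" "p' = cls u'" using pP(2) unfolding P_def by blast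
    have "w \<in> S" "u = w \<or> (u, w) \<in> C" "u' = w \<or> (u', w) \<in> C"
      using w u u' by (auto simp: cls_def)
    then show ?thesis using eqv[of u w] eqv[of u' w] u u' by simp
  qed
  have finP: "finite P" using finS by (simp add: P_def)
  \<comment> \<open>The pruning to minimum degree \<open>D\<close> pays off here: a class contains
    all neighbours in \<open>H\<close> of its representative except the at most \<open>b\<close>
    nonsimplicial ones. Disjoint classes of this size number at most \<open>K\<close>.\<close>
  have size: "D - b \<le> card p" if pP: "p \<in> P" for p
  proof -
    obtain u where u: "u \<in> S" "p = cls u" using pP by (auto simp: P_def)
    have "{w \<in> H. (u, w) \<in> C} - NS \<subseteq> p" using u by (auto simp: cls_def S_def)
    then have "card ({w \<in> H. (u, w) \<in> C} - NS) \<le> card p"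
      using u finS by (intro card_mono) (auto simp: cls_def)
    moreover have "card {w \<in> H. (u, w) \<in> C} - card NS \<le> card ({w \<in> H. (u, w) \<in> C} - NS)"
      using finNS by (rule diff_card_le_card_Diff)
    moreover have "D \<le> card {w \<in> H. (u, w) \<in> C}" using H(2) u SH by blast
    ultimately show ?thesis using cNS by linarith
  qed
  have "card P * (D - b) \<le> (\<Sum>p\<in>P. card p)"
    using sum_mono[of P "\<lambda>_. D - b" card] size by simp
  also have "\<dots> = card (\<Union>P)"
    using disj finP finS by (intro card_Union_disjoint[symmetric])
      (auto simp: pairwise_def disjnt_def P_def cls_def)
  also have "\<dots> \<le> card {..<n}"
    using SH H(1) by (intro card_mono) (auto simp: P_def cls_def)
  also have "\<dots> \<le> K * (D - b)" using K by (simp add: b_def)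
  finally have "card P * (D - b) \<le> K * (D - b)" .
  moreover have "0 < D - b" using NB by (simp add: b_def)
  ultimately have cP: "card P \<le> K" by simp
  obtain h where h: "bij_betw h P {0..<card P}"
    using ex_bij_betw_finite_nat[OF finP] by blast
  have hlt: "h p < card P" if "p \<in> P" for p using h that bij_betwE by fastforce
  have hinj: "h p = h p' \<longleftrightarrow> p = p'" if "p \<in> P" "p' \<in> P" for p p'
    using h that by (auto simp: bij_betw_def inj_on_def)
  define f where "f = (\<lambda>v. if v \<in> S then Suc (h (cls v)) else 0)"
  have clsP: "cls v \<in> P" if "v \<in> S" for v using that by (simp add: P_def)
  have "f v \<le> K" for v using hlt[OF clsP, of v] cP by (auto simp: f_def)
  moreover have "mono_pairs f \<subseteq> C"
  proof
    fix e assume "e \<in> mono_pairs f"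
    then obtain x y where e: "e = (x, y)" "x \<noteq> y" "f x = f y" "f x \<noteq> 0"
      by (auto simp: mono_pairs_def)
    then have xy: "x \<in> S" "y \<in> S" by (auto simp: f_def split: if_splits)
    then have "cls x = cls y" using e hinj[OF clsP clsP, of x y] by (simp add: f_def)
    then have "y \<in> cls x" using in_cls[OF xy(2)] by simp
    then show "e \<in> C" using e by (auto simp: cls_def)
  qed
  moreover have "card (C - mono_pairs f) \<le> 2 * D * n + 2 * n * b"
  proof -
    \<comment> \<open>A pair is lost either by the pruning or because it touches a nonsimplicial
      vertex.\<close>
    have "C - mono_pairs f \<subseteq> (C \<inter> {..<n} \<times> {..<n} - H \<times> H) \<union> (NS \<times> {..<n} \<union> {..<n} \<times> NS)"
    proof
      fix e assume e: "e \<in> C - mono_pairs f"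
      obtain x y where xy: "e = (x, y)" by (cases e)
      have n: "x < n" "y < n" "x \<noteq> y" using e xy CN irr by auto
      show "e \<in> (C \<inter> {..<n} \<times> {..<n} - H \<times> H) \<union> (NS \<times> {..<n} \<union> {..<n} \<times> NS)"
      proof (rule ccontr)
        assume "\<not> ?thesis"
        then have "x \<in> S" "y \<in> S" using e xy n by (auto simp: S_def)
        moreover from this have "cls x = cls y" using eqv e xy by blast
        ultimately show False using e n unfolding xy f_def mono_pairs_def by auto
      qed
    qed
    then have "card (C - mono_pairs f) \<le>
        card ((C \<inter> {..<n} \<times> {..<n} - H \<times> H) \<union> (NS \<times> {..<n} \<union> {..<n} \<times> NS))"
      using finNS by (intro card_mono) auto
    also have "\<dots> \<le> card (C \<inter> {..<n} \<times> {..<n} - H \<times> H) + (card (NS \<times> {..<n}) + card ({..<n} \<times> NS))"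
      by (meson card_Un_le le_trans nat_add_left_cancel_le)
    also have "\<dots> \<le> 2 * D * n + (b * n + n * b)"
      using H(3) cNS by (intro add_mono) (auto simp: card_cartesian_product)
    finally show ?thesis by (simp add: mult_ac)
  qed
  ultimately show ?thesis unfolding b_def by blast
qed

text \<open>Reserve \<open>d\<close> vertices of each class, or the whole class if it is smaller.
  Every other coloured vertex sees \<open>d\<close> reserved ones of its own class and gains
  \<open>d\<close>; the at most \<open>K * d\<close> reserved vertices account for the loss
  \<open>K * d * d\<close>.\<close>

lemma rk_mono_pairs:
  assumes "\<forall>v. f v \<le> K"
  shows "d * card {v \<in> {..<n}. f v \<noteq> 0} \<le> rk (mono_pairs f) + K * d * d"
proof -
  let ?V = "\<lambda>j. {v \<in> {..<n}. f v = j}"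
  have "\<forall>j. \<exists>A. A \<subseteq> ?V j \<and> card A = min d (card (?V j))"
    by (intro allI finite_choice_subset) auto
  from choice[OF this] obtain A where "\<forall>j. A j \<subseteq> ?V j \<and> card (A j) = min d (card (?V j))" ..
  then have A: "A j \<subseteq> ?V j" "card (A j) = min d (card (?V j))" for j by simp_all
  define U where "U = (\<Union>j\<in>{1..K}. A j)"
  define Y where "Y = {v \<in> {..<n}. f v \<noteq> 0} - U"
  let ?C = "mono_pairs f"
  have Un: "U \<subseteq> {..<n}" using A(1) by (auto simp: U_def)
  have "rk (?C \<inter> U \<times> U) + (\<Sum>v\<in>Y. d) \<le> rk (?C \<inter> (U \<union> Y) \<times> (U \<union> Y))"
  proof (rule rk_grow)
    fix v assume v: "v \<in> Y"
    have j: "f v \<in> {1..K}" "v < n" "v \<notin> U" using v assms by (auto simp: Y_def Suc_le_eq)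
    have "card (A (f v)) = d"
    proof (rule ccontr)
      assume "card (A (f v)) \<noteq> d"
      then have "card (A (f v)) = card (?V (f v))" using A(2)[of "f v"] by simp
      then have "A (f v) = ?V (f v)" using A(1)[of "f v"] by (intro card_subset_eq) auto
      then show False using j by (auto simp: U_def)
    qed
    moreover have "Pair v ` A (f v) \<subseteq> ?C"
    proof
      fix e assume "e \<in> Pair v ` A (f v)"
      then obtain a where a: "e = (v, a)" "a \<in> A (f v)" by blast
      have "a \<in> U" using a j by (auto simp: U_def)
      then show "e \<in> ?C" using a j A(1)[of "f v"] by (auto simp: mono_pairs_def)
    qed
    moreover have "A (f v) \<subseteq> U" using j by (auto simp: U_def)
    ultimately show "\<exists>A\<subseteq>U. Pair v ` A \<subseteq> ?C \<and> card A = d \<and>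
        (d \<le> d \<or> d \<le> d + 1 \<and> (\<exists>x\<in>A. \<exists>y\<in>A. R (x, y) \<notin> FV.span (R ` ?C)))"
      by (intro exI[of _ "A (f v)"]) simp
  qed (use Un in \<open>auto simp: Y_def mono_pairs_def\<close>)
  also have "\<dots> \<le> rk ?C"
  proof (rule rk_subset)
    show "finite ?C" by (rule finite_subset[of _ "{..<n} \<times> {..<n}"]) (auto simp: mono_pairs_def)
  qed auto
  finally have "d * card Y \<le> rk ?C" by (simp add: mult.commute)
  moreover have "card {v \<in> {..<n}. f v \<noteq> 0} \<le> card Y + card U"
  proof -
    have "card {v \<in> {..<n}. f v \<noteq> 0} \<le> card (Y \<union> U)"
      using finite_subset[OF Un] by (intro card_mono) (auto simp: Y_def)
    then show ?thesis using card_Un_le[of Y U] by simp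
  qed
  moreover have "card U \<le> K * d"
  proof -
    have "card U \<le> (\<Sum>j\<in>{1..K}. card (A j))" unfolding U_def by (rule card_UN_le) simp
    also have "\<dots> \<le> (\<Sum>j\<in>{1..K}. d)" by (intro sum_mono) (simp add: A(2))
    finally show ?thesis by simp
  qed
  ultimately have "card {v \<in> {..<n}. f v \<noteq> 0} \<le> card Y + K * d" by simp
  then have "d * card {v \<in> {..<n}. f v \<noteq> 0} \<le> d * (card Y + K * d)" by (rule mult_le_mono2)
  also have "\<dots> = d * card Y + d * (K * d)" by (rule add_mult_distrib2)
  finally have "d * card {v \<in> {..<n}. f v \<noteq> 0} \<le> d * card Y + d * (K * d)" .
  then show ?thesis using \<open>d * card Y \<le> rk ?C\<close> by (simp add: mult_ac)
qed

end

subsection \<open>Expectations over random subsets\<close>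

text \<open>The ground set is a parameter so that proofs can expose one element at a time;
  \<open>all_edges n\<close> gives the weights of \<open>prob_Gnp\<close>.\<close>

definition subset_expect :: "real \<Rightarrow> 'a set \<Rightarrow> ('a set \<Rightarrow> real) \<Rightarrow> real" where
  "subset_expect p A f = (\<Sum>E\<in>Pow A. p ^ card E * (1 - p) ^ (card A - card E) * f E)"

lemma subset_expect_empty [simp]: "subset_expect p {} f = f {}"
  by (simp add: subset_expect_def)

lemma subset_expect_insert:
  assumes "finite A" "e \<notin> A"
  shows "subset_expect p (insert e A) f =
    p * subset_expect p A (\<lambda>E. f (insert e E)) + (1 - p) * subset_expect p A f"
proof -
  let ?w = "\<lambda>A E. p ^ card E * (1 - p) ^ (card A - card E)"
  have le: "card E \<le> card A" "finite E" "e \<notin> E" if "E \<in> Pow A" for E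
    using that assms card_mono[of A E] finite_subset[of E A] by auto
  have disj: "Pow A \<inter> insert e ` Pow A = {}" using assms(2) by auto
  have inj: "inj_on (insert e) (Pow A)"
    using assms(2) by (intro inj_onI) (auto simp: set_eq_iff)
  have "subset_expect p (insert e A) f =
      (\<Sum>E\<in>Pow A. ?w (insert e A) E * f E) + (\<Sum>E\<in>insert e ` Pow A. ?w (insert e A) E * f E)"
    unfolding subset_expect_def Pow_insert using assms(1) disj by (intro sum.union_disjoint) auto
  also have "(\<Sum>E\<in>Pow A. ?w (insert e A) E * f E) = (1 - p) * subset_expect p A f"
    unfolding subset_expect_def sum_distrib_left
    using assms le by (intro sum.cong refl) (auto simp: Suc_diff_le mult_ac)
  also have "(\<Sum>E\<in>insert e ` Pow A. ?w (insert e A) E * f E) =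
      p * subset_expect p A (\<lambda>E. f (insert e E))"
    unfolding subset_expect_def sum_distrib_left sum.reindex[OF inj]
    using assms le by (intro sum.cong refl) (auto simp: mult_ac)
  finally show ?thesis by simp
qed

lemma subset_expect_mono:
  assumes "0 \<le> p" "p \<le> 1" "\<And>E. E \<subseteq> A \<Longrightarrow> f E \<le> g E"
  shows "subset_expect p A f \<le> subset_expect p A g"
  unfolding subset_expect_def using assms by (intro sum_mono mult_left_mono) auto

lemma subset_expect_cmult: "subset_expect p A (\<lambda>E. c * f E) = c * subset_expect p A f"
  by (simp add: subset_expect_def sum_distrib_left mult_ac)

lemma subset_expect_sum: "subset_expect p A (\<lambda>E. \<Sum>i\<in>I. f i E) = (\<Sum>i\<in>I. subset_expect p A (f i))"
  unfolding subset_expect_def sum_distrib_left by (rule sum.swap)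

lemma subset_expect_cong:
  "(\<And>E. E \<subseteq> A \<Longrightarrow> f E = g E) \<Longrightarrow> subset_expect p A f = subset_expect p A g"
  by (simp add: subset_expect_def)

text \<open>The generating function of a binomial variable with \<open>card (A \<inter> F)\<close>
  trials; every exponential tail bound of this kind below starts from it.\<close>

lemma subset_expect_power:
  assumes "finite A"
  shows "subset_expect p A (\<lambda>E. z ^ card (E \<inter> F)) = (1 - p + p * z) ^ card (A \<inter> F)"
  using assms
proof (induction A rule: finite_induct)
  case empty
  then show ?case by simp
next
  case (insert e A)
  show ?case
  proof (cases "e \<in> F")
    case True
    have "subset_expect p A (\<lambda>E. z ^ card (insert e E \<inter> F)) =
        subset_expect p A (\<lambda>E. z * z ^ card (E \<inter> F))"
    proof (rule subset_expect_cong)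
      fix E assume "E \<subseteq> A"
      then have "finite (E \<inter> F)" "e \<notin> E" using insert.hyps finite_subset by auto
      then show "z ^ card (insert e E \<inter> F) = z * z ^ card (E \<inter> F)" using True by simp
    qed
    then show ?thesis
      using insert True by (simp add: subset_expect_insert subset_expect_cmult algebra_simps)
  next
    case False
    then show ?thesis using insert by (simp add: subset_expect_insert algebra_simps)
  qed
qed

lemma subset_expect_const: "finite A \<Longrightarrow> subset_expect p A (\<lambda>_. c) = c"
  using subset_expect_power[of A p 1 "{}"] subset_expect_cmult[of p A c "\<lambda>_. 1"] by simp

lemma finite_all_edges: "finite (all_edges n)"
  by (rule finite_subset[of _ "{..<n} \<times> {..<n}"]) (auto simp: all_edges_def)

lemma card_all_edges: "2 * card (all_edges n) = n * (n - 1)"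
proof (induction n)
  case 0
  then show ?case by (simp add: all_edges_def)
next
  case (Suc n)
  have "all_edges (Suc n) = all_edges n \<union> (\<lambda>x. (x, n)) ` {..<n}"
    by (auto simp: all_edges_def less_Suc_eq)
  moreover have "all_edges n \<inter> (\<lambda>x. (x, n)) ` {..<n} = {}" by (auto simp: all_edges_def)
  ultimately have "card (all_edges (Suc n)) = card (all_edges n) + n"
    using finite_all_edges[of n] by (simp add: card_Un_disjoint card_image inj_on_def)
  then show ?case using Suc by (cases n) (auto simp: algebra_simps)
qed

lemma prob_Gnp_expect:
  "prob_Gnp n p P = subset_expect p (all_edges n) (\<lambda>E. if P E then 1 else 0)"
proof -
  have "subset_expect p (all_edges n) (\<lambda>E. if P E then 1 else 0) =
      (\<Sum>E\<in>Pow (all_edges n). if P E then p ^ card E * (1 - p) ^ (card (all_edges n) - card E) else 0)"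
    unfolding subset_expect_def by (intro sum.cong) auto
  also have "\<dots> = prob_Gnp n p P"
    unfolding prob_Gnp_def using finite_all_edges[of n]
    by (subst sum.inter_filter[symmetric]) (auto simp: Pow_def intro!: sum.cong)
  finally show ?thesis by simp
qed

lemma prob_Gnp_markov:
  assumes "0 \<le> p" "p \<le> 1" "\<And>E. E \<subseteq> all_edges n \<Longrightarrow> 0 \<le> f E"
    and "\<And>E. E \<subseteq> all_edges n \<Longrightarrow> P E \<Longrightarrow> 1 \<le> f E"
  shows "prob_Gnp n p P \<le> subset_expect p (all_edges n) f"
  unfolding prob_Gnp_expect using assms by (intro subset_expect_mono) auto

lemma prob_Gnp_mono:
  assumes "0 \<le> p" "p \<le> 1" "\<And>E. E \<subseteq> all_edges n \<Longrightarrow> P E \<Longrightarrow> Q E"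
  shows "prob_Gnp n p P \<le> prob_Gnp n p Q"
  unfolding prob_Gnp_expect using assms by (intro subset_expect_mono) auto

lemma prob_Gnp_nonneg: "0 \<le> p \<Longrightarrow> p \<le> 1 \<Longrightarrow> 0 \<le> prob_Gnp n p P"
  unfolding prob_Gnp_def by (intro sum_nonneg) auto

lemma prob_Gnp_or:
  assumes "0 \<le> p" "p \<le> 1"
  shows "prob_Gnp n p (\<lambda>E. P E \<or> Q E) \<le> prob_Gnp n p P + prob_Gnp n p Q"
proof -
  have "prob_Gnp n p P + prob_Gnp n p Q =
      subset_expect p (all_edges n) (\<lambda>E. (if P E then 1 else 0) + (if Q E then 1 else 0))"
    unfolding prob_Gnp_expect subset_expect_def by (simp add: sum.distrib[symmetric] distrib_left)
  then show ?thesis unfolding prob_Gnp_expect[of n p "\<lambda>E. P E \<or> Q E"]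
    using assms by (auto intro!: subset_expect_mono)
qed

lemma prob_Gnp_compl: "prob_Gnp n p P = 1 - prob_Gnp n p (\<lambda>E. \<not> P E)"
proof -
  have "prob_Gnp n p P + prob_Gnp n p (\<lambda>E. \<not> P E) = subset_expect p (all_edges n) (\<lambda>_. 1)"
    unfolding prob_Gnp_expect subset_expect_def
    by (simp add: sum.distrib[symmetric] distrib_left[symmetric] del: distrib_left) (intro sum.cong, auto)
  then show ?thesis using subset_expect_const[OF finite_all_edges, of p n 1] by simp
qed

lemma sum_power_card_Pow:
  fixes y :: real
  assumes "finite A"
  shows "(\<Sum>B\<in>Pow A. y ^ card B) = (1 + y) ^ card A"
  using assms
proof (induction A rule: finite_induct)
  case empty
  then show ?case by simp
next
  case (insert a A)
  have "(\<Sum>B\<in>Pow (insert a A). y ^ card B) =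
      (\<Sum>B\<in>Pow A. y ^ card B) + (\<Sum>B\<in>insert a ` Pow A. y ^ card B)"
    unfolding Pow_insert using insert.hyps by (intro sum.union_disjoint) auto
  also have "(\<Sum>B\<in>insert a ` Pow A. y ^ card B) = (\<Sum>B\<in>Pow A. y * y ^ card B)"
  proof (subst sum.reindex)
    show "inj_on (insert a) (Pow A)"
      using insert.hyps by (intro inj_onI) (auto simp: set_eq_iff)
    have "card (insert a B) = Suc (card B)" if "B \<in> Pow A" for B
      using that insert.hyps finite_subset[of B A] by (subst card_insert_disjoint) auto
    then show "sum ((\<lambda>B. y ^ card B) \<circ> insert a) (Pow A) = (\<Sum>B\<in>Pow A. y * y ^ card B)"
      by (intro sum.cong) auto
  qed
  finally show ?case using insert by (simp add: sum_distrib_left[symmetric] algebra_simps)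
qed

subsection \<open>Edges leaving small vertex sets\<close>

definition edge_cut :: "nat \<Rightarrow> nat set \<Rightarrow> (nat \<times> nat) set" where
  "edge_cut n B = {(x, y) \<in> all_edges n. (x \<in> B) \<noteq> (y \<in> B)}"

lemma card_edge_cut:
  assumes "B \<subseteq> {..<n}"
  shows "card (edge_cut n B) = card B * (n - card B)"
proof -
  have "bij_betw (\<lambda>(x, y). (min x y, max x y)) (B \<times> ({..<n} - B)) (edge_cut n B)"
  proof (rule bij_betw_byWitness[where f' = "\<lambda>(x, y). if x \<in> B then (x, y) else (y, x)"])
    show "(\<lambda>(x, y). (min x y, max x y)) ` (B \<times> ({..<n} - B)) \<subseteq> edge_cut n B"
    proof
      fix e assume "e \<in> (\<lambda>(x, y). (min x y, max x y)) ` (B \<times> ({..<n} - B))"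
      then obtain x y where xy: "x \<in> B" "y < n" "y \<notin> B" "e = (min x y, max x y)" by auto
      moreover have "x < n" "x \<noteq> y" using xy assms by auto
      ultimately show "e \<in> edge_cut n B"
        by (cases "x < y") (auto simp: edge_cut_def all_edges_def min_def max_def)
    qed
    show "(\<lambda>(x, y). if x \<in> B then (x, y) else (y, x)) ` edge_cut n B \<subseteq> B \<times> ({..<n} - B)"
      by (auto simp: edge_cut_def all_edges_def)
  qed (auto simp: edge_cut_def all_edges_def min_def max_def)
  then have "card (edge_cut n B) = card (B \<times> ({..<n} - B))" by (simp add: bij_betw_same_card)
  also have "\<dots> = card B * (n - card B)"
    using assms finite_subset[OF assms] by (simp add: card_cartesian_product card_Diff_subset)
  finally show ?thesis .
qed

text \<open>Markov's inequality with the weight 2 to the power \<open>d * card B\<close> minus the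
  number of cut edges. The base 2 is the optimal tilt when \<open>d\<close> is half of the mean
  degree n p. A cut of \<open>B\<close> has at least \<open>card B * (1 - \<eta>) * n\<close> pairs,
  so \<open>B\<close> contributes at most \<open>y ^ card B\<close>, and the binomial theorem sums
  this over all nonempty sets.\<close>

lemma prob_small_cut:
  fixes p \<eta> :: real and n d :: nat
  assumes p: "0 \<le> p" "p \<le> 1" and \<eta>: "0 \<le> \<eta>"
  shows "prob_Gnp n p (\<lambda>E. \<exists>B\<subseteq>{..<n}. B \<noteq> {} \<and> card B \<le> \<eta> * n \<and> card (E \<inter> edge_cut n B) \<le> d * card B)
    \<le> exp (n * exp (d * ln 2 - (1 - \<eta>) * n * p / 2)) - 1"
proof -
  define y where "y = exp (real d * ln 2 - (1 - \<eta>) * n * p / 2)"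
  define \<B> where "\<B> = {B \<in> Pow {..<n}. B \<noteq> {} \<and> card B \<le> \<eta> * n}"
  have fin: "finite \<B>" by (simp add: \<B>_def)
  let ?f = "\<lambda>B E. 2 ^ (d * card B) * (1 / 2 :: real) ^ card (E \<inter> edge_cut n B)"
  have "prob_Gnp n p (\<lambda>E. \<exists>B\<subseteq>{..<n}. B \<noteq> {} \<and> card B \<le> \<eta> * n \<and> card (E \<inter> edge_cut n B) \<le> d * card B)
      \<le> subset_expect p (all_edges n) (\<lambda>E. \<Sum>B\<in>\<B>. ?f B E)"
  proof (rule prob_Gnp_markov[OF p])
    fix E assume "\<exists>B\<subseteq>{..<n}. B \<noteq> {} \<and> card B \<le> \<eta> * n \<and> card (E \<inter> edge_cut n B) \<le> d * card B"
    then obtain B where B: "B \<in> \<B>" "card (E \<inter> edge_cut n B) \<le> d * card B" by (auto simp: \<B>_def)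
    have "1 \<le> ?f B E"
      using power_increasing[OF B(2), of "2 :: real"] by (simp add: power_one_over field_simps)
    also have "\<dots> \<le> (\<Sum>B\<in>\<B>. ?f B E)" using B(1) fin by (intro member_le_sum) auto
    finally show "1 \<le> (\<Sum>B\<in>\<B>. ?f B E)" .
  qed (auto intro!: sum_nonneg)
  also have "\<dots> = (\<Sum>B\<in>\<B>. 2 ^ (d * card B) * (1 - p / 2) ^ card (edge_cut n B))"
  proof -
    have "all_edges n \<inter> edge_cut n B = edge_cut n B" for B by (auto simp: edge_cut_def)
    then show ?thesis
      unfolding subset_expect_sum subset_expect_cmult subset_expect_power[OF finite_all_edges]
      by (simp add: algebra_simps)
  qed
  also have "\<dots> \<le> (\<Sum>B\<in>\<B>. y ^ card B)"
  proof (rule sum_mono)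
    fix B assume B: "B \<in> \<B>"
    then have Bn: "B \<subseteq> {..<n}" "real (card B) \<le> \<eta> * n" by (auto simp: \<B>_def)
    have cB: "card B \<le> n" using Bn(1) card_mono[of "{..<n}" B] by simp
    have "(1 - p / 2) ^ card (edge_cut n B) \<le> exp (- p / 2) ^ card (edge_cut n B)"
      using p exp_ge_add_one_self[of "- p / 2"] by (intro power_mono) auto
    also have "\<dots> = exp (- p / 2 * (card B * (n - card B)))"
      unfolding card_edge_cut[OF Bn(1)] using cB
      by (simp add: exp_of_nat_mult[symmetric] of_nat_diff mult_ac)
    also have "\<dots> \<le> exp (- p / 2 * (card B * ((1 - \<eta>) * n)))"
    proof -
      have "(1 - \<eta>) * n \<le> real n - card B" using Bn(2) by (simp add: algebra_simps)
      then have "p / 2 * (card B * ((1 - \<eta>) * n)) \<le> p / 2 * (card B * (real n - card B))"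
        using p by (intro mult_left_mono) auto
      then show ?thesis using cB by (simp add: of_nat_diff)
    qed
    finally have "(1 - p / 2) ^ card (edge_cut n B) \<le> exp (- p / 2 * (card B * ((1 - \<eta>) * n)))" .
    then have "2 ^ (d * card B) * (1 - p / 2) ^ card (edge_cut n B) \<le>
        2 ^ (d * card B) * exp (- p / 2 * (card B * ((1 - \<eta>) * n)))"
      by (intro mult_left_mono) auto
    also have "2 ^ (d * card B) * exp (- p / 2 * (card B * ((1 - \<eta>) * n))) =
        exp (real (d * card B) * ln 2) * exp (- p / 2 * (card B * ((1 - \<eta>) * n)))"
      unfolding exp_of_nat_mult[of "d * card B" "ln 2"] by simp
    also have "\<dots> = y ^ card B"
      unfolding y_def exp_add[symmetric] exp_of_nat_mult[symmetric] by (simp add: field_simps)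
    finally show "2 ^ (d * card B) * (1 - p / 2) ^ card (edge_cut n B) \<le> y ^ card B" .
  qed
  also have "\<dots> \<le> (\<Sum>B\<in>Pow {..<n} - {{}}. y ^ card B)"
    by (intro sum_mono2) (auto simp: \<B>_def y_def)
  also have "\<dots> = (1 + y) ^ n - 1"
    using sum_power_card_Pow[of "{..<n}" y] by (simp add: sum_diff1)
  also have "\<dots> \<le> exp (n * y) - 1"
    using exp_ge_add_one_self[of y] power_mono[of "1 + y" "exp y" n]
    by (simp add: exp_of_nat_mult y_def add_nonneg_nonneg)
  finally show ?thesis by (simp add: y_def)
qed

subsection \<open>A Chernoff bound for the rank of a random edge set\<close>

context generic_framework
begin

text \<open>Expose the elements of \<open>A\<close> one at a time. An element already spanned is irrelevant; every
  other one raises the rank with probability \<open>p\<close>, and there are at least as many of these as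
  elements outside the final closure.\<close>

lemma rank_chernoff:
  assumes A: "finite A" and X: "finite X" and p: "0 \<le> p" "p \<le> 1" and z: "0 \<le> z" "z \<le> 1"
  shows "subset_expect p A (\<lambda>E. if t \<le> card {e \<in> A. R e \<notin> FV.span (R ` (X \<union> E))}
      then z ^ (rk (X \<union> E) - rk X) else 0) \<le> (1 - p + p * z) ^ t"
  using A X
proof (induction A arbitrary: X t rule: finite_induct)
  case empty
  have "0 \<le> 1 - p + p * z" using p z by simp
  then show ?case by simp
next
  case (insert e A)
  let ?out = "\<lambda>X A E. {e \<in> A. R e \<notin> FV.span (R ` (X \<union> E))}"
  let ?g = "\<lambda>X t A E. if t \<le> card (?out X A E) then z ^ (rk (X \<union> E) - rk X) else 0"
  have q: "0 \<le> 1 - p + p * z" "1 - p + p * z \<le> 1"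
    using p z mult_left_le[of z p] by auto
  have span_mono: "FV.span (R ` X) \<subseteq> FV.span (R ` (X \<union> E))" for E :: "(nat \<times> nat) set"
    by (intro FV.span_mono) auto
  have finE: "finite E" if "E \<subseteq> A" for E using that insert.hyps finite_subset by blast
  show ?case
  proof (cases "R e \<in> FV.span (R ` X)")
    case True
    have same: "FV.span (R ` (X \<union> insert e E)) = FV.span (R ` (X \<union> E))" for E
    proof -
      have "R e \<in> FV.span (R ` (X \<union> E))" using True span_mono by blast
      then have "FV.span (insert (R e) (R ` (X \<union> E))) = FV.span (R ` (X \<union> E))"
        by (rule FV.span_redundant)
      then show ?thesis by simp
    qed
    have rks: "rk (X \<union> insert e E) = rk (X \<union> E)" for E
      unfolding rk_def using same[of E] FV.dim_span by metis
    have "?out X (insert e A) E = ?out X A E" for E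
      using True span_mono by auto
    then have "?g X t (insert e A) E = ?g X t A E" "?g X t (insert e A) (insert e E) = ?g X t A E" for E
      using same rks by simp_all
    then have "subset_expect p (insert e A) (?g X t (insert e A)) =
        p * subset_expect p A (?g X t A) + (1 - p) * subset_expect p A (?g X t A)"
      by (simp only: subset_expect_insert[OF insert.hyps])
    also have "\<dots> = subset_expect p A (?g X t A)" by (simp add: algebra_simps)
    also have "\<dots> \<le> (1 - p + p * z) ^ t" by (rule insert.IH[OF insert.prems])
    finally show ?thesis .
  next
    case False
    define X' where "X' = insert e X"
    have rk': "rk X' = Suc (rk X)" using rk_insert[OF insert.prems] False by (simp add: X'_def)
    have "?g X t (insert e A) (insert e E) \<le> z * ?g X' t A E" if E: "E \<subseteq> A" for E
    proof -
      have eq: "X \<union> insert e E = X' \<union> E" by (simp add: X'_def)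
      have "R e \<in> FV.span (R ` (X' \<union> E))" by (intro FV.span_base) (auto simp: X'_def)
      then have "?out X (insert e A) (insert e E) = ?out X' A E" unfolding eq by auto
      moreover have "rk X' \<le> rk (X' \<union> E)"
        using finE[OF E] insert.prems by (intro rk_subset) (auto simp: X'_def)
      ultimately show ?thesis unfolding eq rk' by (simp add: Suc_diff_Suc Suc_le_eq flip: power_Suc)
    qed
    then have "subset_expect p A (\<lambda>E. ?g X t (insert e A) (insert e E)) \<le>
        subset_expect p A (\<lambda>E. z * ?g X' t A E)"
      using p by (intro subset_expect_mono)
    also have "\<dots> = z * subset_expect p A (?g X' t A)" by (rule subset_expect_cmult)
    also have "\<dots> \<le> z * (1 - p + p * z) ^ t"
      using z insert.prems by (intro mult_left_mono insert.IH) (auto simp: X'_def)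
    \<comment> \<open>With \<open>e\<close> present it is spanned, so the count of unspanned
      elements did not drop. One factor is given away to match the other branch.\<close>
    also have "\<dots> \<le> z * (1 - p + p * z) ^ (t - 1)"
      using z q by (intro mult_left_mono power_decreasing) auto
    finally have 1: "subset_expect p A (\<lambda>E. ?g X t (insert e A) (insert e E)) \<le>
        z * (1 - p + p * z) ^ (t - 1)" .
    \<comment> \<open>With \<open>e\<close> absent the only element that may leave the count is
      \<open>e\<close> itself, so \<open>t\<close> drops by one and the rank gain is
      unchanged.\<close>
    have "?g X t (insert e A) E \<le> ?g X (t - 1) A E" for E
    proof -
      have "card (?out X (insert e A) E) \<le> card (insert e (?out X A E))"
        using insert.hyps by (intro card_mono) auto
      also have "\<dots> \<le> Suc (card (?out X A E))" by (rule card_insert_le_m1[THEN order_trans]) auto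
      finally show ?thesis using z by auto
    qed
    then have "subset_expect p A (?g X t (insert e A)) \<le> subset_expect p A (?g X (t - 1) A)"
      using p by (intro subset_expect_mono)
    also have "\<dots> \<le> (1 - p + p * z) ^ (t - 1)" by (rule insert.IH[OF insert.prems])
    finally have 2: "subset_expect p A (?g X t (insert e A)) \<le> (1 - p + p * z) ^ (t - 1)" .
    have "subset_expect p (insert e A) (?g X t (insert e A)) \<le>
        p * (z * (1 - p + p * z) ^ (t - 1)) + (1 - p) * (1 - p + p * z) ^ (t - 1)"
      unfolding subset_expect_insert[OF insert.hyps] using 1 2 p
      by (intro add_mono mult_left_mono) auto
    also have "\<dots> = (1 - p + p * z) * (1 - p + p * z) ^ (t - 1)" by (simp add: algebra_simps)
    \<comment> \<open>For \<open>t = 0\<close> also \<open>t - 1 = 0\<close>; the surplus factor is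
      then at most 1.\<close>
    also have "\<dots> \<le> (1 - p + p * z) ^ t" using q by (cases t) auto
    finally show ?thesis .
  qed
qed

end

section \<open>A clique containing almost all vertices\<close>

lemma card_all_edges_real: "real (card (all_edges n)) = real n * (real n - 1) / 2"
proof -
  have "2 * real (card (all_edges n)) = real (n * (n - 1))"
    using card_all_edges[of n] by (metis of_nat_mult of_nat_numeral)
  then show ?thesis by (cases n) (auto simp: algebra_simps)
qed

context generic_framework
begin

lemma card_unordered_le:
  assumes "C \<subseteq> {..<n} \<times> {..<n}" and sym: "\<And>x y. (x, y) \<in> C \<Longrightarrow> (y, x) \<in> C"
  shows "2 * card (all_edges n \<inter> C) \<le> card C"
proof -
  let ?A = "all_edges n \<inter> C"
  have finC: "finite C" using assms(1) finite_subset by blast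
  have "card (prod.swap ` ?A) = card ?A" by (simp add: card_image)
  moreover have "?A \<inter> prod.swap ` ?A = {}" by (auto simp: all_edges_def)
  ultimately have "2 * card ?A = card (?A \<union> prod.swap ` ?A)"
    using finC by (subst card_Un_disjoint) auto
  also have "\<dots> \<le> card C" using sym finC by (intro card_mono) auto
  finally show ?thesis .
qed

lemma finite_mono_pairs: "finite (mono_pairs f)"
  by (rule finite_subset[of _ "{..<n} \<times> {..<n}"]) (auto simp: mono_pairs_def)

lemma span_Un_cl:
  assumes "M \<subseteq> cl E"
  shows "FV.span (R ` (M \<union> E)) = FV.span (R ` E)"
proof (rule FV.span_eq[THEN iffD2], intro conjI)
  show "R ` (M \<union> E) \<subseteq> FV.span (R ` E)"
    using assms by (auto simp: cl_def intro: FV.span_base)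
  show "R ` E \<subseteq> FV.span (R ` (M \<union> E))" by (auto intro: FV.span_base)
qed

definition clique :: "(nat \<times> nat) set \<Rightarrow> nat set \<Rightarrow> bool" where
  "clique E A \<longleftrightarrow> A \<subseteq> {..<n} \<and> (\<forall>x\<in>A. \<forall>y\<in>A. x \<noteq> y \<longrightarrow> (x, y) \<in> cl E)"

text \<open>The estimate of a sum of squares of class sizes by the largest size times their
  sum.\<close>

lemma card_mono_pairs_le:
  fixes c :: real
  assumes "\<And>j. j \<noteq> 0 \<Longrightarrow> card {v \<in> {..<n}. f v = j} \<le> c" and "0 \<le> c"
  shows "card (mono_pairs f) \<le> c * card {v \<in> {..<n}. f v \<noteq> 0}"
proof -
  let ?S = "{v \<in> {..<n}. f v \<noteq> 0}"
  have "mono_pairs f \<subseteq> (SIGMA x : ?S. {v \<in> {..<n}. f v = f x})"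
    by (auto simp: mono_pairs_def)
  then have "card (mono_pairs f) \<le> card (SIGMA x : ?S. {v \<in> {..<n}. f v = f x})"
    by (intro card_mono) auto
  also have "\<dots> = (\<Sum>x\<in>?S. card {v \<in> {..<n}. f v = f x})"
    by (simp add: card_SigmaI)
  finally have "real (card (mono_pairs f)) \<le> real (\<Sum>x\<in>?S. card {v \<in> {..<n}. f v = f x})"
    by (rule of_nat_mono)
  also have "\<dots> = (\<Sum>x\<in>?S. real (card {v \<in> {..<n}. f v = f x}))" by (rule of_nat_sum)
  also have "\<dots> \<le> (\<Sum>x\<in>?S. c)" using assms by (intro sum_mono) auto
  finally show ?thesis by (simp add: mult.commute)
qed

text \<open>In units of \<open>N\<close>, with \<open>\<sigma>\<close> the proportion of coloured
  vertices, the missing rank is at most \<open>(1 - 2 * \<epsilon>) * (1 - \<sigma>)\<close> and the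
  expected number of edges outside the cliques at least \<open>1 - (1 - \<eta>) * \<sigma>\<close>,
  each up to \<open>\<kappa> / 4\<close>. The gap is at least \<open>\<kappa> / 2\<close>, so a tilt
  \<open>\<theta>\<close> costs \<open>- \<theta> * \<kappa> / 2 + \<theta>\<^sup>2 / 2\<close>,
  which is minimal at \<open>\<theta> = \<kappa> / 2\<close> with value
  \<open>- \<kappa>\<^sup>2 / 8\<close>.\<close>

lemma colouring_exponent:
  fixes p \<epsilon> \<eta> \<kappa> :: real and S M L :: nat
  defines "N \<equiv> p * (real n)\<^sup>2 / 2"
  assumes n: "0 < n" and p: "0 \<le> p"
    and \<kappa>: "0 < \<kappa>" "\<kappa> \<le> 2 * \<epsilon>" "\<kappa> \<le> \<eta>" and \<eta>: "\<eta> \<le> 1"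
    and d: "d * n \<le> (1 - 2 * \<epsilon>) * N" and Kd: "K * d * d \<le> \<kappa> / 4 * N"
    and L: "L + n + 2 \<le> \<kappa> / 4 * (real n)\<^sup>2" and S: "S \<le> n" and M: "M \<le> (1 - \<eta>) * n * S"
    and t: "real t \<ge> (n * (real n - 1) - M - L) / 2 - 1"
    and m: "real m = real d * (real n - real S) + K * d * d"
  shows "\<kappa> / 2 * m - p * (1 - exp (- (\<kappa> / 2))) * t \<le> - (\<kappa>\<^sup>2 / 8 * N)"
proof -
  define \<theta> where "\<theta> = \<kappa> / 2"
  define \<sigma> where "\<sigma> = S / real n"
  define y where "y = 1 - (1 - \<eta>) * \<sigma>"
  have N: "0 \<le> N" using p by (simp add: N_def)
  have \<sigma>: "0 \<le> \<sigma>" "\<sigma> \<le> 1" using S n by (auto simp: \<sigma>_def field_simps)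
  have Sn: "real S = \<sigma> * n" using n by (simp add: \<sigma>_def)
  have y: "\<eta> \<le> y" "y \<le> 1"
    using \<sigma> \<eta> mult_left_mono[OF \<sigma>(2), of "1 - \<eta>"] by (auto simp: y_def)
  have m': "real m \<le> ((1 - 2 * \<epsilon>) * (1 - \<sigma>) + \<kappa> / 4) * N"
  proof -
    have "real d * (real n - real S) = (1 - \<sigma>) * (d * n)" by (simp add: Sn algebra_simps)
    also have "\<dots> \<le> (1 - \<sigma>) * ((1 - 2 * \<epsilon>) * N)" using \<sigma> d by (intro mult_left_mono) auto
    finally show ?thesis using Kd m by (simp add: algebra_simps)
  qed
  \<comment> \<open>The \<open>n\<close> in \<open>L + n + 2\<close> replaces
    \<open>n * (n - 1)\<close> by \<open>n\<^sup>2\<close>; the 2 is the doubled rounding error of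
    \<open>t\<close>.\<close>
  have pt: "(y - \<kappa> / 4) * N \<le> p * t"
  proof -
    have "(y - \<kappa> / 4) * (real n)\<^sup>2 \<le> 2 * real t"
    proof -
      have "(y - \<kappa> / 4) * (real n)\<^sup>2 = (real n)\<^sup>2 - (1 - \<eta>) * n * S - \<kappa> / 4 * (real n)\<^sup>2"
        by (simp add: y_def Sn power2_eq_square algebra_simps)
      also have "\<dots> \<le> (real n)\<^sup>2 - M - (L + n + 2)" using M L by simp
      also have "\<dots> \<le> 2 * real t" using t by (simp add: power2_eq_square algebra_simps)
      finally show ?thesis .
    qed
    from mult_left_mono[OF this, of "p / 2"] p show ?thesis by (simp add: N_def algebra_simps)
  qed
  have z: "\<theta> - \<theta>\<^sup>2 / 2 \<le> 1 - exp (- \<theta>)"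
  proof -
    have "exp (- \<theta>) \<le> 1 + (- \<theta>) + (- \<theta>)\<^sup>2 / 2"
    proof -
      obtain u where u: "\<bar>u\<bar> \<le> \<bar>- \<theta>\<bar>"
        "exp (- \<theta>) = (\<Sum>m<3. (- \<theta>) ^ m / fact m) + exp u / fact 3 * (- \<theta>) ^ 3"
        using Maclaurin_exp_le[of "- \<theta>" 3] by blast
      have "exp u / fact 3 * (- \<theta>) ^ 3 \<le> 0"
        using \<kappa> by (intro mult_nonneg_nonpos) (auto simp: \<theta>_def)
      then show ?thesis using u(2) by (simp add: eval_nat_numeral)
    qed
    then show ?thesis by simp
  qed
  have \<theta>: "0 < \<theta>" "\<theta> \<le> 1" using \<kappa> \<eta> by (auto simp: \<theta>_def)
  have w: "0 \<le> y - \<kappa> / 4" "y - \<kappa> / 4 \<le> 1" using y \<kappa> by auto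
  have "(\<theta> * (y - \<kappa> / 4) - \<theta>\<^sup>2 / 2) * N \<le> (\<theta> - \<theta>\<^sup>2 / 2) * ((y - \<kappa> / 4) * N)"
  proof -
    have "\<theta>\<^sup>2 / 2 * ((y - \<kappa> / 4) * N) \<le> \<theta>\<^sup>2 / 2 * (1 * N)"
      using w N by (intro mult_left_mono mult_right_mono) auto
    then show ?thesis by (simp add: algebra_simps)
  qed
  also have "\<dots> \<le> (1 - exp (- \<theta>)) * (p * t)"
    using w(1) N \<theta> by (intro mult_mono[OF z pt]) auto
  finally have 1: "(\<theta> * (y - \<kappa> / 4) - \<theta>\<^sup>2 / 2) * N \<le> p * (1 - exp (- \<theta>)) * t"
    by (simp add: mult_ac)
  have "\<theta> * m \<le> \<theta> * (((1 - 2 * \<epsilon>) * (1 - \<sigma>) + \<kappa> / 4) * N)" using \<theta> m' by (intro mult_left_mono) auto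
  then have "\<theta> * m - p * (1 - exp (- \<theta>)) * t \<le>
      (\<theta> * ((1 - 2 * \<epsilon>) * (1 - \<sigma>) - y + \<kappa> / 2) + \<theta>\<^sup>2 / 2) * N"
    using 1 by (simp add: algebra_simps)
  also have "\<dots> \<le> (\<theta> * (- (\<kappa> / 2)) + \<theta>\<^sup>2 / 2) * N"
  proof -
    \<comment> \<open>The gap is the convex combination
      \<open>2 * \<epsilon> * (1 - \<sigma>) + \<eta> * \<sigma>\<close>: uncoloured vertices pay by
      the subcritical \<open>d\<close>, coloured ones by the absence of a giant class.\<close>
    have "\<kappa> * (1 - \<sigma>) + \<kappa> * \<sigma> \<le> 2 * \<epsilon> * (1 - \<sigma>) + \<eta> * \<sigma>"
      using \<sigma> \<kappa> by (intro add_mono mult_right_mono) auto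
    then have "(1 - 2 * \<epsilon>) * (1 - \<sigma>) - y \<le> - \<kappa>" by (simp add: y_def algebra_simps)
    then show ?thesis using \<theta> N by (intro mult_right_mono add_mono mult_left_mono) auto
  qed
  also have "\<dots> = - (\<kappa>\<^sup>2 / 8 * N)" by (simp add: \<theta>_def power2_eq_square algebra_simps)
  finally show ?thesis by (simp add: \<theta>_def)
qed

text \<open>Union bound over colourings all of whose cliques are smaller than or equal to
  \<open>(1 - \<eta>) * n\<close>. For fixed \<open>f\<close> the bad event limits the rank gain
  over \<open>mono_pairs f\<close> to \<open>m f\<close> although at least \<open>t f\<close> pairs
  stay unspanned. On this event \<open>exp (\<theta> * m f)\<close> times \<open>z\<close> to the
  power of the gain is at least 1, and \<open>rank_chernoff\<close> bounds its expectation.\<close>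

lemma prob_no_giant_clique:
  fixes p \<epsilon> \<eta> \<kappa> :: real and s D K :: nat
  defines "N \<equiv> p * (real n)\<^sup>2 / 2" and "L \<equiv> 2 * D * n + 2 * n * ((8 * d + 1) * s)"
  assumes n: "0 < n" and p: "0 \<le> p" "p \<le> 1"
    and \<kappa>: "0 < \<kappa>" "\<kappa> \<le> 2 * \<epsilon>" "\<kappa> \<le> \<eta>" and \<eta>: "\<eta> \<le> 1"
    and dN: "d * n \<le> (1 - 2 * \<epsilon>) * N" and Kd: "K * d * d \<le> \<kappa> / 4 * N"
    and L: "L + n + 2 \<le> \<kappa> / 4 * (real n)\<^sup>2"
    and d: "1 \<le> d" and s: "2 * s \<le> D"
    and small: "real n * (1 - real D / (4 * real n)) ^ s < (1 / 2 :: real) ^ d"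
    and NB: "(8 * d + 1) * s < D" and K: "n \<le> K * (D - (8 * d + 1) * s)"
  shows "prob_Gnp n p (\<lambda>E. \<not> (\<exists>A. clique E A \<and> (1 - \<eta>) * n \<le> card A))
    \<le> (real K + 1) ^ n * exp (- (\<kappa>\<^sup>2 / 8 * N))"
proof -
  define \<theta> where "\<theta> = \<kappa> / 2"
  define z where "z = exp (- \<theta>)"
  \<comment> \<open>\<open>PiE\<close> fixes the values outside \<open>{..<n}\<close> so that the
    colourings can be counted; colour 0, of unrestricted size, turns \<open>K\<close> into
    \<open>K + 1\<close>.\<close>
  define Fs where "Fs = {f \<in> PiE {..<n} (\<lambda>_. {..K}).
    \<forall>j. j \<noteq> 0 \<longrightarrow> card {v \<in> {..<n}. f v = j} \<le> (1 - \<eta>) * n}"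
  define S where "S = (\<lambda>f::nat \<Rightarrow> nat. card {v \<in> {..<n}. f v \<noteq> 0})"
  \<comment> \<open>Closure pairs are ordered and \<open>all_edges\<close> are not, hence
    \<open>div 2\<close>. If the truncated difference is 0, the requirement
    \<open>t f \<le> ?cnt f E\<close> is trivial.\<close>
  define t where "t = (\<lambda>f. (n * (n - 1) - card (mono_pairs f) - L) div 2)"
  define m where "m = (\<lambda>f. d * (n - S f) + K * d * d)"
  let ?cnt = "\<lambda>f E. card {e \<in> all_edges n. R e \<notin> FV.span (R ` (mono_pairs f \<union> E))}"
  let ?g = "\<lambda>f E. if t f \<le> ?cnt f E
      then z ^ (rk (mono_pairs f \<union> E) - rk (mono_pairs f)) else 0"
  have z: "0 < z" "z \<le> 1" using \<kappa> by (auto simp: z_def \<theta>_def)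
  have finFs: "finite Fs"
    unfolding Fs_def by (rule finite_subset[of _ "PiE {..<n} (\<lambda>_. {..K})"]) (auto intro: finite_PiE)
  have "card Fs \<le> card (PiE {..<n} (\<lambda>_. {..K}))"
    unfolding Fs_def by (intro card_mono) (auto intro: finite_PiE)
  then have "card Fs \<le> (K + 1) ^ n" by (simp add: card_PiE)
  then have "real (card Fs) \<le> real ((K + 1) ^ n)" by (rule of_nat_mono)
  then have cFs: "real (card Fs) \<le> (real K + 1) ^ n" by (simp add: add.commute)
  have S: "S f \<le> n" for f
    unfolding S_def using card_mono[of "{..<n}" "{v \<in> {..<n}. f v \<noteq> 0}"] by auto
  have key: "\<exists>f\<in>Fs. t f \<le> ?cnt f E \<and> rk (mono_pairs f \<union> E) - rk (mono_pairs f) \<le> m f"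
    if E: "E \<subseteq> all_edges n" and no: "\<not> (\<exists>A. clique E A \<and> (1 - \<eta>) * n \<le> card A)" for E
  proof -
    obtain f0 where f0: "\<forall>v. f0 v \<le> K" "mono_pairs f0 \<subseteq> cl E" "card (cl E - mono_pairs f0) \<le> L"
      using closed_structure[OF d s small NB K, of E] unfolding L_def by blast
    define f where "f = restrict f0 {..<n}"
    have fv: "f v = f0 v" if "v < n" for v using that by (simp add: f_def)
    have Mf: "mono_pairs f = mono_pairs f0" unfolding mono_pairs_def using fv by auto
    have cli: "clique E {v \<in> {..<n}. f v = j}" if "j \<noteq> 0" for j
      unfolding clique_def
    proof (intro conjI ballI impI)
      fix x y assume "x \<in> {v \<in> {..<n}. f v = j}" "y \<in> {v \<in> {..<n}. f v = j}" "x \<noteq> y"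
      then have "(x, y) \<in> mono_pairs f" using that by (auto simp: mono_pairs_def)
      then show "(x, y) \<in> cl E" using f0(2) Mf by auto
    qed auto
    have "f \<in> Fs"
    proof -
      have "card {v \<in> {..<n}. f v = j} \<le> (1 - \<eta>) * n" if "j \<noteq> 0" for j
        using no cli[OF that] by (meson linear)
      moreover have "f \<in> PiE {..<n} (\<lambda>_. {..K})" using f0(1) by (auto simp: f_def)
      ultimately show ?thesis by (simp add: Fs_def)
    qed
    moreover have "t f \<le> ?cnt f E"
    proof -
      have sp: "FV.span (R ` (mono_pairs f \<union> E)) = FV.span (R ` E)"
        using span_Un_cl f0(2) Mf by simp
      have eq: "{e \<in> all_edges n. R e \<notin> FV.span (R ` (mono_pairs f \<union> E))} =
          all_edges n - all_edges n \<inter> cl E"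
        unfolding sp by (auto simp: cl_def all_edges_def)
      have "2 * card (all_edges n \<inter> cl E) \<le> card (cl E)"
        by (rule card_unordered_le[OF cl_subset cl_sym])
      also have "\<dots> \<le> card (mono_pairs f \<union> (cl E - mono_pairs f))"
        using finite_mono_pairs finite_cl by (intro card_mono) auto
      also have "\<dots> \<le> card (mono_pairs f) + L"
        using card_Un_le[of "mono_pairs f" "cl E - mono_pairs f"] f0(3) Mf by simp
      finally have "2 * card (all_edges n \<inter> cl E) \<le> card (mono_pairs f) + L" .
      moreover have "?cnt f E = card (all_edges n) - card (all_edges n \<inter> cl E)"
        unfolding eq using finite_all_edges[of n] by (intro card_Diff_subset) auto
      ultimately show ?thesis using card_all_edges[of n] unfolding t_def by linarith
    qed
    moreover have "rk (mono_pairs f \<union> E) - rk (mono_pairs f) \<le> m f"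
    proof -
      have "rk (mono_pairs f \<union> E) \<le> d * card {..<n}"
        using E by (intro rk_le) (auto simp: mono_pairs_def all_edges_def)
      moreover have "d * S f \<le> rk (mono_pairs f) + K * d * d"
      proof -
        have "{v \<in> {..<n}. f v \<noteq> 0} = {v \<in> {..<n}. f0 v \<noteq> 0}" using fv by auto
        then show ?thesis using rk_mono_pairs[OF f0(1)] unfolding Mf S_def by simp
      qed
      moreover have "d * n = d * S f + d * (n - S f)"
        using S[of f] by (simp add: add_mult_distrib2[symmetric])
      ultimately show ?thesis unfolding m_def by simp
    qed
    ultimately show ?thesis by blast
  qed
  have "prob_Gnp n p (\<lambda>E. \<not> (\<exists>A. clique E A \<and> (1 - \<eta>) * n \<le> card A))
      \<le> subset_expect p (all_edges n) (\<lambda>E. \<Sum>f\<in>Fs. exp (\<theta> * m f) * ?g f E)"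
  proof (rule prob_Gnp_markov[OF p])
    fix E assume E: "E \<subseteq> all_edges n" and no: "\<not> (\<exists>A. clique E A \<and> (1 - \<eta>) * n \<le> card A)"
    obtain f where f: "f \<in> Fs" "t f \<le> ?cnt f E"
        "rk (mono_pairs f \<union> E) - rk (mono_pairs f) \<le> m f" (is "?r \<le> _")
      using key[OF E no] by blast
    have "1 = exp (\<theta> * m f) * z ^ m f"
      by (simp add: z_def exp_of_nat_mult[symmetric] exp_add[symmetric] mult.commute)
    also have "\<dots> \<le> exp (\<theta> * m f) * z ^ ?r"
      using z f(3) by (intro mult_left_mono power_decreasing) auto
    also have "\<dots> = exp (\<theta> * m f) * ?g f E" using f(2) by simp
    also have "\<dots> \<le> (\<Sum>f\<in>Fs. exp (\<theta> * m f) * ?g f E)"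
      using f(1) finFs z by (intro member_le_sum) auto
    finally show "1 \<le> (\<Sum>f\<in>Fs. exp (\<theta> * m f) * ?g f E)" .
  next
    fix E show "0 \<le> (\<Sum>f\<in>Fs. exp (\<theta> * m f) * ?g f E)"
      using z by (intro sum_nonneg mult_nonneg_nonneg) auto
  qed
  also have "\<dots> = (\<Sum>f\<in>Fs. exp (\<theta> * m f) * subset_expect p (all_edges n) (?g f))"
    unfolding subset_expect_sum subset_expect_cmult ..
  also have "\<dots> \<le> (\<Sum>f\<in>Fs. exp (- (\<kappa>\<^sup>2 / 8 * N)))"
  proof (rule sum_mono)
    fix f assume f: "f \<in> Fs"
    have "subset_expect p (all_edges n) (?g f) \<le> (1 - p + p * z) ^ t f"
      using z p by (intro rank_chernoff finite_all_edges finite_mono_pairs) auto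
    also have "\<dots> \<le> exp (- p * (1 - z)) ^ t f"
    proof (rule power_mono)
      show "1 - p + p * z \<le> exp (- p * (1 - z))"
        using exp_ge_add_one_self[of "- p * (1 - z)"] by (simp add: algebra_simps)
      show "0 \<le> 1 - p + p * z" using p z by (intro add_nonneg_nonneg mult_nonneg_nonneg) auto
    qed
    also have "\<dots> = exp (- p * (1 - z) * t f)" by (simp add: exp_of_nat_mult[symmetric] mult_ac)
    finally have "exp (\<theta> * m f) * subset_expect p (all_edges n) (?g f) \<le>
        exp (\<theta> * m f) * exp (- p * (1 - z) * t f)" by (intro mult_left_mono) auto
    also have "\<dots> = exp (\<kappa> / 2 * m f - p * (1 - exp (- (\<kappa> / 2))) * t f)"
      unfolding exp_add[symmetric] z_def \<theta>_def by simp
    also have "\<dots> \<le> exp (- (\<kappa>\<^sup>2 / 8 * N))"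
    proof -
      have nn: "real (n * (n - 1)) = n * (real n - 1)" using n by (simp add: of_nat_diff)
      \<comment> \<open>Halving loses at most 1 and truncation only enlarges
        \<open>t f\<close>.\<close>
      have "n * (n - 1) \<le> 2 * t f + 1 + card (mono_pairs f) + L" unfolding t_def by linarith
      then have "real (n * (n - 1)) \<le> real (2 * t f + 1 + card (mono_pairs f) + L)" by (rule of_nat_mono)
      then have t: "(n * (real n - 1) - card (mono_pairs f) - L) / 2 - 1 \<le> real (t f)"
        unfolding nn by (simp add: field_simps)
      have M: "real (card (mono_pairs f)) \<le> (1 - \<eta>) * n * S f"
        unfolding S_def using f \<eta> by (intro card_mono_pairs_le) (auto simp: Fs_def)
      have mf: "real (m f) = real d * (real n - real (S f)) + K * d * d"
        using S[of f] by (simp add: m_def of_nat_diff)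
      show ?thesis
        using colouring_exponent[OF n p(1) \<kappa> \<eta> dN[unfolded N_def] Kd[unfolded N_def] L S M t mf]
        by (simp add: N_def)
    qed
    finally show "exp (\<theta> * m f) * subset_expect p (all_edges n) (?g f) \<le> exp (- (\<kappa>\<^sup>2 / 8 * N))" .
  qed
  also have "\<dots> \<le> (real K + 1) ^ n * exp (- (\<kappa>\<^sup>2 / 8 * N))"
    using cFs by (simp add: mult_right_mono)
  finally show ?thesis .
qed

section \<open>From the giant clique to rigidity\<close>

text \<open>Take a largest clique of the closure. If its complement is nonempty, averaging the cut
  edges over it gives a vertex with more than \<open>d\<close> neighbours in the clique. Already
  \<open>d\<close> of them suffice to join it to the whole clique, each further pair completing a
  complete graph on \<open>d + 2\<close> vertices, and this contradicts maximality.\<close>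

lemma rank_full:
  fixes \<eta> :: real
  assumes E: "E \<subseteq> all_edges n" and A0: "clique E A0" "(1 - \<eta>) * n \<le> card A0"
    and d: "d \<le> (1 - \<eta>) * n" "d \<le> n"
    and exp: "\<And>B. B \<subseteq> {..<n} \<Longrightarrow> B \<noteq> {} \<Longrightarrow> card B \<le> \<eta> * n \<Longrightarrow> d * card B < card (E \<inter> edge_cut n B)"
  shows "rk E + (d + 1 choose 2) = d * n"
proof -
  have finE: "finite E" using E finite_all_edges finite_subset by blast
  have "finite {A. clique E A}"
    by (rule finite_subset[of _ "Pow {..<n}"]) (auto simp: clique_def)
  then obtain A where A: "clique E A" "card A0 \<le> card A"
      and max: "\<And>A'. clique E A' \<Longrightarrow> card A' \<le> card A"
    using obtains_MAX[of "{A. clique E A}" card] A0(1)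
    by (metis (mono_tags, lifting) Max_ge empty_iff finite_imageI imageI mem_Collect_eq)
  have An: "A \<subseteq> {..<n}" using A by (simp add: clique_def)
  have finA: "finite A" using An finite_subset by blast
  have dA: "d \<le> card A" using A A0 d by linarith
  define B where "B = {..<n} - A"
  have cB: "card B = n - card A" unfolding B_def using An finA by (simp add: card_Diff_subset)
  have cAn: "card A \<le> n" using An card_mono[of "{..<n}" A] by simp
  have "B = {}"
  proof (rule ccontr)
    assume ne: "B \<noteq> {}"
    have finB: "finite B" by (simp add: B_def)
    have "card B \<le> \<eta> * n" using A A0 cB cAn by (simp add: of_nat_diff algebra_simps)
    then have edge_cut: "d * card B < card (E \<inter> edge_cut n B)" using ne exp[of B] by (auto simp: B_def)
    let ?N = "\<lambda>v. {a \<in> A. (v, a) \<in> E \<or> (a, v) \<in> E}"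
    have "E \<inter> edge_cut n B \<subseteq> (\<lambda>(v, a). (min v a, max v a)) ` (SIGMA v : B. ?N v)"
    proof
      fix e assume e: "e \<in> E \<inter> edge_cut n B"
      obtain x y where xy: "e = (x, y)" "x < y" "y < n" "(x, y) \<in> E" "(x \<in> B) \<noteq> (y \<in> B)"
        using e by (auto simp: edge_cut_def all_edges_def)
      show "e \<in> (\<lambda>(v, a). (min v a, max v a)) ` (SIGMA v : B. ?N v)"
      proof (cases "x \<in> B")
        case True
        then show ?thesis using xy
          by (intro image_eqI[where x = "(x, y)"]) (auto simp: B_def min_def max_def)
      next
        case False
        then show ?thesis using xy
          by (intro image_eqI[where x = "(y, x)"]) (auto simp: B_def min_def max_def)
      qed
    qed
    then have "card (E \<inter> edge_cut n B) \<le> card (SIGMA v : B. ?N v)"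
      using finB finA by (intro surj_card_le) auto
    also have "\<dots> = (\<Sum>v\<in>B. card (?N v))" using finA finB by (simp add: card_SigmaI)
    finally have lt: "d * card B < (\<Sum>v\<in>B. card (?N v))" using edge_cut by simp
    have "\<exists>v\<in>B. d < card (?N v)"
    proof (rule ccontr)
      assume "\<not> ?thesis"
      then have "(\<Sum>v\<in>B. card (?N v)) \<le> (\<Sum>v\<in>B. d)" by (intro sum_mono) (auto simp: not_less)
      then show False using lt by (simp add: mult.commute)
    qed
    then obtain v where v: "v \<in> B" "d < card (?N v)" by blast
    obtain A1 where A1: "A1 \<subseteq> ?N v" "card A1 = d"
      using finite_choice_subset[of "?N v" d] v finA by auto
    have vn: "v < n" "v \<notin> A" using v by (auto simp: B_def)
    let ?W = "FV.span (R ` E)"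
    have AA: "R (a, b) \<in> ?W" if "a \<in> A" "b \<in> A" for a b
      using A(1) that FV.span_zero by (cases "a = b") (auto simp: clique_def cl_def)
    have vA1: "R (v, a) \<in> ?W" if "a \<in> A1" for a
    proof -
      have "(v, a) \<in> E \<or> (a, v) \<in> E" using that A1 by auto
      then have "R (v, a) \<in> R ` E" using rig_vec_sym[of n d q v a] by (metis image_eqI)
      then show ?thesis by (rule FV.span_base)
    qed
    have vA: "R (v, a) \<in> ?W" if a: "a \<in> A" for a
    proof (cases "a \<in> A1")
      case True
      then show ?thesis by (rule vA1)
    next
      case False
      show ?thesis
      proof (rule complete_graph_circuit[OF FV.subspace_span _ A1(2) vn(1)])
        show "A1 \<subseteq> {..<n} - {v, a}" "a < n" "v \<noteq> a" using A1 An vn False a by auto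
        show "R (v, b) \<in> ?W" if "b \<in> A1" for b using that by (rule vA1)
        show "R (a, b) \<in> ?W" if "b \<in> A1" for b using that A1 a by (intro AA) auto
        show "R (b, c) \<in> ?W" if "b \<in> A1" "c \<in> A1" for b c using that A1 by (intro AA) auto
      qed
    qed
    have "clique E (insert v A)"
      unfolding clique_def
    proof (intro conjI ballI impI)
      show "insert v A \<subseteq> {..<n}" using vn An by auto
      fix x y assume xy: "x \<in> insert v A" "y \<in> insert v A" "x \<noteq> y"
      have "R (x, y) \<in> ?W"
        using xy AA vA rig_vec_sym[of n d q x v] by auto
      then show "(x, y) \<in> cl E" using xy vn An by (auto simp: cl_def)
    qed
    then have "card (insert v A) \<le> card A" by (rule max)
    then show False using vn finA by simp
  qed
  then have Aeq: "A = {..<n}" using An by (auto simp: B_def)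
  have "R ` ({..<n} \<times> {..<n}) \<subseteq> FV.span (R ` E)"
  proof
    fix z assume "z \<in> R ` ({..<n} \<times> {..<n})"
    then obtain x y where "z = R (x, y)" "x < n" "y < n" by auto
    then show "z \<in> FV.span (R ` E)"
      using A(1) FV.span_zero by (cases "x = y") (auto simp: Aeq clique_def cl_def)
  qed
  then have "rk ({..<n} \<times> {..<n}) \<le> rk E" using finE by (intro rk_mono)
  moreover have "rk E \<le> rk ({..<n} \<times> {..<n})"
    using E by (intro rk_subset) (auto simp: all_edges_def)
  ultimately show ?thesis using rk_complete[of "{..<n}"] d(2) by simp
qed

end

text \<open>Reduces the quantification over all generic points in \<open>d_rigid\<close> to one
  fixed framework.\<close>

lemma d_rigid_rk:
  assumes "generic n d q" "d < n" "E \<subseteq> all_edges n"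
  shows "d_rigid n d E \<longleftrightarrow> generic_framework.rk n d q E = d * n - (d + 1 choose 2)"
proof -
  interpret generic_framework n d q by unfold_locales (fact assms(1))
  have E: "E \<subseteq> {..<n} \<times> {..<n}" using assms(3) by (auto simp: all_edges_def)
  then have "finite E" by (rule finite_subset) simp
  then have "rig_rank n d E q' = rk E" if "generic n d q'" for q'
    using rig_rank_generic_unique[OF that assms(1) E] rig_rank_eq by simp
  then show ?thesis using assms(1,2) unfolding d_rigid_def by auto
qed

lemma prob_not_rigid_le:
  fixes p \<epsilon> \<eta> :: real and n d s D K :: nat
  defines "N \<equiv> p * (real n)\<^sup>2 / 2" and "L \<equiv> 2 * D * n + 2 * n * ((8 * d + 1) * s)"
  assumes n: "0 < n" and p: "0 \<le> p" "p \<le> 1"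
    and \<eta>: "0 < \<eta>" "\<eta> \<le> 2 * \<epsilon>" "\<eta> \<le> 1"
    and dN: "d * n \<le> (1 - 2 * \<epsilon>) * N" and Kd: "K * d * d \<le> \<eta> / 4 * N"
    and L: "L + n + 2 \<le> \<eta> / 4 * (real n)\<^sup>2"
    and d: "1 \<le> d" "d < n" "d \<le> (1 - \<eta>) * n" and s: "2 * s \<le> D"
    and small: "real n * (1 - real D / (4 * real n)) ^ s < (1 / 2 :: real) ^ d"
    and NB: "(8 * d + 1) * s < D" and K: "n \<le> K * (D - (8 * d + 1) * s)"
  shows "prob_Gnp n p (\<lambda>E. \<not> d_rigid n d E) \<le> (real K + 1) ^ n * exp (- (\<eta>\<^sup>2 / 8 * N)) +
    (exp (n * exp (d * ln 2 - (1 - \<eta>) * n * p / 2)) - 1)"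
proof -
  obtain q where q: "generic n d q" using generic_exists by blast
  interpret generic_framework n d q by unfold_locales (fact q)
  let ?P = "\<lambda>E. \<not> (\<exists>A. clique E A \<and> (1 - \<eta>) * n \<le> card A)"
  let ?Q = "\<lambda>E. \<exists>B\<subseteq>{..<n}. B \<noteq> {} \<and> card B \<le> \<eta> * n \<and> card (E \<inter> edge_cut n B) \<le> d * card B"
  have "prob_Gnp n p (\<lambda>E. \<not> d_rigid n d E) \<le> prob_Gnp n p (\<lambda>E. ?P E \<or> ?Q E)"
  proof (rule prob_Gnp_mono[OF p], rule ccontr)
    fix E assume E: "E \<subseteq> all_edges n" and nr: "\<not> d_rigid n d E" and "\<not> (?P E \<or> ?Q E)"
    then obtain A where A: "clique E A" "(1 - \<eta>) * n \<le> card A" and Q: "\<not> ?Q E" by blast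
    have "rk E + (d + 1 choose 2) = d * n"
    proof (rule rank_full[OF E A])
      fix B assume B: "B \<subseteq> {..<n}" "B \<noteq> {}" "card B \<le> \<eta> * n"
      then have "\<not> card (E \<inter> edge_cut n B) \<le> d * card B" using Q by blast
      then show "d * card B < card (E \<inter> edge_cut n B)" by simp
    qed (use d in auto)
    then have "d_rigid n d E" unfolding d_rigid_rk[OF q d(2) E] by simp
    then show False using nr by simp
  qed
  also have "\<dots> \<le> prob_Gnp n p ?P + prob_Gnp n p ?Q" by (rule prob_Gnp_or[OF p])
  also have "\<dots> \<le> (real K + 1) ^ n * exp (- (\<eta>\<^sup>2 / 8 * N)) +
      (exp (n * exp (d * ln 2 - (1 - \<eta>) * n * p / 2)) - 1)"
  proof (rule add_mono)
    show "prob_Gnp n p ?P \<le> (real K + 1) ^ n * exp (- (\<eta>\<^sup>2 / 8 * N))"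
      unfolding N_def
      \<comment> \<open>The slack \<open>\<kappa>\<close> is taken equal to
        \<open>\<eta>\<close>.\<close>
      by (rule prob_no_giant_clique[OF n p \<eta>(1,2) order_refl \<eta>(3) dN[unfolded N_def]
            Kd[unfolded N_def] L[unfolded L_def] d(1) s small NB K])
    show "prob_Gnp n p ?Q \<le> exp (n * exp (d * ln 2 - (1 - \<eta>) * n * p / 2)) - 1"
      using \<eta>(1) by (intro prob_small_cut[OF p]) simp
  qed
  finally show ?thesis .
qed

section \<open>Above the threshold: too few edges\<close>

lemma prob_many_edges:
  fixes p \<epsilon> :: real
  assumes p: "0 \<le> p" "p \<le> 1" and \<epsilon>: "0 < \<epsilon>" "\<epsilon> < 1"
  shows "prob_Gnp n p (\<lambda>E. (1 + \<epsilon>) * ((real n)\<^sup>2 * p / 2) \<le> card E) \<le> exp (- (\<epsilon>\<^sup>2 / 4 * ((real n)\<^sup>2 * p / 2)))"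
proof -
  \<comment> \<open>Minimiser of the exponent
    \<open>- \<theta> * (1 + \<epsilon>) + \<theta> + \<theta>\<^sup>2\<close>, whose value is then
    \<open>- \<epsilon>\<^sup>2 / 4\<close>.\<close>
  define \<theta> where "\<theta> = \<epsilon> / 2"
  define z where "z = exp \<theta>"
  let ?N = "(real n)\<^sup>2 * p / 2"
  have N: "0 \<le> ?N" using p by simp
  have z: "1 \<le> z" using \<epsilon> by (simp add: z_def \<theta>_def)
  have "prob_Gnp n p (\<lambda>E. (1 + \<epsilon>) * ?N \<le> card E) \<le>
      subset_expect p (all_edges n) (\<lambda>E. exp (- (\<theta> * ((1 + \<epsilon>) * ?N))) * z ^ card (E \<inter> UNIV))"
  proof (rule prob_Gnp_markov[OF p])
    fix E assume "(1 + \<epsilon>) * ?N \<le> card E"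
    then have "\<theta> * ((1 + \<epsilon>) * ?N) \<le> \<theta> * card E" using \<epsilon> by (intro mult_left_mono) (auto simp: \<theta>_def)
    then have "1 \<le> exp (- (\<theta> * ((1 + \<epsilon>) * ?N))) * exp (card E * \<theta>)"
      unfolding exp_add[symmetric] by (simp add: mult.commute)
    then show "1 \<le> exp (- (\<theta> * ((1 + \<epsilon>) * ?N))) * z ^ card (E \<inter> UNIV)"
      by (simp add: z_def exp_of_nat_mult)
  qed (use z in auto)
  also have "\<dots> = exp (- (\<theta> * ((1 + \<epsilon>) * ?N))) * (1 - p + p * z) ^ card (all_edges n)"
    unfolding subset_expect_cmult subset_expect_power[OF finite_all_edges] by simp
  also have "\<dots> \<le> exp (- (\<theta> * ((1 + \<epsilon>) * ?N))) * exp (?N * (z - 1))"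
  proof (intro mult_left_mono)
    have "(1 - p + p * z) ^ card (all_edges n) \<le> exp (p * (z - 1)) ^ card (all_edges n)"
    proof (rule power_mono)
      show "1 - p + p * z \<le> exp (p * (z - 1))"
        using exp_ge_add_one_self[of "p * (z - 1)"] by (simp add: algebra_simps)
      show "0 \<le> 1 - p + p * z" using p z by (intro add_nonneg_nonneg mult_nonneg_nonneg) auto
    qed
    also have "\<dots> = exp (card (all_edges n) * (p * (z - 1)))" by (simp add: exp_of_nat_mult)
    also have "\<dots> \<le> exp (?N * (z - 1))"
    proof -
      have "real (card (all_edges n)) \<le> (real n)\<^sup>2 / 2"
        unfolding card_all_edges_real by (simp add: power2_eq_square mult_left_mono)
      then have "card (all_edges n) * (p * (z - 1)) \<le> (real n)\<^sup>2 / 2 * (p * (z - 1))"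
        using p z by (intro mult_right_mono) auto
      then show ?thesis by (simp add: mult_ac)
    qed
    finally show "(1 - p + p * z) ^ card (all_edges n) \<le> exp (?N * (z - 1))" .
  qed simp
  also have "\<dots> \<le> exp (- (\<epsilon>\<^sup>2 / 4 * ?N))"
  proof -
    have "z \<le> 1 + \<theta> + \<theta>\<^sup>2" unfolding z_def using \<epsilon> by (intro exp_bound) (auto simp: \<theta>_def)
    then have "?N * (z - 1) \<le> ?N * (\<theta> + \<theta>\<^sup>2)" using N by (intro mult_left_mono) auto
    moreover have "- (\<theta> * ((1 + \<epsilon>) * M)) + M * (z - 1) \<le> - (\<epsilon>\<^sup>2 / 4 * M)"
      if "M * (z - 1) \<le> M * (\<theta> + \<theta>\<^sup>2)" for M
      using that by (simp add: \<theta>_def power2_eq_square field_simps)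
    ultimately show ?thesis unfolding exp_add[symmetric] exp_le_cancel_iff by blast
  qed
  finally show ?thesis .
qed

text \<open>Full rank needs \<open>d * (n - (d + 1) / 2)\<close> edges. This grows with
  \<open>d\<close> in the relevant range, so \<open>d\<close> may be lowered to
  \<open>d0 = (1 / 2 + \<epsilon>) * n * p\<close>, where the quadratic correction costs only a
  factor \<open>1 - \<epsilon> / 2\<close>. For \<open>d \<ge> n\<close> the convention demands the
  complete graph, which exceeds the bound since \<open>p \<le> 1 / 4\<close>.\<close>

lemma d_rigid_many_edges:
  fixes p \<epsilon> :: real
  assumes \<epsilon>: "0 < \<epsilon>" "\<epsilon> < 1 / 2" and p: "0 \<le> p" "p \<le> 1 / 4" and n: "2 \<le> n" "n * p + 1 \<le> \<epsilon> * n"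
    and d: "(1 / 2 + \<epsilon>) * n * p < d" and E: "E \<subseteq> all_edges n" and rigid: "d_rigid n d E"
  shows "(1 + \<epsilon>) * ((real n)\<^sup>2 * p / 2) \<le> card E"
proof (cases "d < n")
  case False
  then have "E = all_edges n" using rigid by (simp add: d_rigid_def)
  then have "real (card E) = real n * (real n - 1) / 2" by (simp only: card_all_edges_real)
  moreover have "(1 + \<epsilon>) * ((real n)\<^sup>2 * p / 2) \<le> 2 * ((real n)\<^sup>2 * (1 / 4) / 2)"
  proof -
    have "4 * (p * (real n)\<^sup>2) \<le> (real n)\<^sup>2" using mult_right_mono[OF p(2), of "(real n)\<^sup>2"] by simp
    then show ?thesis using \<epsilon> p by (intro mult_mono) auto
  qed
  moreover have "(real n)\<^sup>2 / 4 \<le> real n * (real n - 1) / 2"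
  proof -
    have "0 \<le> real n * (real n - 2)" using n(1) by (intro mult_nonneg_nonneg) auto
    then show ?thesis by (simp add: power2_eq_square algebra_simps)
  qed
  ultimately show ?thesis by linarith
next
  case True
  obtain q where q: "generic n d q" using generic_exists by blast
  interpret generic_framework n d q by unfold_locales (fact q)
  have finE: "finite E" using E finite_all_edges finite_subset by blast
  have "rk E \<le> card (R ` E)"
    unfolding rk_def using finE by (intro FV.dim_le_card) (auto intro: FV.span_base)
  also have "\<dots> \<le> card E" using finE by (rule card_image_le)
  finally have "d * n - (d + 1 choose 2) \<le> card E"
    using rigid d_rigid_rk[OF q True E] by simp
  then have "real (d * n) \<le> real (card E) + real (d + 1 choose 2)" by linarith
  moreover have "real (d + 1 choose 2) = d * (real d + 1) / 2"
  proof -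
    have "even (Suc d * d)" by simp
    then have "real (Suc d * d div 2) = real (Suc d * d) / 2"
      using real_of_nat_div[of 2 "Suc d * d"] by simp
    then show ?thesis by (simp add: choose_two algebra_simps)
  qed
  ultimately have "real d * real n \<le> real (card E) + d * (real d + 1) / 2" by simp
  then have card: "d * (n - (real d + 1) / 2) \<le> card E" by (simp add: field_simps)
  define d0 where "d0 = (1 / 2 + \<epsilon>) * n * p"
  have d0: "0 \<le> d0" "d0 \<le> n * p" "d0 \<le> d"
    using \<epsilon> p d mult_right_mono[of "1 / 2 + \<epsilon>" 1 "n * p"] by (auto simp: d0_def mult_ac)
  have d0n: "d0 + 1 \<le> \<epsilon> * n" using d0 n(2) by simp
  have "(1 + \<epsilon>) * ((real n)\<^sup>2 * p / 2) \<le> d0 * (n - (d0 + 1) / 2)"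
  proof -
    \<comment> \<open>This is exactly the surplus of
      \<open>(1 / 2 + \<epsilon>) * (1 - \<epsilon> / 2)\<close> over
      \<open>(1 + \<epsilon>) / 2\<close>, nonnegative because
      \<open>\<epsilon> < 1 / 2\<close>.\<close>
    have "0 \<le> (\<epsilon> / 4 - \<epsilon>\<^sup>2 / 2) * ((real n)\<^sup>2 * p)"
      using \<epsilon> p by (intro mult_nonneg_nonneg) (auto simp: power2_eq_square)
    then have "(1 + \<epsilon>) * ((real n)\<^sup>2 * p / 2) \<le> d0 * (n - \<epsilon> * n / 2)"
      by (simp add: d0_def power2_eq_square field_simps)
    also have "\<dots> \<le> d0 * (n - (d0 + 1) / 2)" using d0 d0n by (intro mult_left_mono) auto
    finally show ?thesis .
  qed
  also have "\<dots> \<le> d * (n - (real d + 1) / 2)"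
  proof -
    have "\<epsilon> * n \<le> 1 * real n" using \<epsilon> by (intro mult_right_mono) auto
    \<comment> \<open>The difference of the two edge counts in factored form.\<close>
    then have "0 \<le> (d - d0) * (n - (d + d0 + 1) / 2)"
      using d0 d0n True by (intro mult_nonneg_nonneg) auto
    then show ?thesis by (simp add: field_simps)
  qed
  finally show ?thesis using card by simp
qed

section \<open>The two limits\<close>

lemma C_star_pos: "0 < C_star"
  using ln_2_less_1 by (simp add: C_star_def)

text \<open>The lower bound on \<open>p\<close> makes n^2 p, and with it the Chernoff exponent, tend
  to infinity. The upper bound makes n p small against n, so that the binomial term in the full rank
  is negligible.\<close>

lemma not_rigid_limit:
  fixes p :: "nat \<Rightarrow> real" and \<epsilon> :: real and d :: "nat \<Rightarrow> nat"
  assumes p01: "\<forall>n. 0 \<le> p n \<and> p n \<le> 1"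
    and plow: "eventually (\<lambda>n. C_star * ln (real n) / real n \<le> p n) sequentially"
    and psmall: "p \<in> o(\<lambda>n. 1 / sqrt (real n))"
    and \<epsilon>: "0 < \<epsilon>" "\<epsilon> < 1 / 2"
    and dlow: "eventually (\<lambda>n. real (d n) > (1/2 + \<epsilon>) * real n * p n) sequentially"
  shows "(\<lambda>n. prob_Gnp n (p n) (d_rigid n (d n))) \<longlonglongrightarrow> 0"
proof (rule tendsto_sandwich[OF _ _ tendsto_const])
  show "eventually (\<lambda>n. 0 \<le> prob_Gnp n (p n) (d_rigid n (d n))) sequentially"
    using p01 by (intro always_eventually allI prob_Gnp_nonneg) auto
  have "0 < \<epsilon> / 2" using \<epsilon> by simp
  from landau_o.smallD[OF psmall this]
  have pc: "eventually (\<lambda>n. p n \<le> \<epsilon> / 2 / sqrt n) sequentially"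
    by eventually_elim (use p01 in auto)
  have "eventually (\<lambda>n. \<epsilon> / 2 / sqrt (real n) \<le> 1 / 4) sequentially"
    "eventually (\<lambda>n. n * (\<epsilon> / 2 / sqrt (real n)) + 1 \<le> \<epsilon> * n) sequentially"
    using \<epsilon> by real_asymp+
  then show "eventually (\<lambda>n. prob_Gnp n (p n) (d_rigid n (d n)) \<le>
      exp (- (\<epsilon>\<^sup>2 / 8 * (C_star * (n * ln n))))) sequentially"
    using pc plow dlow eventually_ge_at_top[of 2]
  proof eventually_elim
    case (elim n)
    have p: "0 \<le> p n" "p n \<le> 1" using p01 by auto
    have "n * p n \<le> n * (\<epsilon> / 2 / sqrt (real n))" using elim \<epsilon> by (intro mult_left_mono) auto
    then have n: "n * p n + 1 \<le> \<epsilon> * n" "p n \<le> 1 / 4" using elim \<epsilon> by linarith+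
    have "prob_Gnp n (p n) (d_rigid n (d n)) \<le>
        prob_Gnp n (p n) (\<lambda>E. (1 + \<epsilon>) * ((real n)\<^sup>2 * p n / 2) \<le> card E)"
      using d_rigid_many_edges[OF \<epsilon> p(1) n(2) elim(6) n(1) elim(5)]
      by (intro prob_Gnp_mono[OF p]) auto
    also have "\<dots> \<le> exp (- (\<epsilon>\<^sup>2 / 4 * ((real n)\<^sup>2 * p n / 2)))"
      using \<epsilon> by (intro prob_many_edges[OF p]) auto
    also have "\<dots> \<le> exp (- (\<epsilon>\<^sup>2 / 8 * (C_star * (n * ln n))))"
    proof -
      have "C_star * (n * ln n) = (real n)\<^sup>2 * (C_star * ln n / n)"
        using elim by (simp add: power2_eq_square)
      also have "\<dots> \<le> (real n)\<^sup>2 * p n" using elim by (intro mult_left_mono) auto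
      finally have "\<epsilon>\<^sup>2 / 8 * (C_star * (n * ln n)) \<le> \<epsilon>\<^sup>2 / 8 * ((real n)\<^sup>2 * p n)"
        by (intro mult_left_mono) auto
      then show ?thesis by simp
    qed
    finally show ?case .
  qed
  show "(\<lambda>n. exp (- (\<epsilon>\<^sup>2 / 8 * (C_star * (real n * ln (real n)))))) \<longlonglongrightarrow> 0"
    using \<epsilon> C_star_pos by real_asymp
qed

lemma rigid_limit:
  fixes p :: "nat \<Rightarrow> real" and \<epsilon> :: real and d :: "nat \<Rightarrow> nat"
  assumes p01: "\<forall>n. 0 \<le> p n \<and> p n \<le> 1"
    and plow: "eventually (\<lambda>n. C_star * ln (real n) / real n \<le> p n) sequentially"
    and psmall: "p \<in> o(\<lambda>n. 1 / sqrt (real n))"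
    and \<epsilon>: "0 < \<epsilon>" "\<epsilon> < 1 / 2"
    and dup: "eventually (\<lambda>n. 1 \<le> d n \<and> real (d n) < (1/2 - \<epsilon>) * real n * p n) sequentially"
  shows "(\<lambda>n. prob_Gnp n (p n) (d_rigid n (d n))) \<longlonglongrightarrow> 1"
proof -
  \<comment> \<open>Since \<open>d < (1 / 2 - \<epsilon>) * n * p\<close>, the exponent in the cut
    bound gains \<open>\<epsilon> * ln 2 * n * p\<close>. Excluding sets larger than
    \<open>\<eta> * n\<close> costs \<open>\<eta> / 2 * n * p\<close>; this \<open>\<eta>\<close>
    spends half of the gain.\<close>
  define \<eta> where "\<eta> = \<epsilon> * ln 2"
  \<comment> \<open>With \<open>D\<close> about \<open>\<delta> * n\<close> and
    \<open>b \<le> D / 2\<close> the discarded pairs number at most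
    \<open>3 * \<delta> * n\<^sup>2\<close>, within the budget
    \<open>\<eta> / 4 * n\<^sup>2\<close>.\<close>
  define \<delta> where "\<delta> = \<eta> / 32"
  \<comment> \<open>Chosen to make the quadratic part \<open>72 * c\<^sup>2 / \<delta>\<close> of
    the bound on \<open>b\<close> equal to \<open>\<delta> / 8\<close>.\<close>
  define c where "c = \<delta> / 24"
  \<comment> \<open>Classes have at least \<open>D - b \<ge> \<delta> / 4 * n\<close>
    vertices.\<close>
  define K where "K = nat \<lceil>4 / \<delta>\<rceil>"
  have ln2: "0 < ln (2::real)" "ln (2::real) < 1" using ln_2_less_1 by auto
  have \<eta>: "0 < \<eta>" "\<eta> < 1 / 2" "\<eta> \<le> \<epsilon>"
    using \<epsilon> ln2 mult_strict_mono[of \<epsilon> "1 / 2" "ln 2" 1] mult_left_mono[of "ln 2" 1 \<epsilon>]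
    by (auto simp: \<eta>_def)
  have \<delta>: "0 < \<delta>" "\<delta> < 1" using \<eta> by (auto simp: \<delta>_def)
  have c: "0 < c" using \<delta> by (simp add: c_def)
  have K: "4 / \<delta> \<le> real K" unfolding K_def by linarith
  let ?b1 = "\<lambda>n. (real K + 1) ^ n * exp (- (\<eta>\<^sup>2 / 16 * (C_star * (real n * ln (real n)))))"
  let ?b2 = "\<lambda>n. exp (exp (- (C_star * \<eta> / 2 * ln (real n)))) - 1"
  have pc: "eventually (\<lambda>n. p n \<le> c / sqrt n) sequentially"
    using landau_o.smallD[OF psmall c] by eventually_elim (use p01 in auto)
  have asym: "eventually (\<lambda>n. 9 * (c * sqrt (real n)) * (8 / \<delta> * ln (real n) + 2) \<le> \<delta> / 8 * n) sequentially"
    "eventually (\<lambda>n. real n + 2 \<le> \<eta> / 32 * (real n)\<^sup>2) sequentially"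
    "eventually (\<lambda>n. 1 \<le> \<delta> / 2 * real n) sequentially"
    "eventually (\<lambda>n. real K * (c * sqrt (real n)) \<le> \<eta> / 8 * n) sequentially"
    using c \<delta> \<eta> by real_asymp+
  have up: "eventually (\<lambda>n. prob_Gnp n (p n) (\<lambda>E. \<not> d_rigid n (d n) E) \<le> ?b1 n + ?b2 n) sequentially"
    using asym pc plow dup eventually_ge_at_top[of 2]
  proof eventually_elim
    case (elim n)
    note n2 = \<open>2 \<le> n\<close>
    \<comment> \<open>Each greedy step shrinks the potential by a factor of at most
      \<open>exp (- (\<delta> / 8))\<close>, so this many steps bring it from \<open>n\<close> below
      \<open>exp (- d)\<close>, hence below \<open>(1 / 2) ^ d\<close>. The \<open>+ 1\<close> makes
      the comparison strict.\<close>
    define s where "s = nat \<lceil>8 / \<delta> * (ln n + d n)\<rceil> + 1"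
    define D where "D = nat \<lfloor>\<delta> * n\<rfloor>"
    define N where "N = p n * (real n)\<^sup>2 / 2"
    define b where "b = (8 * d n + 1) * s"
    have p: "0 \<le> p n" "p n \<le> 1" using p01 by auto
    have d: "1 \<le> d n" "real (d n) < (1 / 2 - \<epsilon>) * n * p n" using elim by auto
    have np: "0 \<le> n * p n" "n * p n \<le> n" using p mult_left_mono[OF p(2), of "real n"] by auto
    have "(1 / 2 - \<epsilon>) * (n * p n) \<le> 1 / 2 * (n * p n)" using np \<epsilon> by (intro mult_right_mono) auto
    then have dnp: "real (d n) \<le> n * p n / 2" using d by (simp add: mult.assoc)
    have dn: "d n < n" using dnp np n2 by linarith
    have "n * p n \<le> n * (c / sqrt n)" using elim by (intro mult_left_mono) auto
    also have "\<dots> = c * sqrt n" using n2 by (simp add: field_simps real_sqrt_mult_self)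
    finally have dc: "real (d n) \<le> c * sqrt n" using dnp np by linarith
    have lnn: "0 \<le> ln (real n)" using n2 by simp
    have s_gt: "8 / \<delta> * (ln n + d n) < real s" unfolding s_def by linarith
    have "0 \<le> 8 / \<delta> * (ln n + d n)" using \<delta> lnn by simp
    then have s_le: "real s \<le> 8 / \<delta> * (ln n + d n) + 2" unfolding s_def by linarith
    have D_le: "real D \<le> \<delta> * n" using \<delta> by (simp add: D_def)
    have "\<delta> * n - 1 \<le> real D" unfolding D_def by linarith
    then have D_ge: "\<delta> / 2 * n \<le> real D" using elim by linarith
    \<comment> \<open>Here \<open>d\<close> of order below \<open>sqrt n\<close> is essential:
      \<open>b\<close> is of order \<open>d * (d + ln n)\<close>. One half of the allowance covers
      the \<open>d\<^sup>2\<close> term, the other the logarithmic one.\<close>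
    have b_le: "real b \<le> \<delta> / 4 * n"
    proof -
      have "b \<le> 9 * d n * s" unfolding b_def using d(1) by (intro mult_right_mono) auto
      then have "real b \<le> real (9 * d n * s)" by (rule of_nat_mono)
      also have "\<dots> = (9 * real (d n)) * s" by simp
      also have "\<dots> \<le> (9 * (c * sqrt n)) * (8 / \<delta> * (ln n + c * sqrt n) + 2)"
      proof (intro mult_mono)
        have "8 / \<delta> * (ln n + d n) \<le> 8 / \<delta> * (ln n + c * sqrt n)"
          using \<delta> dc by (intro mult_left_mono) auto
        then show "real s \<le> 8 / \<delta> * (ln n + c * sqrt n) + 2" using s_le by linarith
      qed (use dc c in auto)
      also have "\<dots> = 9 * (c * sqrt n) * (8 / \<delta> * ln n + 2) + 72 * c\<^sup>2 / \<delta> * n"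
        by (simp add: algebra_simps power2_eq_square)
      also have "72 * c\<^sup>2 / \<delta> = \<delta> / 8" using \<delta> by (simp add: c_def power2_eq_square)
      finally show ?thesis using elim by simp
    qed
    then have bD: "2 * real b \<le> D" using D_ge by linarith
    have bpos: "9 * s \<le> b" unfolding b_def using d by (intro mult_right_mono) auto
    have s0: "0 < s" by (simp add: s_def)
    have "prob_Gnp n (p n) (\<lambda>E. \<not> d_rigid n (d n) E) \<le> (real K + 1) ^ n * exp (- (\<eta>\<^sup>2 / 8 * N)) +
        (exp (n * exp (d n * ln 2 - (1 - \<eta>) * n * p n / 2)) - 1)"
      unfolding N_def
    proof (rule prob_not_rigid_le)
      show "real (d n * n) \<le> (1 - 2 * \<epsilon>) * (p n * (real n)\<^sup>2 / 2)"
        using mult_right_mono[OF less_imp_le[OF d(2)], of "real n"]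
        by (simp add: power2_eq_square algebra_simps)
      show "real (K * d n * d n) \<le> \<eta> / 4 * (p n * (real n)\<^sup>2 / 2)"
      proof -
        have "real (K * d n * d n) = (real K * d n) * d n" by simp
        also have "\<dots> \<le> (real K * (c * sqrt n)) * (n * p n)"
          using dc dnp np c by (intro mult_mono) auto
        also have "\<dots> \<le> (\<eta> / 8 * n) * (n * p n)" using elim np by (intro mult_right_mono) auto
        finally show ?thesis by (simp add: power2_eq_square mult_ac)
      qed
      show "real (2 * D * n + 2 * n * ((8 * d n + 1) * s) + n + 2) \<le> \<eta> / 4 * (real n)\<^sup>2"
      proof -
        have "real (2 * D * n + 2 * n * b) = (2 * real D) * n + (2 * real b) * n" by simp
        also have "\<dots> \<le> 2 * (\<delta> * n) * n + (\<delta> * n) * n"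
        proof (intro add_mono mult_right_mono)
          show "2 * real D \<le> 2 * (\<delta> * n)" "2 * real b \<le> \<delta> * n" using D_le bD by auto
        qed auto
        also have "\<dots> = 3 * \<eta> / 32 * (real n)\<^sup>2" by (simp add: \<delta>_def power2_eq_square)
        finally have "real (2 * D * n + 2 * n * b) \<le> 3 * \<eta> / 32 * (real n)\<^sup>2" .
        moreover have "real n + 2 \<le> \<eta> / 32 * (real n)\<^sup>2" using elim by blast
        moreover have "\<eta> / 32 * (real n)\<^sup>2 + 3 * \<eta> / 32 * (real n)\<^sup>2 \<le> \<eta> / 4 * (real n)\<^sup>2"
          using \<eta> by (simp add: field_simps)
        ultimately have "real (2 * D * n + 2 * n * b) + real n + 2 \<le> \<eta> / 4 * (real n)\<^sup>2" by linarith
        then show ?thesis unfolding b_def by simp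
      qed
      show "real (d n) \<le> (1 - \<eta>) * n"
      proof -
        have "1 / 2 * real n \<le> (1 - \<eta>) * n" using \<eta> by (intro mult_right_mono) auto
        then show ?thesis using dnp np by simp
      qed
      show "2 * s \<le> D" using bpos bD by linarith
      show "(8 * d n + 1) * s < D" using bpos bD s0 unfolding b_def[symmetric] by linarith
      show "n \<le> K * (D - (8 * d n + 1) * s)"
      proof -
        have "b \<le> D" using bD by linarith
        then have "\<delta> / 4 * n \<le> real (D - b)" using bD D_ge by (simp add: of_nat_diff)
        then have "(4 / \<delta>) * (\<delta> / 4 * n) \<le> real K * real (D - b)"
          using K \<delta> by (intro mult_mono) auto
        then have "real n \<le> real (K * (D - b))" using \<delta> by simp
        then show ?thesis unfolding b_def of_nat_le_iff .
      qed
      show "real n * (1 - real D / (4 * real n)) ^ s < (1 / 2) ^ d n"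
      proof -
        have Dn: "\<delta> / 8 \<le> real D / (4 * real n)" "real D / (4 * real n) \<le> 1"
        proof -
          have "\<delta> * n \<le> 1 * real n" using \<delta> by (intro mult_right_mono) auto
          then have "real D \<le> 4 * real n" using D_le by linarith
          then show "\<delta> / 8 \<le> real D / (4 * real n)" "real D / (4 * real n) \<le> 1"
            using D_ge n2 by (auto simp: field_simps)
        qed
        have "(1 - real D / (4 * real n)) ^ s \<le> exp (- (\<delta> / 8)) ^ s"
          using Dn exp_ge_add_one_self[of "- (\<delta> / 8)"] by (intro power_mono) auto
        also have "\<dots> = exp (- (\<delta> / 8 * s))" by (simp add: exp_of_nat_mult[symmetric] mult.commute)
        also have "\<dots> < exp (- (ln n + d n))"
          using s_gt \<delta> by (simp add: field_simps)
        finally have "real n * (1 - real D / (4 * real n)) ^ s < n * exp (- (ln n + d n))"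
          using n2 by (intro mult_strict_left_mono) auto
        also have "\<dots> = exp (- real (d n))" using n2 by (simp add: exp_diff exp_minus exp_add field_simps)
        also have "\<dots> \<le> exp (- (d n * ln 2))" using ln2 mult_left_mono[of "ln 2" 1 "real (d n)"] by simp
        also have "\<dots> = (1 / 2) ^ d n"
          by (simp add: exp_minus exp_of_nat_mult power_one_over inverse_eq_divide)
        finally show ?thesis .
      qed
    qed (use n2 p \<eta> d dn in auto)
    also have "\<dots> \<le> ?b1 n + ?b2 n"
    proof (intro add_mono diff_mono order_refl)
      have Cln: "C_star * ln n \<le> n * p n" using elim n2 by (simp add: field_simps)
      show "(real K + 1) ^ n * exp (- (\<eta>\<^sup>2 / 8 * N)) \<le> ?b1 n"
      proof -
        have "\<eta>\<^sup>2 / 16 * n * (C_star * ln n) \<le> \<eta>\<^sup>2 / 16 * n * (n * p n)"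
          using Cln by (intro mult_left_mono) auto
        then show ?thesis
          by (intro mult_left_mono) (auto simp: N_def power2_eq_square mult_ac)
      qed
      \<comment> \<open>The coefficient \<open>(1 - ln 2) / 2 = 1 / C_star\<close> of n p just
        cancels the factor \<open>n\<close> at the critical density; the remaining
        \<open>\<eta> / 2\<close> gives a negative power of \<open>n\<close>.\<close>
      have "n * exp (d n * ln 2 - (1 - \<eta>) * n * p n / 2) \<le> exp (- (C_star * \<eta> / 2 * ln n))"
      proof -
        have "d n * ln 2 \<le> (1 / 2 - \<epsilon>) * n * p n * ln 2" using d ln2 by (intro mult_right_mono) auto
        then have "d n * ln 2 - (1 - \<eta>) * n * p n / 2 \<le> - ((1 / C_star + \<eta> / 2) * (n * p n))"
          by (simp add: C_star_def \<eta>_def field_simps)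
        also have "\<dots> \<le> - ((1 / C_star + \<eta> / 2) * (C_star * ln n))"
          using Cln C_star_pos \<eta> by (simp add: mult_left_mono)
        also have "\<dots> = - ln n - C_star * \<eta> / 2 * ln n"
          using C_star_pos by (simp add: field_simps)
        finally have "n * exp (d n * ln 2 - (1 - \<eta>) * n * p n / 2) \<le>
            n * exp (- ln n - C_star * \<eta> / 2 * ln n)" by (intro mult_left_mono) auto
        also have "n * exp (- ln n - x) = exp (- x)" for x
          using n2 unfolding diff_conv_add_uminus exp_add by (simp add: exp_minus)
        finally show ?thesis .
      qed
      then show "exp (n * exp (d n * ln 2 - (1 - \<eta>) * n * p n / 2)) \<le>
          exp (exp (- (C_star * \<eta> / 2 * ln n)))" by simp
    qed
    finally show ?case .
  qed
  have lim: "(\<lambda>n. ?b1 n + ?b2 n) \<longlonglongrightarrow> 0"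
  proof -
    \<comment> \<open>\<open>K\<close> does not depend on \<open>n\<close>, so
      \<open>n * ln (K + 1)\<close> loses against a multiple of \<open>n * ln n\<close>.\<close>
    have lim1: "?b1 \<longlonglongrightarrow> 0"
    proof (rule Lim_transform_eventually)
      have K0: "0 < real K + 1" by simp
      define l where "l = ln (real K + 1)"
      define a where "a = \<eta>\<^sup>2 / 16 * C_star"
      have "0 < a" using \<eta> C_star_pos by (simp add: a_def)
      then show "(\<lambda>n. exp (real n * l - a * (real n * ln (real n)))) \<longlonglongrightarrow> 0" by real_asymp
      have "exp (real n * l - a * (real n * ln (real n))) = ?b1 n" for n
      proof -
        have "exp (real n * l) = (real K + 1) ^ n" using K0 by (simp add: l_def exp_of_nat_mult)
        then show ?thesis unfolding diff_conv_add_uminus exp_add by (simp add: a_def mult_ac)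
      qed
      then show "eventually (\<lambda>n. exp (real n * l - a * (real n * ln (real n))) = ?b1 n) sequentially"
        by simp
    qed
    have lim2: "?b2 \<longlonglongrightarrow> 0"
    proof -
      define a where "a = C_star * \<eta> / 2"
      have "0 < a" using \<eta> C_star_pos by (simp add: a_def)
      then have "(\<lambda>n. exp (exp (- (a * ln (real n)))) - 1) \<longlonglongrightarrow> 0" by real_asymp
      then show ?thesis by (simp add: a_def)
    qed
    from tendsto_add[OF lim1 lim2] show ?thesis by (simp only: add_0)
  qed
  have lo: "eventually (\<lambda>n. 0 \<le> prob_Gnp n (p n) (\<lambda>E. \<not> d_rigid n (d n) E)) sequentially"
    using p01 by (intro always_eventually allI prob_Gnp_nonneg) auto
  have "(\<lambda>n. prob_Gnp n (p n) (\<lambda>E. \<not> d_rigid n (d n) E)) \<longlonglongrightarrow> 0"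
    by (rule tendsto_sandwich[OF lo up tendsto_const lim])
  then have "(\<lambda>n. 1 - prob_Gnp n (p n) (\<lambda>E. \<not> d_rigid n (d n) E)) \<longlonglongrightarrow> 1 - 0"
    by (intro tendsto_diff tendsto_const)
  moreover have "prob_Gnp n (p n) (d_rigid n (d n)) =
      1 - prob_Gnp n (p n) (\<lambda>E. \<not> d_rigid n (d n) E)" for n
    by (rule prob_Gnp_compl)
  ultimately show ?thesis by simp
qed

theorem theoremB:
  fixes p :: "nat \<Rightarrow> real" and \<epsilon> :: real
  assumes "\<forall>n. 0 \<le> p n \<and> p n \<le> 1"
    and "eventually (\<lambda>n. C_star * ln (real n) / real n \<le> p n) sequentially"
    and "p \<in> o(\<lambda>n. 1 / sqrt (real n))"
    and "0 < \<epsilon>" and "\<epsilon> < 1/2"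
  shows "(\<forall>d :: nat \<Rightarrow> nat.
            eventually (\<lambda>n. 1 \<le> d n \<and> real (d n) < (1/2 - \<epsilon>) * real n * p n) sequentially
            \<longrightarrow> (\<lambda>n. prob_Gnp n (p n) (d_rigid n (d n))) \<longlonglongrightarrow> 1)
       \<and> (\<forall>d :: nat \<Rightarrow> nat.
            eventually (\<lambda>n. real (d n) > (1/2 + \<epsilon>) * real n * p n) sequentially
            \<longrightarrow> (\<lambda>n. prob_Gnp n (p n) (d_rigid n (d n))) \<longlonglongrightarrow> 0)"
  using rigid_limit[OF assms] not_rigid_limit[OF assms] by blast

end
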